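(* Let $N\ge 1$ be an integer and $R>0$. The average number $$\sum_{i=0}^\infty i\cdot A_i(N)$$ of intersection points of pairs of curves $(f,g)\in B(N,R)\times B(N,R)$ is equal to $$\frac{2^{8N+3}\,((2N)!)^4}{((4N+1)!)^2}\left(1+4+\cdots+N^2\right).$$
   Context: For a natural number $N$, let $V_N$ be the $2(2N+1)$-dimensional real vector space of maps $f=(x,y):S^1=\mathbb{R}/2\pi\mathbb{Z}\to\mathbb{R}^2$ whose two components are trigonometric polynomials of degree $\le N$: $x(\varphi)=a_0+\sum_{j=1}^N(a_j\cos j\varphi+b_j\sin j\varphi)$, $y(\varphi)=\tilde a_0+\sum_{j=1}^N(\tilde a_j\cos j\varphi+\tilde b_j\sin j\varphi)$, with real coefficients. Equip $V_N$ with the Euclidean ($L_2$) structure in which the dot product of $(x_1,y_1)$ and $(x_2,y_2)$ is $\frac1\pi\int_0^{2\pi}(x_1x_2+y_1y_2)\,d\varphi$; equivalently, the squared norm of $f$ is $2(a_0^2+\tilde a_0^2)+\sum_{j=1}^N(a_j^2+b_j^2+\tilde a_j^2+\tilde b_j^2)$. Let $B(N,R)\subset V_N$ be the ball of radius $R$ centered at $0$, and $B^2(N,R)=B(N,R)\times B(N,R)\subset V_N\oplus V_N$, with the Euclidean volume of the direct sum. The number of intersection points of a pair of curves $(f,g)$ is the number of pairs $(\varphi,\psi)\in S^1\times S^1$ with $f(\varphi)=g(\psi)$; for almost all pairs this is finite and agrees with the number of common points of the two plane curves. Let $A_i(N)$ be the volume of the set of pairs $(f,g)\in B^2(N,R)$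 with exactly $i$ intersection points, divided by the volume of $B^2(N,R)$; by scaling this does not depend on $R$. *)

theory Defs
  imports "HOL-Analysis.Analysis"
begin

text \<open>
  Maps from the circle of length \<open>2 * pi\<close> to the plane are represented by \<open>2 * pi\<close>-periodic
  functions on the real line.
\<close>

definition trig_polys :: "nat \<Rightarrow> (real \<Rightarrow> real) set" where
  "trig_polys N = {p. \<exists>a b :: nat \<Rightarrow> real. \<forall>\<phi>.
     p \<phi> = a 0 + (\<Sum>j=1..N. a j * cos (real j * \<phi>) + b j * sin (real j * \<phi>))}"

definition curves :: "nat \<Rightarrow> (real \<Rightarrow> real \<times> real) set" where
  "curves N = {f. (\<lambda>\<phi>. fst (f \<phi>)) \<in> trig_polys N \<and> (\<lambda>\<phi>. snd (f \<phi>)) \<in> trig_polys N}"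

definition curve_inner :: "(real \<Rightarrow> real \<times> real) \<Rightarrow> (real \<Rightarrow> real \<times> real) \<Rightarrow> real" where
  "curve_inner f g = 1 / pi * integral {0..2 * pi} (\<lambda>\<phi>. f \<phi> \<bullet> g \<phi>)"

definition curve_ball :: "nat \<Rightarrow> real \<Rightarrow> (real \<Rightarrow> real \<times> real) set" where
  "curve_ball N R = {f \<in> curves N. sqrt (curve_inner f f) \<le> R}"

text \<open>
  The Euclidean volume on \<^term>\<open>curves N\<close> is the image of Lebesgue measure on the coordinate
  space under an orthonormal basis of \<^term>\<open>curves N\<close> with respect to \<^const>\<open>curve_inner\<close>:
  the scalar functions \<open>1 / sqrt 2\<close>, \<open>cos (j * \<phi>)\<close> (index \<open>j > 0\<close>) and \<open>sin (j * \<phi>)\<close>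
  (index \<open>- j < 0\<close>), multiplied by the two standard unit vectors of the plane. The lemmas
  \<open>curve_inner_basis\<close> and \<open>space_curve_volume\<close> below confirm this.
\<close>

definition trig_basis :: "int \<Rightarrow> real \<Rightarrow> real" where
  "trig_basis k \<phi> =
     (if k = 0 then 1 / sqrt 2
      else if k > 0 then cos (of_int k * \<phi>)
      else sin (of_int (- k) * \<phi>))"

definition curve_basis :: "int \<times> (real \<times> real) \<Rightarrow> real \<Rightarrow> real \<times> real" where
  "curve_basis i \<phi> = trig_basis (fst i) \<phi> *\<^sub>R snd i"

definition curve_index :: "nat \<Rightarrow> (int \<times> (real \<times> real)) set" where
  "curve_index N = {- int N..int N} \<times> Basis"

definition curve_of :: "nat \<Rightarrow> (int \<times> (real \<times> real) \<Rightarrow> real) \<Rightarrow> real \<Rightarrow> real \<times> real" where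
  "curve_of N c \<phi> = (\<Sum>i\<in>curve_index N. c i *\<^sub>R curve_basis i \<phi>)"

definition curve_volume :: "nat \<Rightarrow> (real \<Rightarrow> real \<times> real) measure" where
  "curve_volume N = embed_measure (\<Pi>\<^sub>M i\<in>curve_index N. lborel) (curve_of N)"

definition curve_pair_volume ::
    "nat \<Rightarrow> ((real \<Rightarrow> real \<times> real) \<times> (real \<Rightarrow> real \<times> real)) measure" where
  "curve_pair_volume N = curve_volume N \<Otimes>\<^sub>M curve_volume N"

definition intersection_points ::
    "(real \<Rightarrow> real \<times> real) \<Rightarrow> (real \<Rightarrow> real \<times> real) \<Rightarrow> (real \<times> real) set" where
  "intersection_points f g =
     {(\<phi>, \<psi>). \<phi> \<in> {0..<2 * pi} \<and> \<psi> \<in> {0..<2 * pi} \<and> f \<phi> = g \<psi>}"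

text \<open>
  Since \<^const>\<open>card\<close> is 0 on infinite sets, finiteness has to be required explicitly.
\<close>

definition intersection_fraction :: "nat \<Rightarrow> real \<Rightarrow> nat \<Rightarrow> real" where
  "intersection_fraction N R i =
     measure (curve_pair_volume N)
       {(f, g) \<in> curve_ball N R \<times> curve_ball N R.
          finite (intersection_points f g) \<and> card (intersection_points f g) = i}
     / measure (curve_pair_volume N) (curve_ball N R \<times> curve_ball N R)"

lemma has_integral_cos_int:
  "((\<lambda>\<phi>. cos (of_int m * \<phi>)) has_integral (if m = 0 then 2 * pi else 0)) {0..2 * pi}"
proof (cases "m = 0")
  case True
  then show ?thesis using has_integral_const_real[of "1::real" 0 "2 * pi"] by simp
next
  case False
  have "((\<lambda>\<phi>. cos (of_int m * \<phi>)) has_integral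
      (sin (of_int m * (2 * pi)) / of_int m - sin (of_int m * 0) / of_int m)) {0..2 * pi}"
    using False
    by (intro fundamental_theorem_of_calculus)
       (auto intro!: derivative_eq_intros
             simp flip: has_real_derivative_iff_has_vector_derivative)
  then show ?thesis using False sin_int_2pin[of m] by (simp add: mult.commute mult.left_commute)
qed

lemma has_integral_sin_int:
  "((\<lambda>\<phi>. sin (of_int m * \<phi>)) has_integral 0) {0..2 * pi}"
proof (cases "m = 0")
  case True
  then show ?thesis by simp
next
  case False
  have "((\<lambda>\<phi>. sin (of_int m * \<phi>)) has_integral
      (- cos (of_int m * (2 * pi)) / of_int m - (- cos (of_int m * 0) / of_int m))) {0..2 * pi}"
    using False
    by (intro fundamental_theorem_of_calculus)
       (auto intro!: derivative_eq_intros
             simp flip: has_real_derivative_iff_has_vector_derivative)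
  then show ?thesis using False cos_int_2pin[of m] by (simp add: mult.commute mult.left_commute)
qed

lemma has_integral_trig_basis:
  "((\<lambda>\<phi>. trig_basis k \<phi> * trig_basis l \<phi>) has_integral (if k = l then pi else 0)) {0..2 * pi}"
proof -
  have cc: "((\<lambda>\<phi>. cos (of_int m * \<phi>) * cos (of_int n * \<phi>)) has_integral
      ((if m - n = 0 then 2 * pi else 0) + (if m + n = 0 then 2 * pi else 0)) / 2) {0..2 * pi}"
    for m n :: int
    using has_integral_divide[OF has_integral_add[OF has_integral_cos_int[of "m - n"]
        has_integral_cos_int[of "m + n"]], of 2]
    by (simp add: cos_times_cos algebra_simps)
  have ss: "((\<lambda>\<phi>. sin (of_int m * \<phi>) * sin (of_int n * \<phi>)) has_integral
      ((if m - n = 0 then 2 * pi else 0) - (if m + n = 0 then 2 * pi else 0)) / 2) {0..2 * pi}"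
    for m n :: int
    using has_integral_divide[OF has_integral_diff[OF has_integral_cos_int[of "m - n"]
        has_integral_cos_int[of "m + n"]], of 2]
    by (simp add: sin_times_sin algebra_simps)
  have sc: "((\<lambda>\<phi>. sin (of_int m * \<phi>) * cos (of_int n * \<phi>)) has_integral 0) {0..2 * pi}"
    for m n :: int
    using has_integral_divide[OF has_integral_add[OF has_integral_sin_int[of "m + n"]
        has_integral_sin_int[of "m - n"]], of 2]
    by (simp add: sin_times_cos distrib_right left_diff_distrib)
  have cs: "((\<lambda>\<phi>. cos (of_int n * \<phi>) * sin (of_int m * \<phi>)) has_integral 0) {0..2 * pi}"
    for m n :: int
    using sc[of m n] by (simp add: mult.commute)
  define s where "s k = (if k = 0 then 1 / sqrt 2 else 1 :: real)" for k :: int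
  have tb: "trig_basis k \<phi> =
      (if k \<ge> 0 then s k * cos (of_int k * \<phi>) else sin (of_int (- k) * \<phi>))" for k \<phi>
    by (auto simp: trig_basis_def s_def)
  consider "k \<ge> 0" "l \<ge> 0" | "k \<ge> 0" "l < 0" | "k < 0" "l \<ge> 0" | "k < 0" "l < 0" by linarith
  then show ?thesis
  proof cases
    case 1
    have "((\<lambda>\<phi>. (s k * s l) * (cos (of_int k * \<phi>) * cos (of_int l * \<phi>))) has_integral
        (s k * s l) * (((if k - l = 0 then 2 * pi else 0) + (if k + l = 0 then 2 * pi else 0)) / 2))
        {0..2 * pi}"
      by (rule has_integral_mult_right[OF cc])
    moreover have
      "(s k * s l) * (((if k - l = 0 then 2 * pi else 0) + (if k + l = 0 then 2 * pi else 0)) / 2)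
       = (if k = l then pi else 0)"
      using 1 by (auto simp: s_def)
    ultimately show ?thesis using 1 by (simp add: tb mult_ac)
  next
    case 2
    then show ?thesis using has_integral_mult_right[OF cs[of k "- l"], of "s k"]
      by (simp add: tb mult_ac)
  next
    case 3
    then show ?thesis using has_integral_mult_right[OF sc[of "- k" l], of "s l"]
      by (simp add: tb mult_ac)
  next
    case 4
    have "((if - k - - l = 0 then 2 * pi else 0) - (if - k + - l = 0 then 2 * pi else 0)) / 2
        = (if k = l then pi else 0)"
      using 4 by auto
    then show ?thesis using 4 ss[of "- k" "- l"] by (simp add: tb)
  qed
qed

lemma curve_inner_basis:
  assumes "i \<in> curve_index N" "j \<in> curve_index N"
  shows "curve_inner (curve_basis i) (curve_basis j) = (if i = j then 1 else 0)"
proof -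
  obtain k u l v where [simp]: "i = (k, u)" "j = (l, v)" by (metis surj_pair)
  have uv: "u \<in> Basis" "v \<in> Basis" using assms by (auto simp: curve_index_def)
  have "integral {0..2 * pi} (\<lambda>\<phi>. (u \<bullet> v) * (trig_basis k \<phi> * trig_basis l \<phi>))
      = (u \<bullet> v) * (if k = l then pi else 0)"
    by (intro integral_unique has_integral_mult_right has_integral_trig_basis)
  then show ?thesis
    using uv by (simp add: curve_inner_def curve_basis_def mult_ac inner_Basis split: if_splits)
qed

lemma curve_of_eq:
  "curve_of N c \<phi> =
     (\<Sum>k\<in>{- int N..int N}. c (k, (1, 0)) * trig_basis k \<phi>,
      \<Sum>k\<in>{- int N..int N}. c (k, (0, 1)) * trig_basis k \<phi>)"
proof -
  have B: "(Basis :: (real \<times> real) set) = {(1, 0), (0, 1)}"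
    by (auto simp: Basis_prod_def)
  have "curve_of N c \<phi> = (\<Sum>k\<in>{- int N..int N}. \<Sum>u\<in>{(1, 0), (0, 1)}.
      c (k, u) *\<^sub>R curve_basis (k, u) \<phi>)"
    unfolding curve_of_def curve_index_def B
    by (subst sum.cartesian_product) (simp add: split_def)
  then show ?thesis by (simp add: curve_basis_def sum_prod)
qed

lemma trig_basis_sum:
  "(\<Sum>k\<in>{- int N..int N}. d k * trig_basis k \<phi>) =
     d 0 / sqrt 2 +
     (\<Sum>j=1..N. d (int j) * cos (real j * \<phi>) + d (- int j) * sin (real j * \<phi>))"
proof (induction N)
  case 0
  then show ?case by (simp add: trig_basis_def)
next
  case (Suc N)
  have "{- int (Suc N)..int (Suc N)} =
      insert (- int (Suc N)) (insert (int (Suc N)) {- int N..int N})" by auto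
  then show ?case
    using Suc by (simp add: trig_basis_def algebra_simps del: of_nat_Suc)
qed

lemma space_curve_volume: "space (curve_volume N) = curves N"
proof -
  have scalar: "(\<exists>d. \<forall>\<phi>. p \<phi> = (\<Sum>k\<in>{- int N..int N}. d k * trig_basis k \<phi>)) \<longleftrightarrow>
      p \<in> trig_polys N" for p
  proof
    assume "\<exists>d. \<forall>\<phi>. p \<phi> = (\<Sum>k\<in>{- int N..int N}. d k * trig_basis k \<phi>)"
    then obtain d where d: "\<And>\<phi>. p \<phi> = (\<Sum>k\<in>{- int N..int N}. d k * trig_basis k \<phi>)"
      by blast
    show "p \<in> trig_polys N" unfolding trig_polys_def d trig_basis_sum
      by (intro CollectI exI[of _ "\<lambda>j. if j = 0 then d 0 / sqrt 2 else d (int j)"]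
            exI[of _ "\<lambda>j. d (- int j)"])
         (auto simp: d trig_basis_sum intro!: sum.cong)
  next
    assume "p \<in> trig_polys N"
    then obtain a b where ab: "\<And>\<phi>. p \<phi> = a 0 +
        (\<Sum>j=1..N. a j * cos (real j * \<phi>) + b j * sin (real j * \<phi>))"
      by (auto simp: trig_polys_def)
    show "\<exists>d. \<forall>\<phi>. p \<phi> = (\<Sum>k\<in>{- int N..int N}. d k * trig_basis k \<phi>)"
      unfolding trig_basis_sum ab
      by (intro exI[of _ "\<lambda>k. if k = 0 then sqrt 2 * a 0
            else if k > 0 then a (nat k) else b (nat (- k))"])
         (auto intro!: sum.cong)
  qed
  have "space (curve_volume N) = curve_of N ` (curve_index N \<rightarrow>\<^sub>E UNIV)"
    by (simp add: curve_volume_def space_embed_measure space_PiM)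
  also have "\<dots> = range (curve_of N)"
  proof -
    have "curve_of N c = curve_of N (restrict c (curve_index N))" for c
      by (auto simp: curve_of_def fun_eq_iff intro!: sum.cong)
    then show ?thesis by (fastforce simp: PiE_def)
  qed
  also have "\<dots> = curves N"
  proof (intro equalityI subsetI)
    fix f assume "f \<in> range (curve_of N)"
    then show "f \<in> curves N"
      by (auto simp: curves_def curve_of_eq scalar[symmetric])
  next
    fix f assume "f \<in> curves N"
    then obtain d e where de:
      "\<And>\<phi>. fst (f \<phi>) = (\<Sum>k\<in>{- int N..int N}. d k * trig_basis k \<phi>)"
      "\<And>\<phi>. snd (f \<phi>) = (\<Sum>k\<in>{- int N..int N}. e k * trig_basis k \<phi>)"
      unfolding curves_def scalar[symmetric] by auto
    have "f = curve_of N (\<lambda>(k, u). if u = (1, 0) then d k else e k)"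
      by (auto simp: fun_eq_iff curve_of_eq prod_eq_iff de)
    then show "f \<in> range (curve_of N)" by blast
  qed
  finally show ?thesis .
qed

end

theory Submission
  imports Defs
begin

text \<open>
  Fix \<open>f\<close> and all coefficients of \<open>g\<close> except the constant term. The pair \<open>(\<phi>, \<psi>)\<close> is an
  intersection point exactly if the constant term of \<open>g\<close> equals \<open>sqrt 2 * (f \<phi> - g\<^sub>0 \<psi>)\<close>, where
  \<open>g\<^sub>0\<close> is the non-constant part, so integrating the number of intersection points over that
  term is an application of the area formula in the plane. The problem is thereby reduced to
  integrating \<open>2 * \<bar>det (f' \<phi>, g' \<psi>)\<bar>\<close> over the pairs in the ball with \<open>f \<phi> = g \<psi>\<close>. An
  orthogonal change of the coefficients turns the values and the derivatives at \<open>\<phi>\<close> and \<open>\<psi>\<close> into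
  multiples of coordinates (so the result does not depend on \<open>\<phi>\<close> and \<open>\<psi>\<close>), and
  all remaining integrals are volumes of balls of various dimensions. Almost everywhere
  finiteness of the number of intersection points follows from the finiteness of the integral.
\<close>

section \<open>Measurability of the number of zeros\<close>

text \<open>Counts may be infinite, so every integral is taken in \<open>ennreal\<close> by Tonelli,
  and the count must first be shown jointly measurable in both curves. Origin of the constants: a
  rotation of the coefficient pair of frequency \<open>j\<close> splits it into a summand
  \<open>p\<close> of the value and a summand \<open>j * q\<close> of the derivative. So value and
  derivative are orthogonal functionals, and the derivative has squared norm
  \<open>1 + 4 + ... + N^2\<close>, whose root enters once from each curve. Including the constant
  term, the value has squared norm \<open>(2 * N + 1) / 2\<close>, so a component with value
  \<open>w\<close> at a given parameter has squared norm at least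
  \<open>2 * w^2 / (2 * N + 1)\<close>. Fixing the point and splitting off two derivative
  coordinates leaves \<open>4 * N - 2\<close> of the \<open>4 * N + 2\<close> dimensions. The
  determinant acts like three more dimensions for each curve, so the answer compares squared ball
  volumes in the odd dimension \<open>4 * N + 1\<close> and the even dimension
  \<open>4 * N + 2\<close>. With \<open>N = Suc n\<close> the dimensions read
  \<open>4 * n + 2\<close>, \<open>4 * n + 5\<close> and \<open>4 * n + 6\<close>.\<close>

lemma exists_zero_in_sets:
  fixes F :: "'a \<Rightarrow> 'b::{metric_space,second_countable_topology} \<Rightarrow> 'c::real_normed_vector"
  assumes K: "compact K"
    and cont: "\<And>c. c \<in> space M \<Longrightarrow> continuous_on K (F c)"
    and meas [measurable]: "\<And>x. (\<lambda>c. norm (F c x)) \<in> borel_measurable M"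
  shows "{c \<in> space M. \<exists>x\<in>K. F c x = 0} \<in> sets M"
proof -
  obtain T where T: "countable T" "T \<subseteq> K" "K \<subseteq> closure T"
    using separable by blast
  \<comment> \<open>The right-hand side refers to countably many points only. It suffices because
    the norm attains its minimum on the compact set \<open>K\<close>, and that minimum is then below
    every \<open>1 / Suc n\<close>.\<close>
  have "(\<exists>x\<in>K. F c x = 0) \<longleftrightarrow> (\<forall>n::nat. \<exists>x\<in>T. norm (F c x) < 1 / Suc n)" if c: "c \<in> space M" for c
  proof
    assume "\<exists>x\<in>K. F c x = 0"
    then obtain x where x: "x \<in> K" "F c x = 0" by blast
    show "\<forall>n::nat. \<exists>x\<in>T. norm (F c x) < 1 / Suc n"
    proof
      fix n :: nat
      obtain d where d: "d > 0" "\<And>y. y \<in> K \<Longrightarrow> dist y x < d \<Longrightarrow> dist (F c y) (F c x) < 1 / Suc n"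
        using cont[OF c] x(1) unfolding continuous_on_iff by (metis of_nat_0_less_iff zero_less_Suc zero_less_divide_1_iff)
      obtain y where y: "y \<in> T" "dist y x < d"
        using x(1) T(3) d(1) by (meson closure_approachable subsetD)
      with d(2)[of y] T(2) x show "\<exists>x\<in>T. norm (F c x) < 1 / Suc n"
        by (auto simp: dist_norm)
    qed
  next
    assume *: "\<forall>n::nat. \<exists>x\<in>T. norm (F c x) < 1 / Suc n"
    then have ne: "K \<noteq> {}" using T(2) by fast
    have "continuous_on K (\<lambda>x. norm (F c x))" using cont[OF c] by (intro continuous_intros)
    then obtain x where x: "x \<in> K" "\<And>y. y \<in> K \<Longrightarrow> norm (F c x) \<le> norm (F c y)"
      using continuous_attains_inf[OF K ne] by blast
    have "norm (F c x) < 1 / Suc n" for n :: nat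
      using * x(2) T(2) by (meson le_less_trans subsetD)
    then have "\<not> norm (F c x) > 0"
      by (metis nat_approx_posE not_less_iff_gr_or_eq)
    then show "\<exists>x\<in>K. F c x = 0" using x(1) by auto
  qed
  then have "{c \<in> space M. \<exists>x\<in>K. F c x = 0} =
      {c \<in> space M. \<forall>n::nat. \<exists>x\<in>T. norm (F c x) < 1 / Suc n}" by auto
  also have "\<dots> \<in> sets M"
    using T(1) by measurable
  finally show ?thesis .
qed

text \<open>An open set is a countable union of compact sets, hence so is
  \<open>U \<inter> D\<close>, and on each compact piece the previous lemma applies.\<close>

lemma exists_zero_Union_in_sets:
  fixes F :: "'a \<Rightarrow> 'b::euclidean_space \<Rightarrow> 'c::real_normed_vector"
  assumes D: "D = (\<Union>n::nat. C n)" "\<And>n. compact (C n)"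
    and cont: "\<And>c. c \<in> space M \<Longrightarrow> continuous_on UNIV (F c)"
    and meas: "\<And>x. (\<lambda>c. norm (F c x)) \<in> borel_measurable M"
    and U: "open U"
  shows "{c \<in> space M. \<exists>x\<in>U \<inter> D. F c x = 0} \<in> sets M"
proof -
  obtain B :: "nat \<Rightarrow> 'b set" where B: "\<And>n. compact (B n)" "U = (\<Union>n. B n)"
    using open_Union_compact_subsets[OF U] by metis
  have "{c \<in> space M. \<exists>x\<in>U \<inter> D. F c x = 0} =
      (\<Union>m n. {c \<in> space M. \<exists>x\<in>B m \<inter> C n. F c x = 0})"
    unfolding D B by blast
  also have "\<dots> \<in> sets M"
    by (intro sets.countable_UN'' exists_zero_in_sets compact_Int B D meas)
       (auto intro: continuous_on_subset[OF cont])
  finally show ?thesis .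
qed

lemma finite_disjoint_basis_neighbourhoods:
  fixes S :: "'b::metric_space set"
  assumes S: "finite S" and \<B>: "topological_basis \<B>"
  obtains U where "\<And>x. x \<in> S \<Longrightarrow> U x \<in> \<B> \<and> x \<in> U x"
    "\<And>x y. x \<in> S \<Longrightarrow> y \<in> S \<Longrightarrow> x \<noteq> y \<Longrightarrow> U x \<inter> U y = {}"
proof -
  obtain d where d: "\<And>x. x \<in> S \<Longrightarrow> d x > 0" "\<And>x y. x \<in> S \<Longrightarrow> y \<in> S \<Longrightarrow> y \<noteq> x \<Longrightarrow> d x \<le> dist x y"
    using finite_set_avoid[OF S] by metis
  have "\<exists>U. U \<in> \<B> \<and> x \<in> U \<and> U \<subseteq> ball x (d x / 2)" if "x \<in> S" for x
    using topological_basisE[OF \<B>, of "ball x (d x / 2)" x] d(1)[OF that] by (metis centre_in_ball half_gt_zero open_ball)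
  then obtain U where U: "\<And>x. x \<in> S \<Longrightarrow> U x \<in> \<B> \<and> x \<in> U x \<and> U x \<subseteq> ball x (d x / 2)" by metis
  show thesis
  proof (rule that[of U])
    show "x \<in> S \<Longrightarrow> U x \<in> \<B> \<and> x \<in> U x" for x using U by blast
    fix x y assume xy: "x \<in> S" "y \<in> S" "x \<noteq> y"
    show "U x \<inter> U y = {}"
    proof (rule ccontr)
      assume "U x \<inter> U y \<noteq> {}"
      then obtain z where "z \<in> U x" "z \<in> U y" by blast
      then have "dist x z < d x / 2" "dist y z < d y / 2"
        using U[OF xy(1)] U[OF xy(2)] by (meson mem_ball subsetD)+
      moreover have "d x \<le> dist x y" "d y \<le> dist x y"
        using d(2) xy by (metis dist_commute)+
      moreover have "dist x y \<le> dist x z + dist y z" by (metis dist_commute dist_triangle)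
      ultimately show False by linarith
    qed
  qed
qed

text \<open>Having at least \<open>m\<close> zeros amounts to having \<open>m\<close> pairwise
  disjoint members of a countable basis, each of which meets \<open>D\<close> in a zero. There are
  only countably many such families, so the uncountable choice of \<open>S\<close>
  disappears.\<close>

lemma zeros_card_ge_in_sets:
  fixes F :: "'a \<Rightarrow> 'b::euclidean_space \<Rightarrow> 'c::real_normed_vector"
  assumes D: "D = (\<Union>n::nat. C n)" "\<And>n. compact (C n)"
    and cont: "\<And>c. c \<in> space M \<Longrightarrow> continuous_on UNIV (F c)"
    and meas: "\<And>x. (\<lambda>c. norm (F c x)) \<in> borel_measurable M"
  shows "{c \<in> space M. \<exists>S. S \<subseteq> {x \<in> D. F c x = 0} \<and> finite S \<and> card S = m} \<in> sets M"
proof -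
  obtain \<B> :: "'b set set" where \<B>: "countable \<B>" "topological_basis \<B>"
    using ex_countable_basis by blast
  define \<C> where "\<C> = {\<U>. finite \<U> \<and> \<U> \<subseteq> \<B> \<and> card \<U> = m \<and> disjoint \<U>}"
  have cC: "countable \<C>"
    using countable_Collect_finite_subset[OF \<B>(1)] by (rule countable_subset[rotated]) (auto simp: \<C>_def)
  have "(\<exists>S. S \<subseteq> {x \<in> D. F c x = 0} \<and> finite S \<and> card S = m) \<longleftrightarrow>
      (\<exists>\<U>\<in>\<C>. \<forall>U\<in>\<U>. \<exists>x\<in>U \<inter> D. F c x = 0)" for c
  proof
    assume "\<exists>S. S \<subseteq> {x \<in> D. F c x = 0} \<and> finite S \<and> card S = m"
    then obtain S where S: "S \<subseteq> {x \<in> D. F c x = 0}" "finite S" "card S = m" by blast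
    obtain U where U: "\<And>x. x \<in> S \<Longrightarrow> U x \<in> \<B> \<and> x \<in> U x"
      "\<And>x y. x \<in> S \<Longrightarrow> y \<in> S \<Longrightarrow> x \<noteq> y \<Longrightarrow> U x \<inter> U y = {}"
      using finite_disjoint_basis_neighbourhoods[OF S(2) \<B>(2)] by metis
    have "inj_on U S" using U by (intro inj_onI) (metis disjoint_iff)
    then have "U ` S \<in> \<C>"
      using U S unfolding \<C>_def by (auto simp: card_image intro!: disjointI)
    moreover have "\<forall>V\<in>U ` S. \<exists>x\<in>V \<inter> D. F c x = 0" using U S(1) by blast
    ultimately show "\<exists>\<U>\<in>\<C>. \<forall>U\<in>\<U>. \<exists>x\<in>U \<inter> D. F c x = 0" by blast
  next
    assume "\<exists>\<U>\<in>\<C>. \<forall>U\<in>\<U>. \<exists>x\<in>U \<inter> D. F c x = 0"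
    then obtain \<U> x where \<U>: "\<U> \<in> \<C>" and x: "\<And>U. U \<in> \<U> \<Longrightarrow> x U \<in> U \<inter> D \<and> F c (x U) = 0" by metis
    have "inj_on x \<U>"
    proof (intro inj_onI)
      fix U V assume UV: "U \<in> \<U>" "V \<in> \<U>" "x U = x V"
      then have "x U \<in> U \<inter> V" using x by (metis IntD1 IntI)
      moreover have "disjoint \<U>" using \<U> by (simp add: \<C>_def)
      ultimately show "U = V" using UV by (metis disjointD empty_iff)
    qed
    then have "x ` \<U> \<subseteq> {x \<in> D. F c x = 0} \<and> finite (x ` \<U>) \<and> card (x ` \<U>) = m"
      using x \<U> by (auto simp: \<C>_def card_image)
    then show "\<exists>S. S \<subseteq> {x \<in> D. F c x = 0} \<and> finite S \<and> card S = m" by blast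
  qed
  then have "{c \<in> space M. \<exists>S. S \<subseteq> {x \<in> D. F c x = 0} \<and> finite S \<and> card S = m} =
     {c \<in> space M. \<exists>\<U>\<in>\<C>. \<forall>U\<in>\<U>. \<exists>x\<in>U \<inter> D. F c x = 0}" by auto
  also have "\<dots> = (\<Union>\<U>\<in>\<C>. {c \<in> space M. \<forall>U\<in>\<U>. \<exists>x\<in>U \<inter> D. F c x = 0})" by auto
  also have "\<dots> \<in> sets M"
  proof (rule sets.countable_UN''[OF cC])
    show "{c \<in> space M. \<forall>U\<in>\<U>. \<exists>x\<in>U \<inter> D. F c x = 0} \<in> sets M" if \<U>: "\<U> \<in> \<C>" for \<U>
    proof -
    have "open U" if "U \<in> \<U>" for U
      using that \<U> \<B>(2) by (auto simp: \<C>_def dest: topological_basis_open)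
    then show ?thesis
      using \<U> by (intro sets.sets_Collect_finite_All exists_zero_Union_in_sets[OF D cont meas]) (auto simp: \<C>_def)
    qed
  qed
  finally show ?thesis .
qed

text \<open>Unlike \<open>card\<close>, this count is infinite on infinite sets, which makes it
  countably additive and lets the area formula hold without exceptions.\<close>

abbreviation ecount :: "'a set \<Rightarrow> ennreal" where
  "ecount \<equiv> emeasure (count_space UNIV)"

text \<open>The indicator switches the term \<open>m\<close> on exactly if \<open>Z\<close> has at
  least \<open>m\<close> elements, a condition that \<open>zeros_card_ge_in_sets\<close> makes
  measurable when \<open>Z\<close> is a zero set.\<close>

lemma ecount_eq_SUP:
  "ecount Z = (SUP m. of_nat m * indicator {m. \<exists>S. S \<subseteq> Z \<and> finite S \<and> card S = m} m)"
    (is "_ = (SUP m. ?f m)")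
proof (cases "finite Z")
  case True
  have "?f m \<le> of_nat (card Z)" for m
    using card_mono[OF True] by (auto simp: indicator_def)
  moreover have "?f (card Z) = of_nat (card Z)" using True by (auto simp: indicator_def)
  ultimately have "(SUP m. ?f m) = of_nat (card Z)"
    by (intro antisym SUP_least) (auto intro!: SUP_upper2[where i = "card Z"])
  then show ?thesis using True by simp
next
  case False
  then have "?f m = of_nat m" for m
    using infinite_arbitrarily_large[OF False, of m] by (auto simp: indicator_def)
  then show ?thesis using False by (simp add: ennreal_SUP_of_nat_eq_top)
qed

lemma borel_measurable_ecount_zeros:
  fixes F :: "'a \<Rightarrow> 'b::euclidean_space \<Rightarrow> 'c::real_normed_vector"
  assumes D: "D = (\<Union>n::nat. C n)" "\<And>n. compact (C n)"
    and cont: "\<And>c. c \<in> space M \<Longrightarrow> continuous_on UNIV (F c)"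
    and meas: "\<And>x. (\<lambda>c. norm (F c x)) \<in> borel_measurable M"
  shows "(\<lambda>c. ecount {x \<in> D. F c x = 0}) \<in> borel_measurable M"
proof -
  let ?G = "\<lambda>m. {c \<in> space M. \<exists>S. S \<subseteq> {x \<in> D. F c x = 0} \<and> finite S \<and> card S = m}"
  have [measurable]: "?G m \<in> sets M" for m
    using zeros_card_ge_in_sets[OF D cont meas] .
  have "(\<lambda>c. SUP m. of_nat m * indicator (?G m) c :: ennreal) \<in> borel_measurable M"
    by measurable
  then show ?thesis
    by (subst measurable_cong[where g = "\<lambda>c. SUP m. of_nat m * indicator (?G m) c"])
       (auto simp: ecount_eq_SUP[of "{x \<in> D. _ x}"] indicator_def intro!: SUP_cong)
qed

text \<open>The half-open square counts every parameter of the circle once but is not compact; this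
  exhaustion supplies the sets \<open>C n\<close> for the measurability lemmas.\<close>

lemma atLeastLessThan_square_eq_UN_compact:
  "{0..<b} \<times> {0..<b} = (\<Union>n. {0..b - 1 / Suc n} \<times> {0..b - 1 / Suc n :: real})"
proof (intro equalityI subsetI)
  fix z assume "z \<in> {0..<b} \<times> {0..<b}"
  then obtain x y where z: "z = (x, y)" "0 \<le> x" "x < b" "0 \<le> y" "y < b" by auto
  then obtain n where "1 / Suc n < b - max x y"
    by (metis nat_approx_posE diff_gt_0_iff_gt max_less_iff_conj)
  then show "z \<in> (\<Union>n. {0..b - 1 / Suc n} \<times> {0..b - 1 / Suc n})"
    using z by (auto intro!: exI[of _ n])
next
  fix z assume "z \<in> (\<Union>n. {0..b - 1 / Suc n} \<times> {0..b - 1 / Suc n})"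
  then obtain x y n where "z = (x, y)" "0 \<le> x" "x \<le> b - 1 / Suc n" "0 \<le> y" "y \<le> b - 1 / Suc n"
    by auto
  moreover have "1 / real (Suc n) > 0" by simp
  ultimately have "x < b \<and> y < b" by linarith
  with \<open>z = (x, y)\<close> \<open>0 \<le> x\<close> \<open>0 \<le> y\<close> show "z \<in> {0..<b} \<times> {0..<b}" by simp
qed

section \<open>The area formula\<close>

text \<open>The injectivity half of the inverse function theorem. It needs derivatives close in
  operator norm, and these come from continuity of the matrix entries, since the sum of their
  absolute values bounds the operator norm.\<close>

lemma locally_injective_of_det_nonzero:
  fixes h :: "real^'n::{finite,wellorder} \<Rightarrow> real^'n::_"
  assumes der: "\<And>x. (h has_derivative (\<lambda>v. A x *v v)) (at x)"
    and cont: "continuous_on UNIV A" and det: "det (A a) \<noteq> 0"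
  obtains r where "r > 0" "inj_on h (ball a r)"
proof -
  obtain B where B: "B ** A a = mat 1" "A a ** B = mat 1"
    using det by (metis invertible_def invertible_det_nz)
  have small: "\<exists>d>0. \<forall>x. dist a x < d \<longrightarrow> onorm (\<lambda>v. A x *v v - A a *v v) < e" if "e > 0" for e
  proof -
    let ?s = "\<lambda>x. \<Sum>i\<in>UNIV. \<Sum>j\<in>UNIV. \<bar>(A x - A a) $ i $ j\<bar>"
    have "continuous_on UNIV ?s"
      using cont by (intro continuous_intros)
    then have "isCont ?s a" by (simp add: continuous_on_eq_continuous_at)
    then obtain d where d: "d > 0" "\<And>x. dist x a < d \<Longrightarrow> dist (?s x) (?s a) < e"
      using \<open>e > 0\<close> unfolding continuous_at_eps_delta by metis
    have "onorm (\<lambda>v. A x *v v - A a *v v) < e" if "dist a x < d" for x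
    proof -
      have "?s a = 0" by simp
      then have "?s x < e" using d(2)[of x] that by (simp add: dist_commute dist_real_def)
      moreover have "onorm ((*v) (A x - A a)) \<le> ?s x" by (rule onorm_le_matrix_component_sum)
      moreover have "(*v) (A x - A a) = (\<lambda>v. A x *v v - A a *v v)"
        by (auto simp: matrix_vector_mult_diff_rdistrib)
      ultimately show ?thesis by simp
    qed
    then show ?thesis using d(1) by blast
  qed
  show thesis
  proof (rule has_derivative_locally_injective[of a UNIV "(*v) B" "\<lambda>x v. A x *v v" h])
    show "(*v) B \<circ> (*v) (A a) = id"
      using B by (auto simp: fun_eq_iff matrix_vector_mul_assoc)
  qed (use der small that in auto)
qed

lemma continuous_on_det:
  fixes A :: "'a::t2_space \<Rightarrow> real^'n^'n"
  assumes "continuous_on S A"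
  shows "continuous_on S (\<lambda>x. det (A x))"
  unfolding det_def using assms by (intro continuous_intros)

text \<open>Boundedness of \<open>P\<close> makes the continuous Jacobian integrable on it, so the
  image has finite measure and the change of variables theorem applies.\<close>

lemma emeasure_differentiable_image:
  fixes h :: "real^'n::{finite,wellorder} \<Rightarrow> real^'n::_"
  assumes der: "\<And>x. (h has_derivative (\<lambda>v. A x *v v)) (at x)"
    and cont: "continuous_on UNIV A"
    and P: "P \<in> sets borel" "bounded P" and inj: "inj_on h P"
  shows "h ` P \<in> sets lebesgue"
    "emeasure lebesgue (h ` P) = (\<integral>\<^sup>+x\<in>P. ennreal \<bar>det (A x)\<bar> \<partial>lborel)"
proof -
  have der': "(h has_derivative (\<lambda>v. A x *v v)) (at x within P)" for x
    using der by (rule has_derivative_at_withinI)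
  have Pl: "P \<in> sets lebesgue" using P(1) by simp
  have cd: "continuous_on UNIV (\<lambda>x. \<bar>det (A x)\<bar>)"
    using cont by (intro continuous_intros continuous_on_det)
  obtain a where "P \<subseteq> cbox (-a) a" using bounded_subset_cbox_symmetric[OF P(2)] by blast
  have "(\<lambda>x. \<bar>det (A x)\<bar>) absolutely_integrable_on cbox (-a) a"
    by (intro absolutely_integrable_continuous continuous_on_subset[OF cd]) auto
  then have "(\<lambda>x. \<bar>det (A x)\<bar>) absolutely_integrable_on P"
    by (rule set_integrable_subset) (use Pl \<open>P \<subseteq> _\<close> in auto)
  then have int: "(\<lambda>x. \<bar>det (matrix ((*v) (A x)))\<bar>) integrable_on P"
    by (simp add: set_lebesgue_integral_eq_integral)
  have m: "h ` P \<in> lmeasurable"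
    using measurable_differentiable_image_eq[OF Pl der' inj] int by blast
  then show "h ` P \<in> sets lebesgue" by blast
  have "((\<lambda>x. \<bar>det (A x)\<bar>) has_integral measure lebesgue (h ` P)) P"
    using has_measure_differentiable_image[OF Pl der' inj, of "measure lebesgue (h ` P)"] m by simp
  from nn_integral_has_integral_lebesgue[OF _ this]
  have "(\<integral>\<^sup>+x. ennreal (indicator P x * \<bar>det (A x)\<bar>) \<partial>lborel) = ennreal (measure lebesgue (h ` P))"
    by simp
  then show "emeasure lebesgue (h ` P) = (\<integral>\<^sup>+x\<in>P. ennreal \<bar>det (A x)\<bar> \<partial>lborel)"
    using m by (simp add: emeasure_eq_measure2 ennreal_mult' ennreal_indicator mult.commute)
qed

lemma ecount_image_inj:
  assumes "inj_on h P"
  shows "ecount {x \<in> P. h x = y} = indicator (h ` P) y"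
proof (cases "y \<in> h ` P")
  case True
  then obtain x where "x \<in> P" "h x = y" by blast
  then have "{x \<in> P. h x = y} = {x}" using assms by (auto dest: inj_onD)
  then show ?thesis using True by simp
next
  case False
  then have *: "{x \<in> P. h x = y} = {}" by blast
  show ?thesis unfolding * using False by simp
qed

text \<open>Off the critical points \<open>h\<close> is locally injective, so
  \<open>S \<inter> G\<close> falls into countably many measurable pieces on which \<open>h\<close>
  is injective, and the indicators of their images add up to the number of preimages. Critical
  points contribute to neither side: their image is negligible by Sard's theorem, and the Jacobian
  vanishes on them.\<close>

theorem area_formula:
  fixes h :: "real^'n::{finite,wellorder} \<Rightarrow> real^'n::_"
  assumes der: "\<And>x. (h has_derivative (\<lambda>v. A x *v v)) (at x)"
    and cont: "continuous_on UNIV A"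
    and S: "S \<in> sets borel" "bounded S"
  shows "(\<integral>\<^sup>+y. ecount {x \<in> S. h x = y} \<partial>lborel) = (\<integral>\<^sup>+x\<in>S. ennreal \<bar>det (A x)\<bar> \<partial>lborel)"
proof -
  have cd: "continuous_on UNIV (\<lambda>x. det (A x))"
    using cont by (rule continuous_on_det)
  define G where "G = {x. det (A x) \<noteq> 0}"
  have "G = (\<lambda>x. det (A x)) -` (- {0})" by (auto simp: G_def)
  then have G: "open G" using open_vimage[OF _ cd, of "- {0}"] by auto
  define \<F> where "\<F> = {ball a r | a r. inj_on h (ball a r)}"
  have GF: "G \<subseteq> \<Union>\<F>"
  proof
    fix a assume "a \<in> G"
    then obtain r where "r > 0" "inj_on h (ball a r)"
      using locally_injective_of_det_nonzero[OF der cont, of a] by (auto simp: G_def)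
    then show "a \<in> \<Union>\<F>" unfolding \<F>_def by (auto intro!: exI[of _ "ball a r"])
  qed
  obtain \<F>' where F': "\<F>' \<subseteq> \<F>" "countable \<F>'" "\<Union>\<F>' = \<Union>\<F>"
    using Lindelof[of \<F>] by (auto simp: \<F>_def)
  \<comment> \<open>The empty set is added so that an enumeration by all natural numbers exists even
    if \<open>\<F>'\<close> is empty or finite; \<open>disjointed\<close> below needs a
    sequence.\<close>
  define B where "B = from_nat_into (insert {} \<F>')"
  have rB: "range B = insert {} \<F>'" unfolding B_def using F'(2) by (intro range_from_nat_into) auto
  have B: "inj_on h (B l)" "open (B l)" for l
  proof -
    have "B l \<in> insert {} \<F>'" using rB by blast
    then show "inj_on h (B l)" "open (B l)" using F'(1) by (auto simp: \<F>_def)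
  qed
  define P where "P l = S \<inter> G \<inter> disjointed B l" for l
  have disjB: "disjointed B l \<in> sets borel" for l
    using B(2) by (auto simp: disjointed_def)
  have P: "P l \<in> sets borel" "bounded (P l)" "inj_on h (P l)" for l
  proof -
    show "P l \<in> sets borel" using S G disjB by (auto simp: P_def)
    show "bounded (P l)" using S by (auto simp: P_def intro: bounded_subset)
    show "inj_on h (P l)" using B(1)[of l] disjointed_subset[of B l]
      by (auto simp: P_def intro: inj_on_subset)
  qed
  have disj: "disjoint_family P"
    using disjoint_family_disjointed[of B] by (auto simp: P_def disjoint_family_on_def)
  have UP: "(\<Union>l. P l) = S \<inter> G"
    using GF F' rB UN_disjointed_eq[of B] by (auto simp: P_def)
  have neg: "negligible (h ` (S - G))"
  proof (rule baby_Sard)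
    show "(h has_derivative (\<lambda>v. A x *v v)) (at x within S - G)" for x
      using der by (rule has_derivative_at_withinI)
    show "rank (matrix ((*v) (A x))) < CARD('n)" if "x \<in> S - G" for x
      using that by (simp add: G_def det_eq_0_rank)
  qed simp
  have AE1: "AE y in lebesgue. y \<notin> h ` (S - G)"
    using neg by (intro AE_I'[of "h ` (S - G)"]) (auto simp: negligible_iff_null_sets)
  have count: "ecount {x \<in> S. h x = y} = (\<Sum>l. indicator (h ` P l) y)" if "y \<notin> h ` (S - G)" for y
  proof -
    have "{x \<in> S. h x = y} = (\<Union>l. {x \<in> P l. h x = y})" using that UP by blast
    also have "ecount \<dots> = (\<Sum>l. ecount {x \<in> P l. h x = y})"
      using disj by (intro suminf_emeasure[symmetric]) (auto simp: disjoint_family_on_def)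
    finally show ?thesis by (simp add: ecount_image_inj[OF P(3)])
  qed
  have meas: "h ` P l \<in> sets lebesgue" for l
    using emeasure_differentiable_image(1)[OF der cont P] .
  have "(\<integral>\<^sup>+y. ecount {x \<in> S. h x = y} \<partial>lborel) = (\<integral>\<^sup>+y. ecount {x \<in> S. h x = y} \<partial>lebesgue)"
    by (simp add: nn_integral_completion)
  also have "\<dots> = (\<integral>\<^sup>+y. (\<Sum>l. indicator (h ` P l) y) \<partial>lebesgue)"
    using AE1 count by (intro nn_integral_cong_AE) (auto elim: eventually_mono)
  also have "\<dots> = (\<Sum>l. emeasure lebesgue (h ` P l))"
    using meas by (subst nn_integral_suminf) auto
  also have "\<dots> = (\<Sum>l. \<integral>\<^sup>+x. ennreal \<bar>det (A x)\<bar> * indicator (P l) x \<partial>lborel)"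
    by (simp add: emeasure_differentiable_image(2)[OF der cont P])
  also have "\<dots> = (\<integral>\<^sup>+x. (\<Sum>l. ennreal \<bar>det (A x)\<bar> * indicator (P l) x) \<partial>lborel)"
    using P(1) borel_measurable_continuous_onI[OF cd]
    by (intro nn_integral_suminf[symmetric] borel_measurable_times_ennreal borel_measurable_indicator) auto
  also have "\<dots> = (\<integral>\<^sup>+x\<in>S \<inter> G. ennreal \<bar>det (A x)\<bar> \<partial>lborel)"
    by (simp add: suminf_indicator[OF disj] UP)
  also have "\<dots> = (\<integral>\<^sup>+x\<in>S. ennreal \<bar>det (A x)\<bar> \<partial>lborel)"
    by (intro nn_integral_cong) (auto simp: G_def indicator_def)
  finally show ?thesis .
qed

text \<open>The area formula lives in \<open>real^2\<close>, where matrices and determinants are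
  available, while the curves take values in \<open>real \<times> real\<close>. The bridge is the
  description of \<open>lborel\<close> as a product over the two axis vectors.\<close>

lemma nn_integral_lborel_vec2:
  fixes f :: "real^2 \<Rightarrow> ennreal"
  assumes [measurable]: "f \<in> borel_measurable borel"
  shows "(\<integral>\<^sup>+z. f z \<partial>lborel) = (\<integral>\<^sup>+x. \<integral>\<^sup>+y. f (vector [x, y]) \<partial>lborel \<partial>lborel)"
proof -
  interpret product_sigma_finite "\<lambda>_. lborel :: real measure" ..
  let ?e1 = "axis 1 1 :: real^2" and ?e2 = "axis 2 1 :: real^2"
  have B: "(Basis :: (real^2) set) = insert ?e1 {?e2}"
    by (auto simp: Basis_vec_def UNIV_2)
  have ne: "?e1 \<noteq> ?e2" by (simp add: axis_eq_axis)
  have [measurable]: "(\<lambda>g. \<Sum>b\<in>Basis. g b *\<^sub>R b :: real^2) \<in> borel_measurable (\<Pi>\<^sub>M b\<in>Basis. lborel)"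
    by measurable
  have "(\<integral>\<^sup>+z. f z \<partial>lborel) = (\<integral>\<^sup>+g. f (\<Sum>b\<in>Basis. g b *\<^sub>R b) \<partial>(\<Pi>\<^sub>M b\<in>Basis. lborel))"
    by (subst lborel_eq) (simp add: nn_integral_distr)
  also have "\<dots> = (\<integral>\<^sup>+x. \<integral>\<^sup>+g. f (\<Sum>b\<in>Basis. (g(?e1 := x)) b *\<^sub>R b) \<partial>(\<Pi>\<^sub>M b\<in>{?e2}. lborel) \<partial>lborel)"
    using ne unfolding B by (subst product_nn_integral_insert_rev) (auto simp flip: B)
  also have "\<dots> = (\<integral>\<^sup>+x. \<integral>\<^sup>+g. f (vector [x, g ?e2]) \<partial>(\<Pi>\<^sub>M b\<in>{?e2}. lborel) \<partial>lborel)"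
  proof (intro nn_integral_cong arg_cong[where f = f])
    fix x :: real and g :: "real^2 \<Rightarrow> real"
    show "(\<Sum>b\<in>Basis. (g(?e1 := x)) b *\<^sub>R b) = vector [x, g ?e2]"
      using ne by (simp add: B vec_eq_iff forall_2 vector_2 axis_def)
  qed
  also have "\<dots> = (\<integral>\<^sup>+x. \<integral>\<^sup>+y. f (vector [x, y]) \<partial>lborel \<partial>lborel)"
  proof (intro nn_integral_cong)
    fix x :: real
    have [measurable]: "(\<lambda>y. vector [x, y] :: real^2) \<in> borel_measurable borel"
    proof -
      have "(\<lambda>y. vector [x, y] :: real^2) = (\<lambda>y. x *\<^sub>R ?e1 + y *\<^sub>R ?e2)"
        by (auto simp: fun_eq_iff vec_eq_iff forall_2 vector_2 axis_def)
      then show ?thesis by simp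
    qed
    show "(\<integral>\<^sup>+g. f (vector [x, g ?e2]) \<partial>(\<Pi>\<^sub>M b\<in>{?e2}. lborel)) = (\<integral>\<^sup>+y. f (vector [x, y]) \<partial>lborel)"
      by (rule product_nn_integral_singleton) measurable
  qed
  finally show ?thesis .
qed

lemma nn_integral_lborel_vec2_prod:
  fixes f :: "real^2 \<Rightarrow> ennreal"
  assumes [measurable]: "f \<in> borel_measurable borel"
  shows "(\<integral>\<^sup>+z. f z \<partial>lborel) = (\<integral>\<^sup>+(x, y). f (vector [x, y]) \<partial>(lborel :: (real \<times> real) measure))"
proof -
  have eq: "(\<lambda>z. vector [fst z, snd z] :: real^2) = (\<lambda>z. fst z *\<^sub>R axis 1 1 + snd z *\<^sub>R axis 2 1)"
    by (auto simp: fun_eq_iff vec_eq_iff forall_2 vector_2 axis_def)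
  have [measurable]: "(\<lambda>z. vector [fst z, snd z] :: real^2) \<in> borel_measurable (borel \<Otimes>\<^sub>M borel)"
    unfolding eq by measurable
  show ?thesis
    unfolding nn_integral_lborel_vec2[OF assms] lborel_prod[symmetric] split_def
    by (subst lborel.nn_integral_fst[symmetric]) (auto simp: split_def)
qed

text \<open>The area formula for the map
  \<open>(\<phi>, \<psi>) \<mapsto> f \<phi> - g \<psi>\<close> with \<open>f = (u, v)\<close> and
  \<open>g = (p, q)\<close>, whose Jacobian matrix has the columns \<open>f'\<close> and
  \<open>- g'\<close>. The weight \<open>indicator C\<close> is absorbed by restricting the domain
  to the preimage of \<open>C\<close>.\<close>

theorem area_formula_difference:
  fixes u v p q u' v' p' q' :: "real \<Rightarrow> real" and b :: real
  assumes der: "\<And>x. (u has_real_derivative u' x) (at x)" "\<And>x. (v has_real_derivative v' x) (at x)"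
    "\<And>x. (p has_real_derivative p' x) (at x)" "\<And>x. (q has_real_derivative q' x) (at x)"
    and cont: "continuous_on UNIV u'" "continuous_on UNIV v'" "continuous_on UNIV p'" "continuous_on UNIV q'"
    and C: "C \<in> sets (borel :: (real \<times> real) measure)"
  defines "D \<equiv> {0..<b} \<times> {0..<b}"
  shows "(\<integral>\<^sup>+z. indicator C z *
        ecount {\<theta> \<in> D. (u (fst \<theta>) - p (snd \<theta>), v (fst \<theta>) - q (snd \<theta>)) = z} \<partial>lborel) =
    (\<integral>\<^sup>+\<theta>. ennreal \<bar>u' (fst \<theta>) * q' (snd \<theta>) - v' (fst \<theta>) * p' (snd \<theta>)\<bar> *
        indicator C (u (fst \<theta>) - p (snd \<theta>), v (fst \<theta>) - q (snd \<theta>)) * indicator D \<theta> \<partial>lborel)"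
proof -
  let ?e1 = "axis 1 1 :: real^2" and ?e2 = "axis 2 1 :: real^2"
  define k where "k \<theta> = (u (fst \<theta>) - p (snd \<theta>), v (fst \<theta>) - q (snd \<theta>))" for \<theta>
  define h where "h z = (u (z$1) - p (z$2)) *\<^sub>R ?e1 + (v (z$1) - q (z$2)) *\<^sub>R ?e2" for z :: "real^2"
  define A where "A z = (vector [vector [u' (z$1), - p' (z$2)], vector [v' (z$1), - q' (z$2)]] :: real^2^2)" for z :: "real^2"
  have cu: "continuous_on UNIV u" "continuous_on UNIV v" "continuous_on UNIV p" "continuous_on UNIV q"
    using der by (auto intro!: DERIV_continuous_on)
  have [measurable]: "u \<in> borel_measurable borel" "v \<in> borel_measurable borel"
    "p \<in> borel_measurable borel" "q \<in> borel_measurable borel"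
    "u' \<in> borel_measurable borel" "v' \<in> borel_measurable borel"
    "p' \<in> borel_measurable borel" "q' \<in> borel_measurable borel"
    using cu cont by (auto intro: borel_measurable_continuous_onI)
  note C [measurable]
  have h: "h z = vector [fst (k (z$1, z$2)), snd (k (z$1, z$2))]" for z
    by (auto simp: h_def k_def vec_eq_iff forall_2 vector_2 axis_def)
  have detA: "det (A z) = v' (z$1) * p' (z$2) - u' (z$1) * q' (z$2)" for z
    by (simp add: A_def det_2 vector_2)
  have der_h: "(h has_derivative (\<lambda>w. A z *v w)) (at z)" for z
  proof -
    note [derivative_intros] = DERIV_compose_FDERIV[OF der(1)] DERIV_compose_FDERIV[OF der(2)]
      DERIV_compose_FDERIV[OF der(3)] DERIV_compose_FDERIV[OF der(4)]
    have nth: "((\<lambda>z. z $ i) has_derivative (\<lambda>w. w $ i)) (at z)" for i :: 2 and z :: "real^2"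
      by (rule bounded_linear.has_derivative[OF bounded_linear_vec_nth has_derivative_ident])
    show ?thesis
      unfolding h_def
      by (rule derivative_eq_intros nth refl | simp)+
         (auto simp: A_def fun_eq_iff vec_eq_iff forall_2 vector_2 axis_def matrix_vector_mult_def sum_2)
  qed
  have cont_A: "continuous_on UNIV A"
  proof -
    have "A = (\<lambda>z. u' (z$1) *\<^sub>R axis 1 ?e1 + (- p' (z$2)) *\<^sub>R axis 1 ?e2
        + v' (z$1) *\<^sub>R axis 2 ?e1 + (- q' (z$2)) *\<^sub>R axis 2 ?e2)"
      by (auto simp: A_def fun_eq_iff vec_eq_iff forall_2 vector_2 axis_def)
    moreover have "continuous_on UNIV \<dots>"
      using cont by (intro continuous_intros)
        (erule continuous_on_compose2, auto intro!: continuous_intros)+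
    ultimately show ?thesis by simp
  qed
  define S where "S = {z :: real^2. (z$1, z$2) \<in> D \<and> k (z$1, z$2) \<in> C}"
  have [measurable]: "D \<in> sets borel" unfolding D_def by (auto simp: borel_prod[symmetric])
  have [measurable]: "k \<in> borel_measurable borel"
    unfolding k_def borel_prod[symmetric] by measurable
  have [measurable]: "(\<lambda>z :: real^2. (z$1, z$2)) \<in> borel_measurable borel"
    by (intro borel_measurable_continuous_onI continuous_intros)
  have Sb: "S \<in> sets borel"
    unfolding S_def by measurable
  note Sb [measurable]
  have "bounded S"
  proof -
    have "S \<subseteq> cbox 0 (vector [b, b])"
      by (auto simp: S_def D_def mem_box_cart forall_2 vector_2)
    then show ?thesis using bounded_cbox bounded_subset by blast
  qed
  note area = area_formula[OF der_h cont_A Sb this]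
  \<comment> \<open>Since \<open>S\<close> contains only points mapped into \<open>C\<close>, a
    value outside \<open>C\<close> has no preimage in \<open>S\<close>, which produces the factor
    \<open>indicator C\<close>.\<close>
  have cnt: "ecount {z \<in> S. h z = vector [x, y]} = indicator C (x, y) * ecount {\<theta> \<in> D. k \<theta> = (x, y)}" for x y
  proof -
    have "{z \<in> S. h z = vector [x, y]} = (if (x, y) \<in> C then (\<lambda>\<theta>. vector [fst \<theta>, snd \<theta>]) ` {\<theta> \<in> D. k \<theta> = (x, y)} else {})"
      (is "?L = ?R")
    proof (intro equalityI subsetI)
      fix z assume z: "z \<in> ?L"
      then have kz: "k (z$1, z$2) = (x, y)"
        unfolding h by (auto simp: vec_eq_iff forall_2 vector_2 prod_eq_iff)
      have "z = vector [fst (z$1, z$2), snd (z$1, z$2)]" by (simp add: vec_eq_iff forall_2 vector_2)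
      then show "z \<in> ?R" using z kz unfolding S_def by (auto intro!: image_eqI)
    next
      fix z assume "z \<in> ?R"
      then show "z \<in> ?L" unfolding S_def h by (auto simp: vector_2 split: if_splits)
    qed
    moreover have "inj (\<lambda>\<theta>::real\<times>real. vector [fst \<theta>, snd \<theta>] :: real^2)"
      by (auto intro!: injI simp: vec_eq_iff forall_2 vector_2 prod_eq_iff)
    ultimately show ?thesis
      by (auto simp: emeasure_count_space finite_image_iff card_image inj_on_subset indicator_def)
  qed
  \<comment> \<open>The passage from \<open>real^2\<close> to pairs below needs a measurable
    integrand. Here the target point \<open>y\<close> plays the role of the parameter in the
    measurability lemma.\<close>
  have [measurable]: "(\<lambda>y. ecount {z \<in> S. h z = y}) \<in> borel_measurable borel"
  proof -
    have "(\<lambda>y :: real^2. ecount {\<theta> \<in> D. k \<theta> - (y$1, y$2) = 0}) \<in> borel_measurable borel"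
      unfolding D_def
    proof (rule borel_measurable_ecount_zeros[OF atLeastLessThan_square_eq_UN_compact])
      show "continuous_on UNIV (\<lambda>\<theta>. k \<theta> - (y$1, y$2))" for y :: "real^2"
        unfolding k_def by (intro continuous_intros continuous_on_compose2[OF cu(1)]
            continuous_on_compose2[OF cu(2)] continuous_on_compose2[OF cu(3)] continuous_on_compose2[OF cu(4)]) auto
    qed (auto intro: compact_Times)
    then have "(\<lambda>y :: real^2. indicator C (y$1, y$2) * ecount {\<theta> \<in> D. k \<theta> - (y$1, y$2) = 0}) \<in> borel_measurable borel"
      by measurable
    moreover have "ecount {z \<in> S. h z = y} = indicator C (y$1, y$2) * ecount {\<theta> \<in> D. k \<theta> - (y$1, y$2) = 0}" for y :: "real^2"
    proof -
      have "y = vector [y$1, y$2]" by (simp add: vec_eq_iff forall_2 vector_2)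
      then show ?thesis using cnt[of "y$1" "y$2"] by simp
    qed
    ultimately show ?thesis by simp
  qed
  have "(\<integral>\<^sup>+z. indicator C z * ecount {\<theta> \<in> D. k \<theta> = z} \<partial>lborel) =
      (\<integral>\<^sup>+(x, y). ecount {z \<in> S. h z = vector [x, y]} \<partial>lborel)"
    by (simp add: cnt split_def)
  also have "\<dots> = (\<integral>\<^sup>+y. ecount {z \<in> S. h z = y} \<partial>lborel)"
    by (rule nn_integral_lborel_vec2_prod[symmetric]) measurable
  also note area
  also have "(\<integral>\<^sup>+z\<in>S. ennreal \<bar>det (A z)\<bar> \<partial>lborel) =
      (\<integral>\<^sup>+(x, y). ennreal \<bar>det (A (vector [x, y]))\<bar> * indicator S (vector [x, y]) \<partial>lborel)"
    unfolding detA by (intro nn_integral_lborel_vec2_prod) measurable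
  also have "\<dots> = (\<integral>\<^sup>+\<theta>. ennreal \<bar>u' (fst \<theta>) * q' (snd \<theta>) - v' (fst \<theta>) * p' (snd \<theta>)\<bar> *
        indicator C (k \<theta>) * indicator D \<theta> \<partial>lborel)"
    by (intro nn_integral_cong)
       (auto simp: detA vector_2 S_def indicator_def abs_minus_commute)
  finally show ?thesis by (simp add: k_def)
qed

section \<open>Radial integrals\<close>

text \<open>For \<open>a \<noteq> 0\<close> one variable is replaced at a time:
  \<open>s = a * x + b * y\<close> for \<open>x\<close>, then \<open>t = (y - b * s) / a\<close> for
  \<open>y\<close>, and the factors \<open>1 / \<bar>a\<bar>\<close> and
  \<open>\<bar>a\<bar>\<close> cancel. For \<open>a = 0\<close> the map swaps the axes up to
  signs.\<close>

lemma nn_integral_plane_rotation: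
  fixes f :: "real \<Rightarrow> real \<Rightarrow> ennreal" and a b :: real
  assumes f [measurable]: "case_prod f \<in> borel_measurable (borel \<Otimes>\<^sub>M borel)" and ab: "a\<^sup>2 + b\<^sup>2 = 1"
  shows "(\<integral>\<^sup>+x. \<integral>\<^sup>+y. f (a * x + b * y) (a * y - b * x) \<partial>lborel \<partial>lborel) = (\<integral>\<^sup>+x. \<integral>\<^sup>+y. f x y \<partial>lborel \<partial>lborel)"
proof (cases "a = 0")
  case False
  have "(\<integral>\<^sup>+x. \<integral>\<^sup>+y. f (a * x + b * y) (a * y - b * x) \<partial>lborel \<partial>lborel) =
      (\<integral>\<^sup>+y. \<integral>\<^sup>+x. f (a * x + b * y) (a * y - b * x) \<partial>lborel \<partial>lborel)"
    by (rule lborel_pair.Fubini'[symmetric]) measurable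
  also have "\<dots> = (\<integral>\<^sup>+y. ennreal \<bar>1 / a\<bar> * (\<integral>\<^sup>+s. f s ((y - b * s) / a) \<partial>lborel) \<partial>lborel)"
  proof (intro nn_integral_cong)
    fix y
    have 1: "a * (- b * y / a + 1 / a * s) + b * y = s" for s
      using False by (simp add: field_simps)
    have 2: "a * y - b * (- b * y / a + 1 / a * s) = (y - b * s) / a" for s
    proof -
      have "a * y - b * (- b * y / a + 1 / a * s) = ((a\<^sup>2 + b\<^sup>2) * y - b * s) / a"
        using False by (simp add: field_simps power2_eq_square)
      then show ?thesis by (simp add: ab)
    qed
    show "(\<integral>\<^sup>+x. f (a * x + b * y) (a * y - b * x) \<partial>lborel) =
      ennreal \<bar>1 / a\<bar> * (\<integral>\<^sup>+s. f s ((y - b * s) / a) \<partial>lborel)"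
      using False
      by (subst nn_integral_real_affine[where c = "1 / a" and t = "- b * y / a"]) (simp_all only: 1 2, auto)
  qed
  also have "\<dots> = ennreal \<bar>1 / a\<bar> * (\<integral>\<^sup>+y. \<integral>\<^sup>+s. f s ((y - b * s) / a) \<partial>lborel \<partial>lborel)"
    by (rule nn_integral_cmult) measurable
  also have "(\<integral>\<^sup>+y. \<integral>\<^sup>+s. f s ((y - b * s) / a) \<partial>lborel \<partial>lborel) = (\<integral>\<^sup>+s. \<integral>\<^sup>+y. f s ((y - b * s) / a) \<partial>lborel \<partial>lborel)"
    by (rule lborel_pair.Fubini') measurable
  also have "\<dots> = (\<integral>\<^sup>+s. ennreal \<bar>a\<bar> * (\<integral>\<^sup>+t. f s t \<partial>lborel) \<partial>lborel)"
  proof (intro nn_integral_cong)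
    fix s
    show "(\<integral>\<^sup>+y. f s ((y - b * s) / a) \<partial>lborel) = ennreal \<bar>a\<bar> * (\<integral>\<^sup>+t. f s t \<partial>lborel)"
      using False by (subst nn_integral_real_affine[where c = a and t = "b * s"]) auto
  qed
  also have "\<dots> = ennreal \<bar>a\<bar> * (\<integral>\<^sup>+s. \<integral>\<^sup>+t. f s t \<partial>lborel \<partial>lborel)"
    by (rule nn_integral_cmult) measurable
  finally show ?thesis
    using False by (simp add: mult.assoc[symmetric] ennreal_mult'[symmetric])
next
  case True
  then have b: "b\<^sup>2 = 1" using ab by simp
  then have b': "b \<noteq> 0" "\<bar>b\<bar> = 1" by (auto simp: power2_eq_1_iff)
  have "(\<integral>\<^sup>+x. \<integral>\<^sup>+y. f (b * y) (- b * x) \<partial>lborel \<partial>lborel) =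
      (\<integral>\<^sup>+y. \<integral>\<^sup>+x. f (b * y) (- b * x) \<partial>lborel \<partial>lborel)"
    by (rule lborel_pair.Fubini'[symmetric]) measurable
  also have "\<dots> = (\<integral>\<^sup>+y. \<integral>\<^sup>+x. f (b * y) x \<partial>lborel \<partial>lborel)"
  proof (rule nn_integral_cong)
    show "(\<integral>\<^sup>+x. f (b * y) (- b * x) \<partial>lborel) = (\<integral>\<^sup>+x. f (b * y) x \<partial>lborel)" for y
      using b' nn_integral_real_affine[of "f (b * y)" "- b" 0] by simp
  qed
  also have "\<dots> = (\<integral>\<^sup>+y. \<integral>\<^sup>+x. f y x \<partial>lborel \<partial>lborel)"
    using b' nn_integral_real_affine[of "\<lambda>y. \<integral>\<^sup>+x. f y x \<partial>lborel" b 0] by simp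
  finally show ?thesis using True by simp
qed

text \<open>Rotating the direction of \<open>(\<alpha>, \<beta>)\<close> into the first axis turns
  the functional into its norm times one coordinate and preserves the sum of squares.\<close>

lemma nn_integral_linear_functional_radial:
  fixes G :: "real \<Rightarrow> real \<Rightarrow> ennreal" and \<alpha> \<beta> :: real
  assumes [measurable]: "case_prod G \<in> borel_measurable (borel \<Otimes>\<^sub>M borel)" and nz: "\<alpha>\<^sup>2 + \<beta>\<^sup>2 \<noteq> 0"
  shows "(\<integral>\<^sup>+x. \<integral>\<^sup>+y. G (\<alpha> * x + \<beta> * y) (x\<^sup>2 + y\<^sup>2) \<partial>lborel \<partial>lborel) =
    (\<integral>\<^sup>+x. \<integral>\<^sup>+y. G (sqrt (\<alpha>\<^sup>2 + \<beta>\<^sup>2) * x) (x\<^sup>2 + y\<^sup>2) \<partial>lborel \<partial>lborel)"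
proof -
  define n where "n = sqrt (\<alpha>\<^sup>2 + \<beta>\<^sup>2)"
  have n2: "n\<^sup>2 = \<alpha>\<^sup>2 + \<beta>\<^sup>2" by (simp add: n_def)
  have n: "n \<noteq> 0" using nz by (simp add: n_def)
  define a b where "a = \<alpha> / n" and "b = \<beta> / n"
  have ab: "a\<^sup>2 + b\<^sup>2 = 1" using n nz unfolding a_def b_def power_divide n2 by (simp add: add_divide_distrib[symmetric])
  have *: "(a * x + b * y)\<^sup>2 + (a * y - b * x)\<^sup>2 = x\<^sup>2 + y\<^sup>2" for x y
  proof -
    have "(a * x + b * y)\<^sup>2 + (a * y - b * x)\<^sup>2 = (a\<^sup>2 + b\<^sup>2) * (x\<^sup>2 + y\<^sup>2)"
      by (simp add: power2_eq_square algebra_simps)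
    then show ?thesis by (simp add: ab)
  qed
  have "n * (a * x + b * y) = \<alpha> * x + \<beta> * y" for x y
    using n by (simp add: a_def b_def field_simps)
  then show ?thesis
    using nn_integral_plane_rotation[of "\<lambda>x y. G (n * x) (x\<^sup>2 + y\<^sup>2)" a b, OF _ ab]
    by (simp add: * n_def)
qed

text \<open>Holds the \<open>k\<close> coordinates that enter an integrand only through the sum of
  their squares. Because of it, every rotation can take place in a plane.\<close>

definition rad_integral :: "nat \<Rightarrow> (real \<Rightarrow> ennreal) \<Rightarrow> ennreal" where
  "rad_integral k H = (\<integral>\<^sup>+z. H (\<Sum>i<k. (z i)\<^sup>2) \<partial>(\<Pi>\<^sub>M i\<in>{..<k}. lborel))"

lemma sigma_finite_PiM_lborel: "finite I \<Longrightarrow> sigma_finite_measure (\<Pi>\<^sub>M i\<in>I. (lborel :: real measure))"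
proof -
  interpret product_sigma_finite "\<lambda>_. lborel :: real measure" ..
  show "finite I \<Longrightarrow> ?thesis" by (rule sigma_finite)
qed

lemma nn_integral_swap:
  assumes "sigma_finite_measure M" "sigma_finite_measure N"
    and "(\<lambda>(x, y). f x y) \<in> borel_measurable (M \<Otimes>\<^sub>M N)"
  shows "(\<integral>\<^sup>+x. \<integral>\<^sup>+y. f x y \<partial>N \<partial>M) = (\<integral>\<^sup>+y. \<integral>\<^sup>+x. f x y \<partial>M \<partial>N)"
proof -
  interpret pair_sigma_finite M N using assms by (intro pair_sigma_finite.intro)
  show ?thesis using Fubini'[OF assms(3)] by simp
qed

lemma measurable_rad_integral [measurable (raw)]:
  assumes [measurable]: "(\<lambda>(x, r). H x r) \<in> borel_measurable (M \<Otimes>\<^sub>M borel)"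
  shows "(\<lambda>x. rad_integral k (H x)) \<in> borel_measurable M"
proof -
  interpret sigma_finite_measure "\<Pi>\<^sub>M i\<in>{..<k}. (lborel :: real measure)"
    by (rule sigma_finite_PiM_lborel) simp
  show ?thesis unfolding rad_integral_def by measurable
qed

lemma rad_integral_0 [simp]: "rad_integral 0 H = H 0"
  by (simp add: rad_integral_def PiM_empty nn_integral_count_space_finite)

lemma rad_integral_Suc:
  assumes [measurable]: "H \<in> borel_measurable borel"
  shows "rad_integral (Suc k) H = (\<integral>\<^sup>+s. rad_integral k (\<lambda>r. H (r + s\<^sup>2)) \<partial>lborel)"
proof -
  interpret product_sigma_finite "\<lambda>_. lborel :: real measure" ..
  have "rad_integral (Suc k) H = (\<integral>\<^sup>+s. \<integral>\<^sup>+z. H (\<Sum>i<Suc k. ((z(k := s)) i)\<^sup>2) \<partial>(\<Pi>\<^sub>M i\<in>{..<k}. lborel) \<partial>lborel)"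
    unfolding rad_integral_def lessThan_Suc
    by (rule product_nn_integral_insert_rev) (auto simp flip: lessThan_Suc)
  then show ?thesis by (simp add: rad_integral_def)
qed

lemma rad_integral_swap:
  assumes "sigma_finite_measure M" and [measurable]: "(\<lambda>(x, r). H x r) \<in> borel_measurable (M \<Otimes>\<^sub>M borel)"
  shows "(\<integral>\<^sup>+x. rad_integral k (H x) \<partial>M) = rad_integral k (\<lambda>r. \<integral>\<^sup>+x. H x r \<partial>M)"
  unfolding rad_integral_def
  by (rule nn_integral_swap[OF assms(1) sigma_finite_PiM_lborel]) auto

lemma rad_integral_cmult:
  assumes [measurable]: "H \<in> borel_measurable borel"
  shows "rad_integral k (\<lambda>r. c * H r) = c * rad_integral k H"
  unfolding rad_integral_def by (rule nn_integral_cmult) measurable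

text \<open>The argument is the squared radius: slicing a ball at height \<open>s\<close> then
  merely subtracts \<open>s\<^sup>2\<close>, and an empty slice shows up as a negative argument with
  volume 0.\<close>

definition ball_vol :: "nat \<Rightarrow> real \<Rightarrow> ennreal" where
  "ball_vol k \<rho> = rad_integral k (indicator {..\<rho>})"

lemma measurable_ball_vol [measurable]: "ball_vol k \<in> borel_measurable borel"
proof -
  have "(\<lambda>\<rho>. rad_integral k (\<lambda>r. indicator {p :: real \<times> real. fst p \<le> snd p} (r, \<rho>))) \<in> borel_measurable borel"
    by measurable
  then show ?thesis by (simp add: ball_vol_def[abs_def] indicator_def[abs_def])
qed

lemma ball_vol_Suc: "ball_vol (Suc k) \<rho> = (\<integral>\<^sup>+s. ball_vol k (\<rho> - s\<^sup>2) \<partial>lborel)"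
proof -
  have "indicator {..\<rho>} (r + s\<^sup>2) = (indicator {..\<rho> - s\<^sup>2} r :: ennreal)" for r s
    by (simp add: indicator_def algebra_simps)
  then show ?thesis unfolding ball_vol_def by (subst rad_integral_Suc) auto
qed

text \<open>Fubini for a ball in \<open>d + k\<close> dimensions: \<open>r\<close> is the squared
  norm of \<open>k\<close> of the coordinates, and the other \<open>d\<close> fill the
  slice.\<close>

lemma rad_integral_ball_vol: "rad_integral k (\<lambda>r. ball_vol d (\<rho> - r)) = ball_vol (d + k) \<rho>"
proof (induction k arbitrary: \<rho>)
  case (Suc k)
  have "rad_integral (Suc k) (\<lambda>r. ball_vol d (\<rho> - r)) = (\<integral>\<^sup>+s. rad_integral k (\<lambda>r. ball_vol d (\<rho> - (r + s\<^sup>2))) \<partial>lborel)"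
    by (rule rad_integral_Suc) measurable
  also have "\<dots> = (\<integral>\<^sup>+s. ball_vol (d + k) (\<rho> - s\<^sup>2) \<partial>lborel)"
    by (simp add: Suc.IH[symmetric] algebra_simps)
  finally show ?case by (simp add: ball_vol_Suc)
qed simp

lemma ball_vol_eq:
  assumes "\<rho> > 0"
  shows "ball_vol k \<rho> = ennreal (unit_ball_vol (real k) * sqrt \<rho> ^ k)"
proof -
  have "ball_vol k \<rho> = (\<integral>\<^sup>+z. indicator ({f. sqrt (\<Sum>i<k. (f i)\<^sup>2) \<le> sqrt \<rho>} \<inter> space (\<Pi>\<^sub>M i\<in>{..<k}. lborel)) z \<partial>(\<Pi>\<^sub>M i\<in>{..<k}. lborel))"
    unfolding ball_vol_def rad_integral_def using assms
    by (intro nn_integral_cong) (auto simp: indicator_def)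
  also have "\<dots> = emeasure (\<Pi>\<^sub>M i\<in>{..<k}. lborel) ({f. sqrt (\<Sum>i<k. (f i)\<^sup>2) \<le> sqrt \<rho>} \<inter> space (\<Pi>\<^sub>M i\<in>{..<k}. lborel))"
  proof (rule nn_integral_indicator)
    have "{f \<in> space (\<Pi>\<^sub>M i\<in>{..<k}. lborel). sqrt (\<Sum>i<k. (f i)\<^sup>2) \<le> sqrt \<rho>} \<in> sets (\<Pi>\<^sub>M i\<in>{..<k}. (lborel :: real measure))"
      by measurable
    then show "{f. sqrt (\<Sum>i<k. (f i)\<^sup>2) \<le> sqrt \<rho>} \<inter> space (\<Pi>\<^sub>M i\<in>{..<k}. lborel) \<in> sets (\<Pi>\<^sub>M i\<in>{..<k}. (lborel :: real measure))"
      by (simp add: Int_def conj_commute)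
  qed
  also have "\<dots> = ennreal (unit_ball_vol (real k) * sqrt \<rho> ^ k)"
    using emeasure_cball_aux[of "{..<k}" "sqrt \<rho>"] assms by simp
  finally show ?thesis .
qed

lemma ball_vol_neg:
  assumes "\<rho> < 0"
  shows "ball_vol k \<rho> = 0"
proof -
  have "indicator {..\<rho>} (\<Sum>i<k. (z i)\<^sup>2) = (0 :: ennreal)" for z :: "nat \<Rightarrow> real"
    using assms sum_nonneg[of "{..<k}" "\<lambda>i. (z i)\<^sup>2"] by (auto simp: indicator_def)
  then show ?thesis by (simp add: ball_vol_def rad_integral_def)
qed

section \<open>Value and derivative of a trigonometric polynomial\<close>

text \<open>Frequency 0 is left out because the constant term is the variable that an intersection
  determines. Positive indices belong to cosines, negative ones to sines.\<close>

definition trig_index :: "nat \<Rightarrow> int set" where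
  "trig_index N = {- int N..int N} - {0}"

definition trig_space :: "nat \<Rightarrow> (int \<Rightarrow> real) measure" where
  "trig_space N = (\<Pi>\<^sub>M k\<in>trig_index N. lborel)"

definition trig_val :: "nat \<Rightarrow> (int \<Rightarrow> real) \<Rightarrow> real \<Rightarrow> real" where
  "trig_val N c \<phi> = (\<Sum>j=1..N. c (int j) * cos (real j * \<phi>) + c (- int j) * sin (real j * \<phi>))"

definition trig_deriv :: "nat \<Rightarrow> (int \<Rightarrow> real) \<Rightarrow> real \<Rightarrow> real" where
  "trig_deriv N c \<phi> = (\<Sum>j=1..N. real j * (c (- int j) * cos (real j * \<phi>) - c (int j) * sin (real j * \<phi>)))"

definition trig_sq :: "nat \<Rightarrow> (int \<Rightarrow> real) \<Rightarrow> real" where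
  "trig_sq N c = (\<Sum>j=1..N. (c (int j))\<^sup>2 + (c (- int j))\<^sup>2)"

lemma sigma_finite_trig_space: "sigma_finite_measure (trig_space N)"
  unfolding trig_space_def by (rule sigma_finite_PiM_lborel) (simp add: trig_index_def)

lemma measurable_trig_coeff [measurable (raw)]:
  "k \<in> trig_index N \<Longrightarrow> (\<lambda>c. c k) \<in> borel_measurable (trig_space N)"
  unfolding trig_space_def by measurable

lemma measurable_trig_val [measurable (raw)]:
  assumes [measurable]: "f \<in> measurable M (trig_space N)" "g \<in> borel_measurable M"
  shows "(\<lambda>x. trig_val N (f x) (g x)) \<in> borel_measurable M"
proof -
  have [measurable]: "(\<lambda>x. f x k) \<in> borel_measurable M" if "k \<in> trig_index N" for k
    using measurable_compose[OF assms(1) measurable_trig_coeff[OF that]] .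
  show ?thesis unfolding trig_val_def
    by (intro borel_measurable_sum borel_measurable_add borel_measurable_times measurable_compose[OF _ borel_measurable_cos]
        measurable_compose[OF _ borel_measurable_sin]) (auto simp: trig_index_def)
qed

lemma measurable_trig_deriv [measurable (raw)]:
  assumes [measurable]: "f \<in> measurable M (trig_space N)" "g \<in> borel_measurable M"
  shows "(\<lambda>x. trig_deriv N (f x) (g x)) \<in> borel_measurable M"
proof -
  have [measurable]: "(\<lambda>x. f x k) \<in> borel_measurable M" if "k \<in> trig_index N" for k
    using measurable_compose[OF assms(1) measurable_trig_coeff[OF that]] .
  show ?thesis unfolding trig_deriv_def
    by (intro borel_measurable_sum borel_measurable_diff borel_measurable_times) (auto simp: trig_index_def)
qed

lemma measurable_trig_sq [measurable]:
  "trig_sq N \<in> borel_measurable (trig_space N)"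
  unfolding trig_sq_def[abs_def]
  by (intro borel_measurable_sum borel_measurable_add borel_measurable_power) (auto simp: trig_index_def)

text \<open>The new pair \<open>(p, q)\<close> enters the value and the derivative through the two
  coordinates of a rotated pair, the rotation having angle \<open>Suc N * \<phi>\<close> up to sign;
  the sum of squares does not notice the rotation.\<close>

lemma trig_fun_upd:
  fixes p q :: real and N :: nat
  defines "c' \<equiv> \<lambda>c. c(- int (Suc N) := q, int (Suc N) := p)"
  shows "trig_val (Suc N) (c' c) \<phi> = trig_val N c \<phi> + (cos (real (Suc N) * \<phi>) * p + sin (real (Suc N) * \<phi>) * q)"
    "trig_deriv (Suc N) (c' c) \<phi> = trig_deriv N c \<phi> + real (Suc N) * (cos (real (Suc N) * \<phi>) * q - sin (real (Suc N) * \<phi>) * p)"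
    "trig_sq (Suc N) (c' c) = trig_sq N c + (p\<^sup>2 + q\<^sup>2)"
proof -
  have *: "(\<Sum>j=1..Suc N. f j (c' c (int j)) (c' c (- int j))) =
      (\<Sum>j=1..N. f j (c (int j)) (c (- int j))) + f (Suc N) p q" for f :: "nat \<Rightarrow> real \<Rightarrow> real \<Rightarrow> real"
  proof -
    have "(\<Sum>j=1..N. f j (c' c (int j)) (c' c (- int j))) = (\<Sum>j=1..N. f j (c (int j)) (c (- int j)))"
      by (rule sum.cong) (auto simp: c'_def)
    then show ?thesis by (simp add: c'_def)
  qed
  show "trig_val (Suc N) (c' c) \<phi> = trig_val N c \<phi> + (cos (real (Suc N) * \<phi>) * p + sin (real (Suc N) * \<phi>) * q)"
    unfolding trig_val_def using *[of "\<lambda>j x y. x * cos (real j * \<phi>) + y * sin (real j * \<phi>)"]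
    by (simp add: mult.commute)
  show "trig_deriv (Suc N) (c' c) \<phi> = trig_deriv N c \<phi> + real (Suc N) * (cos (real (Suc N) * \<phi>) * q - sin (real (Suc N) * \<phi>) * p)"
    unfolding trig_deriv_def using *[of "\<lambda>j x y. real j * (y * cos (real j * \<phi>) - x * sin (real j * \<phi>))"]
    by (simp add: mult.commute)
  show "trig_sq (Suc N) (c' c) = trig_sq N c + (p\<^sup>2 + q\<^sup>2)"
    unfolding trig_sq_def using *[of "\<lambda>j x y. x\<^sup>2 + y\<^sup>2"] by simp
qed

lemma nn_integral_trig_space_Suc:
  assumes [measurable]: "F \<in> borel_measurable (trig_space (Suc N))"
  shows "(\<integral>\<^sup>+c. F c \<partial>trig_space (Suc N)) =
    (\<integral>\<^sup>+c. \<integral>\<^sup>+q. \<integral>\<^sup>+p. F (c(- int (Suc N) := q, int (Suc N) := p)) \<partial>lborel \<partial>lborel \<partial>trig_space N)"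
proof -
  interpret product_sigma_finite "\<lambda>_. lborel :: real measure" ..
  let ?I = "insert (- int (Suc N)) (trig_index N)"
  have I: "trig_index (Suc N) = insert (int (Suc N)) ?I"
    by (auto simp: trig_index_def)
  have [measurable]: "F \<in> borel_measurable (Pi\<^sub>M (insert (int (Suc N)) ?I) (\<lambda>_. lborel))"
    using assms unfolding trig_space_def I .
  have fin: "finite (trig_index N)" "finite ?I" "int (Suc N) \<notin> ?I" "- int (Suc N) \<notin> trig_index N"
    by (auto simp: trig_index_def)
  have "(\<integral>\<^sup>+c. F c \<partial>trig_space (Suc N)) = (\<integral>\<^sup>+c. \<integral>\<^sup>+p. F (c(int (Suc N) := p)) \<partial>lborel \<partial>(Pi\<^sub>M ?I (\<lambda>_. lborel)))"
    unfolding trig_space_def I by (rule product_nn_integral_insert[OF fin(2,3)]) measurable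
  also have "\<dots> = (\<integral>\<^sup>+c. \<integral>\<^sup>+q. \<integral>\<^sup>+p. F (c(- int (Suc N) := q, int (Suc N) := p)) \<partial>lborel \<partial>lborel \<partial>trig_space N)"
    unfolding trig_space_def by (rule product_nn_integral_insert[OF fin(1,4)]) measurable
  finally show ?thesis .
qed

text \<open>Rotating each coefficient pair makes the value and the derivative at \<open>\<phi>\<close> independent coordinates.\<close>

lemma nn_integral_trig_space_rotated:
  fixes H :: "real \<times> real \<times> real \<Rightarrow> ennreal"
  assumes [measurable]: "H \<in> borel_measurable (borel \<Otimes>\<^sub>M borel \<Otimes>\<^sub>M borel)"
  shows "(\<integral>\<^sup>+c. H (trig_val (Suc N) c \<phi>, trig_deriv (Suc N) c \<phi>, trig_sq (Suc N) c) \<partial>trig_space (Suc N)) =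
    (\<integral>\<^sup>+p. \<integral>\<^sup>+q. \<integral>\<^sup>+c. H (trig_val N c \<phi> + p, trig_deriv N c \<phi> + real (Suc N) * q, trig_sq N c + (p\<^sup>2 + q\<^sup>2)) \<partial>trig_space N \<partial>lborel \<partial>lborel)"
proof -
  interpret T: sigma_finite_measure "trig_space N" by (rule sigma_finite_trig_space)
  let ?C = "cos (real (Suc N) * \<phi>)" and ?S = "sin (real (Suc N) * \<phi>)"
  let ?K = "\<lambda>c p q. H (trig_val N c \<phi> + p, trig_deriv N c \<phi> + real (Suc N) * q, trig_sq N c + (p\<^sup>2 + q\<^sup>2))"
  have CS: "(?C * p + ?S * q)\<^sup>2 + (?C * q - ?S * p)\<^sup>2 = p\<^sup>2 + q\<^sup>2" for p q
  proof -
    have "(?C * p + ?S * q)\<^sup>2 + (?C * q - ?S * p)\<^sup>2 = (?C\<^sup>2 + ?S\<^sup>2) * (p\<^sup>2 + q\<^sup>2)"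
      by (simp only: power2_eq_square) algebra
    then show ?thesis by simp
  qed
  have "(\<integral>\<^sup>+c. H (trig_val (Suc N) c \<phi>, trig_deriv (Suc N) c \<phi>, trig_sq (Suc N) c) \<partial>trig_space (Suc N)) =
    (\<integral>\<^sup>+c. \<integral>\<^sup>+q. \<integral>\<^sup>+p. ?K c (?C * p + ?S * q) (?C * q - ?S * p) \<partial>lborel \<partial>lborel \<partial>trig_space N)"
    by (subst nn_integral_trig_space_Suc) (measurable, simp only: trig_fun_upd CS)
  also have "\<dots> = (\<integral>\<^sup>+c. \<integral>\<^sup>+p. \<integral>\<^sup>+q. ?K c p q \<partial>lborel \<partial>lborel \<partial>trig_space N)"
  proof (rule nn_integral_cong)
    fix c
    define v d r where "v = trig_val N c \<phi>" and "d = trig_deriv N c \<phi>" and "r = trig_sq N c"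
    let ?L = "\<lambda>p q. H (v + p, d + real (Suc N) * q, r + (p\<^sup>2 + q\<^sup>2))"
    have "(\<integral>\<^sup>+q. \<integral>\<^sup>+p. ?L (?C * p + ?S * q) (?C * q - ?S * p) \<partial>lborel \<partial>lborel) =
        (\<integral>\<^sup>+p. \<integral>\<^sup>+q. ?L (?C * p + ?S * q) (?C * q - ?S * p) \<partial>lborel \<partial>lborel)"
      by (rule lborel_pair.Fubini') measurable
    also have "\<dots> = (\<integral>\<^sup>+p. \<integral>\<^sup>+q. ?L p q \<partial>lborel \<partial>lborel)"
    proof (rule nn_integral_plane_rotation)
      show "?C\<^sup>2 + ?S\<^sup>2 = 1" by simp
    qed measurable
    finally show "(\<integral>\<^sup>+q. \<integral>\<^sup>+p. ?K c (?C * p + ?S * q) (?C * q - ?S * p) \<partial>lborel \<partial>lborel) =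
        (\<integral>\<^sup>+p. \<integral>\<^sup>+q. ?K c p q \<partial>lborel \<partial>lborel)" by (simp only: v_def d_def r_def)
  qed
  also have "\<dots> = (\<integral>\<^sup>+p. \<integral>\<^sup>+c. \<integral>\<^sup>+q. ?K c p q \<partial>lborel \<partial>trig_space N \<partial>lborel)"
    by (rule nn_integral_swap[OF sigma_finite_trig_space lborel.sigma_finite_measure_axioms]) measurable
  also have "\<dots> = (\<integral>\<^sup>+p. \<integral>\<^sup>+q. \<integral>\<^sup>+c. ?K c p q \<partial>trig_space N \<partial>lborel \<partial>lborel)"
    by (intro nn_integral_cong nn_integral_swap[OF sigma_finite_trig_space lborel.sigma_finite_measure_axioms]) measurable
  finally show ?thesis .
qed

text \<open>After the rotations the value is a sum of \<open>Suc n\<close> coordinates, and the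
  derivative combines as many other coordinates with the weights \<open>1, ..., Suc n\<close>. These
  sets of coordinates are disjoint, so each functional becomes its norm times one coordinate,
  \<open>s\<close> and \<open>t\<close>, and the remaining \<open>2 * n\<close> coordinates enter by
  their squares alone.\<close>

lemma nn_integral_trig_space_value_derivative:
  fixes H :: "real \<times> real \<times> real \<Rightarrow> ennreal"
  assumes "H \<in> borel_measurable (borel \<Otimes>\<^sub>M borel \<Otimes>\<^sub>M borel)"
  shows "(\<integral>\<^sup>+c. H (trig_val (Suc n) c \<phi>, trig_deriv (Suc n) c \<phi>, trig_sq (Suc n) c) \<partial>trig_space (Suc n)) =
    (\<integral>\<^sup>+s. \<integral>\<^sup>+t. rad_integral (2 * n) (\<lambda>r. H (sqrt (Suc n) * s, sqrt (\<Sum>k=1..Suc n. (real k)\<^sup>2) * t, r + (s\<^sup>2 + t\<^sup>2))) \<partial>lborel \<partial>lborel)"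
  using assms
proof (induction n arbitrary: H)
  case 0
  note [measurable] = 0
  show ?case
    by (subst nn_integral_trig_space_rotated)
       (measurable, simp add: trig_space_def trig_index_def trig_val_def trig_deriv_def trig_sq_def
          PiM_empty nn_integral_count_space_finite)
next
  case (Suc n)
  note [measurable] = Suc.prems
  define \<nu> where "\<nu> = real (Suc n)"
  define \<sigma> where "\<sigma> = (\<Sum>k=1..Suc n. (real k)\<^sup>2)"
  define m where "m = real (Suc (Suc n))"
  have \<sigma>: "\<sigma> \<ge> 0" "(\<Sum>k=1..Suc (Suc n). (real k)\<^sup>2) = m\<^sup>2 + \<sigma>"
    by (auto simp: \<sigma>_def m_def intro!: sum_nonneg add_nonneg_nonneg)
  have \<nu>: "real (Suc (Suc n)) = 1\<^sup>2 + (sqrt \<nu>)\<^sup>2" "\<nu> \<ge> 0" by (auto simp: \<nu>_def)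
  have nz1: "1\<^sup>2 + (sqrt \<nu>)\<^sup>2 \<noteq> 0" using \<nu>(2) by simp
  have m: "m\<^sup>2 + (sqrt \<sigma>)\<^sup>2 \<noteq> 0" using \<sigma> by (auto simp: m_def add_nonneg_eq_0_iff)
  let ?K = "\<lambda>A B R. rad_integral (2 * n) (\<lambda>r. H (A, B, r + R))"
  have "(\<integral>\<^sup>+c. H (trig_val (Suc (Suc n)) c \<phi>, trig_deriv (Suc (Suc n)) c \<phi>, trig_sq (Suc (Suc n)) c) \<partial>trig_space (Suc (Suc n))) =
    (\<integral>\<^sup>+p. \<integral>\<^sup>+q. \<integral>\<^sup>+c. H (trig_val (Suc n) c \<phi> + p, trig_deriv (Suc n) c \<phi> + m * q, trig_sq (Suc n) c + (p\<^sup>2 + q\<^sup>2)) \<partial>trig_space (Suc n) \<partial>lborel \<partial>lborel)"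
    unfolding m_def by (rule nn_integral_trig_space_rotated) measurable
  also have "\<dots> = (\<integral>\<^sup>+p. \<integral>\<^sup>+q. \<integral>\<^sup>+s. \<integral>\<^sup>+t. ?K (1 * p + sqrt \<nu> * s) (m * q + sqrt \<sigma> * t) ((p\<^sup>2 + s\<^sup>2) + (q\<^sup>2 + t\<^sup>2)) \<partial>lborel \<partial>lborel \<partial>lborel \<partial>lborel)"
  proof (rule nn_integral_cong, rule nn_integral_cong)
    fix p q :: real
    let ?H = "\<lambda>z. H (fst z + p, fst (snd z) + m * q, snd (snd z) + (p\<^sup>2 + q\<^sup>2))"
    have "?H \<in> borel_measurable (borel \<Otimes>\<^sub>M borel \<Otimes>\<^sub>M borel)" by measurable
    from Suc.IH[OF this]
    show "(\<integral>\<^sup>+c. H (trig_val (Suc n) c \<phi> + p, trig_deriv (Suc n) c \<phi> + m * q, trig_sq (Suc n) c + (p\<^sup>2 + q\<^sup>2)) \<partial>trig_space (Suc n)) =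
        (\<integral>\<^sup>+s. \<integral>\<^sup>+t. ?K (1 * p + sqrt \<nu> * s) (m * q + sqrt \<sigma> * t) ((p\<^sup>2 + s\<^sup>2) + (q\<^sup>2 + t\<^sup>2)) \<partial>lborel \<partial>lborel)"
      unfolding \<nu>_def \<sigma>_def by (simp add: add_ac)
  qed
  \<comment> \<open>By induction the lower frequencies are collapsed to \<open>s\<close> and
    \<open>t\<close>. It remains to merge \<open>p\<close> with \<open>s\<close> and
    \<open>q\<close> with \<open>t\<close>, by one plane rotation each; the integrals are reordered
    so that the members of a pair are adjacent.\<close>
  also have "\<dots> = (\<integral>\<^sup>+p. \<integral>\<^sup>+s. \<integral>\<^sup>+q. \<integral>\<^sup>+t. ?K (1 * p + sqrt \<nu> * s) (m * q + sqrt \<sigma> * t) ((p\<^sup>2 + s\<^sup>2) + (q\<^sup>2 + t\<^sup>2)) \<partial>lborel \<partial>lborel \<partial>lborel \<partial>lborel)"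
    by (intro nn_integral_cong lborel_pair.Fubini') measurable
  also have "\<dots> = (\<integral>\<^sup>+p. \<integral>\<^sup>+s. \<integral>\<^sup>+q. \<integral>\<^sup>+t. ?K (sqrt (1\<^sup>2 + (sqrt \<nu>)\<^sup>2) * p) (m * q + sqrt \<sigma> * t) ((p\<^sup>2 + s\<^sup>2) + (q\<^sup>2 + t\<^sup>2)) \<partial>lborel \<partial>lborel \<partial>lborel \<partial>lborel)"
    by (rule nn_integral_linear_functional_radial[of "\<lambda>A R. \<integral>\<^sup>+q. \<integral>\<^sup>+t. ?K A (m * q + sqrt \<sigma> * t) (R + (q\<^sup>2 + t\<^sup>2)) \<partial>lborel \<partial>lborel", OF _ nz1]) measurable
  also have "\<dots> = (\<integral>\<^sup>+p. \<integral>\<^sup>+s. \<integral>\<^sup>+q. \<integral>\<^sup>+t. ?K (sqrt (1\<^sup>2 + (sqrt \<nu>)\<^sup>2) * p) (sqrt (m\<^sup>2 + (sqrt \<sigma>)\<^sup>2) * q) ((p\<^sup>2 + s\<^sup>2) + (q\<^sup>2 + t\<^sup>2)) \<partial>lborel \<partial>lborel \<partial>lborel \<partial>lborel)"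
  proof (rule nn_integral_cong, rule nn_integral_cong)
    fix p s :: real
    show "(\<integral>\<^sup>+q. \<integral>\<^sup>+t. ?K (sqrt (1\<^sup>2 + (sqrt \<nu>)\<^sup>2) * p) (m * q + sqrt \<sigma> * t) ((p\<^sup>2 + s\<^sup>2) + (q\<^sup>2 + t\<^sup>2)) \<partial>lborel \<partial>lborel) =
      (\<integral>\<^sup>+q. \<integral>\<^sup>+t. ?K (sqrt (1\<^sup>2 + (sqrt \<nu>)\<^sup>2) * p) (sqrt (m\<^sup>2 + (sqrt \<sigma>)\<^sup>2) * q) ((p\<^sup>2 + s\<^sup>2) + (q\<^sup>2 + t\<^sup>2)) \<partial>lborel \<partial>lborel)"
      by (rule nn_integral_linear_functional_radial[of "\<lambda>B R. ?K (sqrt (1\<^sup>2 + (sqrt \<nu>)\<^sup>2) * p) B ((p\<^sup>2 + s\<^sup>2) + R)", OF _ m]) measurable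
  qed
  also have "\<dots> = (\<integral>\<^sup>+p. \<integral>\<^sup>+q. \<integral>\<^sup>+s. \<integral>\<^sup>+t. ?K (sqrt (1\<^sup>2 + (sqrt \<nu>)\<^sup>2) * p) (sqrt (m\<^sup>2 + (sqrt \<sigma>)\<^sup>2) * q) ((p\<^sup>2 + s\<^sup>2) + (q\<^sup>2 + t\<^sup>2)) \<partial>lborel \<partial>lborel \<partial>lborel \<partial>lborel)"
    by (intro nn_integral_cong lborel_pair.Fubini') measurable
  \<comment> \<open>The coordinates \<open>s\<close> and \<open>t\<close>, freed by the two
    rotations, join the \<open>2 * n\<close> radial ones.\<close>
  also have "\<dots> = (\<integral>\<^sup>+p. \<integral>\<^sup>+q. rad_integral (2 * Suc n) (\<lambda>r. H (sqrt (Suc (Suc n)) * p, sqrt (\<Sum>k=1..Suc (Suc n). (real k)\<^sup>2) * q, r + (p\<^sup>2 + q\<^sup>2))) \<partial>lborel \<partial>lborel)"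
  proof (intro nn_integral_cong)
    fix p q :: real
    have "(\<Sum>k=1..Suc (Suc n). (real k)\<^sup>2) = m\<^sup>2 + (sqrt \<sigma>)\<^sup>2" using \<sigma> by simp
    note * = this \<nu>(1)
    show "(\<integral>\<^sup>+s. \<integral>\<^sup>+t. ?K (sqrt (1\<^sup>2 + (sqrt \<nu>)\<^sup>2) * p) (sqrt (m\<^sup>2 + (sqrt \<sigma>)\<^sup>2) * q) ((p\<^sup>2 + s\<^sup>2) + (q\<^sup>2 + t\<^sup>2)) \<partial>lborel \<partial>lborel) =
      rad_integral (2 * Suc n) (\<lambda>r. H (sqrt (Suc (Suc n)) * p, sqrt (\<Sum>k=1..Suc (Suc n). (real k)\<^sup>2) * q, r + (p\<^sup>2 + q\<^sup>2)))"
      unfolding * mult_Suc_right add_2_eq_Suc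
      by (subst rad_integral_Suc, measurable, subst rad_integral_Suc, measurable) (simp only: add_ac)
  qed
  finally show ?case .
qed

text \<open>Passing through \<open>w\<close> forces the constant coefficient to be
  \<open>sqrt 2\<close> times \<open>w - trig_val (Suc n) c \<phi>\<close>, and its square is the
  first term of the constraint. With \<open>\<nu> = sqrt (Suc n)\<close> and the value coordinate
  \<open>s\<close>, the terms in question are
  \<open>2 * (w - \<nu> * s)\<^sup>2 + s\<^sup>2\<close>. Completing the square makes
  \<open>s\<close> a radial coordinate, hence the dimension \<open>2 * n + 1\<close>, and leaves the
  least possible squared norm \<open>2 * w\<^sup>2 / (2 * n + 3)\<close>.\<close>

lemma nn_integral_trig_space_constrained:
  fixes H :: "real \<times> real \<Rightarrow> ennreal" and w \<phi> :: real and n :: nat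
  assumes [measurable]: "H \<in> borel_measurable (borel \<Otimes>\<^sub>M borel)"
  defines "S \<equiv> \<Sum>k=1..Suc n. (real k)\<^sup>2"
  shows "(\<integral>\<^sup>+c. H (trig_deriv (Suc n) c \<phi>, 2 * (w - trig_val (Suc n) c \<phi>)\<^sup>2 + trig_sq (Suc n) c) \<partial>trig_space (Suc n)) =
    ennreal (1 / sqrt (2 * n + 3)) *
      (\<integral>\<^sup>+t. rad_integral (2 * n + 1) (\<lambda>r. H (sqrt S * t, r + (t\<^sup>2 + 2 * w\<^sup>2 / (2 * n + 3)))) \<partial>lborel)"
proof -
  define \<nu> where "\<nu> = sqrt (Suc n)"
  define K where "K = real (2 * n + 3)"
  define \<kappa> where "\<kappa> = sqrt K"
  have \<kappa>: "\<kappa> > 0" "\<kappa>\<^sup>2 = K" "K > 0" by (auto simp: \<kappa>_def K_def)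
  have \<nu>: "2 * \<nu>\<^sup>2 = K - 1" by (simp add: \<nu>_def K_def)
  \<comment> \<open>\<open>K\<close> is the leading coefficient of the quadratic in the old variable
    and \<open>2 * \<nu> * w / K\<close> its minimiser; the scaling by \<open>1 / \<kappa>\<close>
    normalises the quadratic term to \<open>s\<^sup>2\<close>.\<close>
  have square: "2 * (w - \<nu> * (2 * \<nu> * w / K + 1 / \<kappa> * s))\<^sup>2 + (2 * \<nu> * w / K + 1 / \<kappa> * s)\<^sup>2 = s\<^sup>2 + 2 * w\<^sup>2 / K" for s
  proof -
    have "2 * (w - \<nu> * z)\<^sup>2 + z\<^sup>2 = (2 * \<nu>\<^sup>2 + 1) * z\<^sup>2 - 4 * \<nu> * w * z + 2 * w\<^sup>2" for z
      by (simp add: power2_eq_square algebra_simps)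
    also have "2 * \<nu>\<^sup>2 + 1 = K" using \<nu> by simp
    also have "K * z\<^sup>2 - 4 * \<nu> * w * z + 2 * w\<^sup>2 = (K * z - 2 * \<nu> * w)\<^sup>2 / K + (2 * w\<^sup>2 - 4 * \<nu>\<^sup>2 * w\<^sup>2 / K)" for z
      using \<kappa>(3) by (simp add: field_simps power2_eq_square)
    also have "2 * w\<^sup>2 - 4 * \<nu>\<^sup>2 * w\<^sup>2 / K = 2 * w\<^sup>2 / K"
    proof -
      have "4 * \<nu>\<^sup>2 * w\<^sup>2 = 2 * (K - 1) * w\<^sup>2" using \<nu> by simp
      then show ?thesis using \<kappa>(3) by (simp add: field_simps)
    qed
    finally have *: "2 * (w - \<nu> * z)\<^sup>2 + z\<^sup>2 = (K * z - 2 * \<nu> * w)\<^sup>2 / K + 2 * w\<^sup>2 / K" for z .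
    have "K * (2 * \<nu> * w / K + 1 / \<kappa> * s) - 2 * \<nu> * w = \<kappa> * s"
      using \<kappa> by (simp add: field_simps power2_eq_square)
    then show ?thesis unfolding * using \<kappa> by (simp add: power_mult_distrib)
  qed
  have "(\<integral>\<^sup>+c. H (trig_deriv (Suc n) c \<phi>, 2 * (w - trig_val (Suc n) c \<phi>)\<^sup>2 + trig_sq (Suc n) c) \<partial>trig_space (Suc n)) =
    (\<integral>\<^sup>+s. \<integral>\<^sup>+t. rad_integral (2 * n) (\<lambda>r. H (sqrt S * t, 2 * (w - \<nu> * s)\<^sup>2 + (r + (s\<^sup>2 + t\<^sup>2)))) \<partial>lborel \<partial>lborel)"
    using nn_integral_trig_space_value_derivative[of "\<lambda>z. H (fst (snd z), 2 * (w - fst z)\<^sup>2 + snd (snd z))" n \<phi>]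
    by (simp add: S_def \<nu>_def)
  also have "\<dots> = (\<integral>\<^sup>+t. \<integral>\<^sup>+s. rad_integral (2 * n) (\<lambda>r. H (sqrt S * t, 2 * (w - \<nu> * s)\<^sup>2 + (r + (s\<^sup>2 + t\<^sup>2)))) \<partial>lborel \<partial>lborel)"
    by (rule lborel_pair.Fubini') measurable
  also have "\<dots> = (\<integral>\<^sup>+t. ennreal (1 / \<kappa>) * (\<integral>\<^sup>+s. rad_integral (2 * n) (\<lambda>r. H (sqrt S * t, r + s\<^sup>2 + (t\<^sup>2 + 2 * w\<^sup>2 / K))) \<partial>lborel) \<partial>lborel)"
  proof (rule nn_integral_cong)
    fix t :: real
    let ?F = "\<lambda>s. rad_integral (2 * n) (\<lambda>r. H (sqrt S * t, 2 * (w - \<nu> * s)\<^sup>2 + (r + (s\<^sup>2 + t\<^sup>2))))"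
    have "(\<integral>\<^sup>+s. ?F s \<partial>lborel) = ennreal \<bar>1 / \<kappa>\<bar> * (\<integral>\<^sup>+s. ?F (2 * \<nu> * w / K + 1 / \<kappa> * s) \<partial>lborel)"
      using \<kappa> by (intro nn_integral_real_affine) auto
    moreover have "2 * (w - \<nu> * (2 * \<nu> * w / K + 1 / \<kappa> * s))\<^sup>2 + (r + ((2 * \<nu> * w / K + 1 / \<kappa> * s)\<^sup>2 + t\<^sup>2)) =
        r + s\<^sup>2 + (t\<^sup>2 + 2 * w\<^sup>2 / K)" for s r
      using square[of s] by linarith
    ultimately show "(\<integral>\<^sup>+s. ?F s \<partial>lborel) = ennreal (1 / \<kappa>) *
        (\<integral>\<^sup>+s. rad_integral (2 * n) (\<lambda>r. H (sqrt S * t, r + s\<^sup>2 + (t\<^sup>2 + 2 * w\<^sup>2 / K))) \<partial>lborel)"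
      using \<kappa>(1) by (simp only: abs_of_pos zero_less_divide_1_iff)
  qed
  also have "\<dots> = (\<integral>\<^sup>+t. ennreal (1 / \<kappa>) * rad_integral (2 * n + 1) (\<lambda>r. H (sqrt S * t, r + (t\<^sup>2 + 2 * w\<^sup>2 / K))) \<partial>lborel)"
    by (simp add: rad_integral_Suc)
  also have "\<dots> = ennreal (1 / \<kappa>) * (\<integral>\<^sup>+t. rad_integral (2 * n + 1) (\<lambda>r. H (sqrt S * t, r + (t\<^sup>2 + 2 * w\<^sup>2 / K))) \<partial>lborel)"
    by (rule nn_integral_cmult) measurable
  finally show ?thesis by (simp add: \<kappa>_def K_def)
qed

text \<open>The previous lemma is applied to one component after the other; in \<open>inner\<close>
  the number \<open>X\<close> is the squared norm already spent by the other component. The two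
  groups of \<open>2 * n + 1\<close> radial coordinates combine to a ball volume in
  \<open>4 * n + 2\<close> dimensions, while \<open>s\<close> and \<open>t\<close> are the
  derivative coordinates of the two components.\<close>

lemma nn_integral_curve_constrained:
  fixes G :: "real \<times> real \<Rightarrow> ennreal" and w1 w2 \<phi> \<rho> :: real and n :: nat
  assumes [measurable]: "G \<in> borel_measurable (borel \<Otimes>\<^sub>M borel)"
  defines "S \<equiv> \<Sum>k=1..Suc n. (real k)\<^sup>2"
  shows "(\<integral>\<^sup>+a. \<integral>\<^sup>+b. G (trig_deriv (Suc n) a \<phi>, trig_deriv (Suc n) b \<phi>) *
      indicator {..\<rho>} (2 * (w1 - trig_val (Suc n) a \<phi>)\<^sup>2 + trig_sq (Suc n) a +
        (2 * (w2 - trig_val (Suc n) b \<phi>)\<^sup>2 + trig_sq (Suc n) b)) \<partial>trig_space (Suc n) \<partial>trig_space (Suc n)) =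
    ennreal (1 / (2 * n + 3)) *
      (\<integral>\<^sup>+s. \<integral>\<^sup>+t. G (sqrt S * s, sqrt S * t) *
        ball_vol (4 * n + 2) (\<rho> - 2 * (w1\<^sup>2 + w2\<^sup>2) / (2 * n + 3) - (s\<^sup>2 + t\<^sup>2)) \<partial>lborel \<partial>lborel)"
proof -
  define K where "K = real (2 * n + 3)"
  define k where "k = ennreal (1 / sqrt K)"
  have kk: "k * k = ennreal (1 / K)"
    by (simp add: k_def ennreal_mult[symmetric] K_def)
  have Krw: "real 2 * real n + 3 = K" "2 * real n + 3 = K" "real (2 * n) + 3 = K" by (auto simp: K_def)
  have ind: "indicator {..\<rho>} (X + (r + y)) = (indicator {..\<rho> - y - X} r :: ennreal)" for X r y :: real
    by (auto simp: indicator_def)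
  have inner: "(\<integral>\<^sup>+b. G (\<tau>, trig_deriv (Suc n) b \<phi>) * indicator {..\<rho>} (X +
        (2 * (w2 - trig_val (Suc n) b \<phi>)\<^sup>2 + trig_sq (Suc n) b)) \<partial>trig_space (Suc n)) =
      k * (\<integral>\<^sup>+t. G (\<tau>, sqrt S * t) * ball_vol (2 * n + 1) (\<rho> - (t\<^sup>2 + 2 * w2\<^sup>2 / K) - X) \<partial>lborel)" for \<tau> X
  proof -
    have "(\<lambda>z. G (\<tau>, fst z) * indicator {..\<rho>} (X + snd z)) \<in> borel_measurable (borel \<Otimes>\<^sub>M borel)"
      by measurable
    from nn_integral_trig_space_constrained[OF this, of n \<phi> w2]
    have "(\<integral>\<^sup>+b. G (\<tau>, trig_deriv (Suc n) b \<phi>) * indicator {..\<rho>} (X +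
        (2 * (w2 - trig_val (Suc n) b \<phi>)\<^sup>2 + trig_sq (Suc n) b)) \<partial>trig_space (Suc n)) =
      k * (\<integral>\<^sup>+t. rad_integral (2 * n + 1) (\<lambda>r. G (\<tau>, sqrt S * t) * indicator {..\<rho>} (X + (r + (t\<^sup>2 + 2 * w2\<^sup>2 / K)))) \<partial>lborel)"
      by (simp add: S_def k_def K_def)
    also have "\<dots> = k * (\<integral>\<^sup>+t. G (\<tau>, sqrt S * t) * ball_vol (2 * n + 1) (\<rho> - (t\<^sup>2 + 2 * w2\<^sup>2 / K) - X) \<partial>lborel)"
      unfolding ball_vol_def ind by (subst rad_integral_cmult) auto
    finally show ?thesis .
  qed
  have "(\<integral>\<^sup>+a. \<integral>\<^sup>+b. G (trig_deriv (Suc n) a \<phi>, trig_deriv (Suc n) b \<phi>) *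
      indicator {..\<rho>} (2 * (w1 - trig_val (Suc n) a \<phi>)\<^sup>2 + trig_sq (Suc n) a +
        (2 * (w2 - trig_val (Suc n) b \<phi>)\<^sup>2 + trig_sq (Suc n) b)) \<partial>trig_space (Suc n) \<partial>trig_space (Suc n)) =
    (\<integral>\<^sup>+a. k * (\<integral>\<^sup>+t. G (trig_deriv (Suc n) a \<phi>, sqrt S * t) *
      ball_vol (2 * n + 1) (\<rho> - (t\<^sup>2 + 2 * w2\<^sup>2 / K) - (2 * (w1 - trig_val (Suc n) a \<phi>)\<^sup>2 + trig_sq (Suc n) a)) \<partial>lborel) \<partial>trig_space (Suc n))"
    by (simp add: inner)
  also have "\<dots> = k * (\<integral>\<^sup>+s. rad_integral (2 * n + 1) (\<lambda>r. k * (\<integral>\<^sup>+t. G (sqrt S * s, sqrt S * t) *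
      ball_vol (2 * n + 1) (\<rho> - (t\<^sup>2 + 2 * w2\<^sup>2 / K) - (r + (s\<^sup>2 + 2 * w1\<^sup>2 / K))) \<partial>lborel)) \<partial>lborel)"
  proof -
    have "(\<lambda>z. k * (\<integral>\<^sup>+t. G (fst z, sqrt S * t) *
      ball_vol (2 * n + 1) (\<rho> - (t\<^sup>2 + 2 * w2\<^sup>2 / K) - snd z) \<partial>lborel)) \<in> borel_measurable (borel \<Otimes>\<^sub>M borel)"
      by measurable
    from nn_integral_trig_space_constrained[OF this, of n \<phi> w1] show ?thesis
      by (simp add: S_def k_def K_def)
  qed
  also have "\<dots> = k * (\<integral>\<^sup>+s. k * (\<integral>\<^sup>+t. G (sqrt S * s, sqrt S * t) *
        ball_vol (4 * n + 2) (\<rho> - 2 * (w1\<^sup>2 + w2\<^sup>2) / K - (s\<^sup>2 + t\<^sup>2)) \<partial>lborel) \<partial>lborel)"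
  proof (intro arg_cong2[where f = "(*)"] nn_integral_cong refl)
    fix s :: real
    have "rad_integral (2 * n + 1) (\<lambda>r. k * (\<integral>\<^sup>+t. G (sqrt S * s, sqrt S * t) *
      ball_vol (2 * n + 1) (\<rho> - (t\<^sup>2 + 2 * w2\<^sup>2 / K) - (r + (s\<^sup>2 + 2 * w1\<^sup>2 / K))) \<partial>lborel)) =
      k * rad_integral (2 * n + 1) (\<lambda>r. \<integral>\<^sup>+t. G (sqrt S * s, sqrt S * t) *
      ball_vol (2 * n + 1) (\<rho> - (t\<^sup>2 + 2 * w2\<^sup>2 / K) - (r + (s\<^sup>2 + 2 * w1\<^sup>2 / K))) \<partial>lborel)"
      by (rule rad_integral_cmult) measurable
    also have "rad_integral (2 * n + 1) (\<lambda>r. \<integral>\<^sup>+t. G (sqrt S * s, sqrt S * t) *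
      ball_vol (2 * n + 1) (\<rho> - (t\<^sup>2 + 2 * w2\<^sup>2 / K) - (r + (s\<^sup>2 + 2 * w1\<^sup>2 / K))) \<partial>lborel) =
      (\<integral>\<^sup>+t. rad_integral (2 * n + 1) (\<lambda>r. G (sqrt S * s, sqrt S * t) *
      ball_vol (2 * n + 1) (\<rho> - (t\<^sup>2 + 2 * w2\<^sup>2 / K) - (r + (s\<^sup>2 + 2 * w1\<^sup>2 / K)))) \<partial>lborel)"
      by (rule rad_integral_swap[symmetric, OF lborel.sigma_finite_measure_axioms]) measurable
    also have "\<dots> = (\<integral>\<^sup>+t. G (sqrt S * s, sqrt S * t) *
        ball_vol (4 * n + 2) (\<rho> - 2 * (w1\<^sup>2 + w2\<^sup>2) / K - (s\<^sup>2 + t\<^sup>2)) \<partial>lborel)"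
    proof (rule nn_integral_cong)
      fix t :: real
      let ?\<rho> = "\<rho> - 2 * (w1\<^sup>2 + w2\<^sup>2) / K - (s\<^sup>2 + t\<^sup>2)"
      have *: "\<rho> - (t\<^sup>2 + 2 * w2\<^sup>2 / K) - (r + (s\<^sup>2 + 2 * w1\<^sup>2 / K)) = ?\<rho> - r" for r
        by (simp add: add_divide_distrib)
      have "rad_integral (2 * n + 1) (\<lambda>r. G (sqrt S * s, sqrt S * t) * ball_vol (2 * n + 1) (?\<rho> - r)) =
        G (sqrt S * s, sqrt S * t) * rad_integral (2 * n + 1) (\<lambda>r. ball_vol (2 * n + 1) (?\<rho> - r))"
        by (rule rad_integral_cmult) measurable
      also have "rad_integral (2 * n + 1) (\<lambda>r. ball_vol (2 * n + 1) (?\<rho> - r)) = ball_vol (4 * n + 2) ?\<rho>"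
        unfolding rad_integral_ball_vol by (rule arg_cong2[where f = ball_vol]) simp_all
      finally show "rad_integral (2 * n + 1) (\<lambda>r. G (sqrt S * s, sqrt S * t) *
          ball_vol (2 * n + 1) (\<rho> - (t\<^sup>2 + 2 * w2\<^sup>2 / K) - (r + (s\<^sup>2 + 2 * w1\<^sup>2 / K)))) =
        G (sqrt S * s, sqrt S * t) * ball_vol (4 * n + 2) ?\<rho>" unfolding * .
    qed
    finally show "rad_integral (2 * n + 1) (\<lambda>r. k * (\<integral>\<^sup>+t. G (sqrt S * s, sqrt S * t) *
      ball_vol (2 * n + 1) (\<rho> - (t\<^sup>2 + 2 * w2\<^sup>2 / K) - (r + (s\<^sup>2 + 2 * w1\<^sup>2 / K))) \<partial>lborel)) =
      k * (\<integral>\<^sup>+t. G (sqrt S * s, sqrt S * t) *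
        ball_vol (4 * n + 2) (\<rho> - 2 * (w1\<^sup>2 + w2\<^sup>2) / K - (s\<^sup>2 + t\<^sup>2)) \<partial>lborel)" .
  qed
  also have "\<dots> = k * k * (\<integral>\<^sup>+s. \<integral>\<^sup>+t. G (sqrt S * s, sqrt S * t) *
        ball_vol (4 * n + 2) (\<rho> - 2 * (w1\<^sup>2 + w2\<^sup>2) / K - (s\<^sup>2 + t\<^sup>2)) \<partial>lborel \<partial>lborel)"
    by (subst nn_integral_cmult) (auto simp: mult.assoc)
  finally show ?thesis unfolding kk by (simp add: K_def)
qed

section \<open>Moments of ball volumes\<close>

text \<open>The hypothesis identifies the distribution of \<open>f\<close> as \<open>c\<close> times
  Lebesgue measure on the half-line, which determines the integral of every function of
  \<open>f\<close>.\<close>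

lemma nn_integral_eq_of_sublevel_sets:
  fixes f :: "'a \<Rightarrow> real" and c :: real
  assumes [measurable]: "f \<in> borel_measurable M" "H \<in> borel_measurable borel" and c: "c \<ge> 0"
    and sub: "\<And>a. emeasure M {x \<in> space M. f x < a} = ennreal (c * max 0 a)"
  shows "(\<integral>\<^sup>+x. H (f x) \<partial>M) = ennreal c * (\<integral>\<^sup>+r\<in>{0..}. H r \<partial>lborel)"
proof -
  define \<nu> where "\<nu> = density lborel (\<lambda>r::real. ennreal c * indicator {0..} r)"
  have \<nu>: "emeasure \<nu> {..<a} = ennreal (c * max 0 a)" for a
  proof -
    have "emeasure \<nu> {..<a} = (\<integral>\<^sup>+r. ennreal c * (indicator {0..<a} r) \<partial>lborel)"
      unfolding \<nu>_def by (subst emeasure_density) (auto intro!: nn_integral_cong simp: indicator_def)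
    also have "\<dots> = ennreal c * emeasure lborel {0..<a}" by (simp add: nn_integral_cmult)
    also have "\<dots> = ennreal (c * max 0 a)"
      using c by (cases "a \<ge> 0") (auto simp: ennreal_mult max_def)
    finally show ?thesis .
  qed
  have [measurable_cong]: "sets \<nu> = sets borel" by (simp add: \<nu>_def)
  \<comment> \<open>The uniqueness theorem compares measures on the rays \<open>{a<..}\<close> and
    requires finite values. On the half-line only the opposite rays have finite measure, hence the
    sign change.\<close>
  have eq: "distr M borel (\<lambda>x. - f x) = distr \<nu> borel uminus"
  proof (rule measure_eqI_lessThan)
    fix a :: real
    have "emeasure (distr M borel (\<lambda>x. - f x)) {a<..} = emeasure M {x \<in> space M. f x < - a}"
      by (subst emeasure_distr) (auto intro!: arg_cong[where f = "emeasure M"])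
    then have 1: "emeasure (distr M borel (\<lambda>x. - f x)) {a<..} = ennreal (c * max 0 (- a))"
      by (simp add: sub)
    have "emeasure (distr \<nu> borel uminus) {a<..} = emeasure \<nu> {..<- a}"
    proof -
      have "uminus -` {a<..} = {..<- a}" by auto
      then show ?thesis by (subst emeasure_distr) (auto simp: \<nu>_def)
    qed
    with 1 show "emeasure (distr M borel (\<lambda>x. - f x)) {a<..} < \<infinity>"
      "emeasure (distr M borel (\<lambda>x. - f x)) {a<..} = emeasure (distr \<nu> borel uminus) {a<..}"
      by (simp_all add: \<nu>)
  qed auto
  have "(\<integral>\<^sup>+x. H (f x) \<partial>M) = (\<integral>\<^sup>+y. H (- y) \<partial>distr M borel (\<lambda>x. - f x))"
    by (simp add: nn_integral_distr)
  also have "\<dots> = (\<integral>\<^sup>+r. H r \<partial>\<nu>)" unfolding eq by (simp add: nn_integral_distr)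
  also have "\<dots> = (\<integral>\<^sup>+r. ennreal c * (H r * indicator {0..} r) \<partial>lborel)"
    unfolding \<nu>_def by (subst nn_integral_density) (auto simp: mult_ac)
  also have "\<dots> = ennreal c * (\<integral>\<^sup>+r\<in>{0..}. H r \<partial>lborel)" by (rule nn_integral_cmult) measurable
  finally show ?thesis .
qed

text \<open>The area of a disc is linear in its squared radius, so the squared radius is distributed
  like \<open>pi\<close> times Lebesgue measure on the half-line.\<close>

lemma nn_integral_radial_plane:
  fixes H :: "real \<Rightarrow> ennreal"
  assumes [measurable]: "H \<in> borel_measurable borel"
  shows "(\<integral>\<^sup>+x. \<integral>\<^sup>+y. H (x\<^sup>2 + y\<^sup>2) \<partial>lborel \<partial>lborel) = ennreal pi * (\<integral>\<^sup>+r\<in>{0..}. H r \<partial>lborel)"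
proof -
  have [measurable]: "(fst :: real \<times> real \<Rightarrow> real) \<in> borel_measurable (lborel \<Otimes>\<^sub>M lborel)"
    "(snd :: real \<times> real \<Rightarrow> real) \<in> borel_measurable (lborel \<Otimes>\<^sub>M lborel)"
    using measurable_fst[of lborel lborel] measurable_snd[of lborel lborel] by simp_all
  have "(\<integral>\<^sup>+x. \<integral>\<^sup>+y. H (x\<^sup>2 + y\<^sup>2) \<partial>lborel \<partial>lborel) = (\<integral>\<^sup>+z. H ((fst z)\<^sup>2 + (snd z)\<^sup>2) \<partial>(lborel \<Otimes>\<^sub>M lborel))"
  proof (subst lborel.nn_integral_fst[symmetric])
    show "(\<lambda>z :: real \<times> real. H ((fst z)\<^sup>2 + (snd z)\<^sup>2)) \<in> borel_measurable (lborel \<Otimes>\<^sub>M lborel)"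
      by measurable
  qed simp
  also have "\<dots> = ennreal pi * (\<integral>\<^sup>+r\<in>{0..}. H r \<partial>lborel)"
  proof (rule nn_integral_eq_of_sublevel_sets)
    fix a :: real
    show "emeasure (lborel \<Otimes>\<^sub>M lborel) {z \<in> space (lborel \<Otimes>\<^sub>M lborel). (fst z)\<^sup>2 + (snd z)\<^sup>2 < a} = ennreal (pi * max 0 a)"
    proof (cases "a > 0")
      case True
      have "{z \<in> space (lborel \<Otimes>\<^sub>M lborel). (fst z)\<^sup>2 + (snd z)\<^sup>2 < a} = ball (0 :: real \<times> real) (sqrt a)"
        by (auto simp: space_pair_measure norm_prod_def)
      then show ?thesis using True by (simp add: lborel_prod emeasure_ball unit_ball_vol_2)
    next
      case False
      then have *: "{z \<in> space (lborel \<Otimes>\<^sub>M lborel). (fst z)\<^sup>2 + (snd z)\<^sup>2 < a} = {}"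
        by (auto simp: not_less intro: order_trans)
      show ?thesis using False unfolding * by (simp add: max_def)
    qed
  qed auto
  finally show ?thesis .
qed

text \<open>Under the density \<open>\<bar>x\<bar>\<close> the set \<open>x\<^sup>2 < a\<close> has
  mass exactly \<open>a\<close> for positive \<open>a\<close>, each sign of \<open>x\<close>
  contributing \<open>a / 2\<close>; so \<open>x\<^sup>2\<close> is distributed like Lebesgue
  measure on the half-line.\<close>

lemma nn_integral_abs_even:
  assumes [measurable]: "H \<in> borel_measurable borel"
  shows "(\<integral>\<^sup>+x. ennreal \<bar>x\<bar> * H (x\<^sup>2) \<partial>lborel) = (\<integral>\<^sup>+r\<in>{0..}. H r \<partial>lborel)"
proof -
  have "(\<integral>\<^sup>+x. ennreal \<bar>x\<bar> * H (x\<^sup>2) \<partial>lborel) = (\<integral>\<^sup>+x. H (x\<^sup>2) \<partial>density lborel (\<lambda>x. ennreal \<bar>x\<bar>))"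
    by (simp add: nn_integral_density)
  also have "\<dots> = ennreal 1 * (\<integral>\<^sup>+r\<in>{0..}. H r \<partial>lborel)"
  proof (rule nn_integral_eq_of_sublevel_sets)
    fix a :: real
    show "emeasure (density lborel (\<lambda>x. ennreal \<bar>x\<bar>)) {x \<in> space (density lborel (\<lambda>x. ennreal \<bar>x\<bar>)). x\<^sup>2 < a} = ennreal (1 * max 0 a)"
    proof (cases "a > 0")
      case True
      define s where "s = sqrt a"
      have s: "s > 0" "s\<^sup>2 = a" using True by (auto simp: s_def)
      \<comment> \<open>This antiderivative of \<open>\<bar>t\<bar>\<close> is valid across 0, so
        the symmetric interval need not be cut.\<close>
      have D: "((\<lambda>t. t * \<bar>t\<bar> / 2) has_real_derivative \<bar>t\<bar>) (at t)" for t :: real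
      proof -
        consider "t > 0" | "t < 0" | "t = 0" by linarith
        then show ?thesis
        proof cases
          case 1
          have "((\<lambda>t. t * t / 2) has_real_derivative \<bar>t\<bar>) (at t)"
            using 1 by (auto intro!: derivative_eq_intros)
          then show ?thesis
            by (rule has_field_derivative_transform_within_open[where S = "{0<..}"]) (use 1 in auto)
        next
          case 2
          have "((\<lambda>t. - (t * t / 2)) has_real_derivative \<bar>t\<bar>) (at t)"
            using 2 by (auto intro!: derivative_eq_intros)
          then show ?thesis
            by (rule has_field_derivative_transform_within_open[where S = "{..<0}"]) (use 2 in auto)
        next
          case 3
          have "((\<lambda>h. \<bar>h\<bar> / 2) \<longlongrightarrow> 0) (at (0::real))" by (auto intro!: tendsto_eq_intros)
          then have "((\<lambda>h. ((0 + h) * \<bar>0 + h\<bar> / 2 - 0 * \<bar>0\<bar> / 2) / h) \<longlongrightarrow> 0) (at (0::real))"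
            by (rule Lim_transform_eventually) (auto simp: eventually_at intro!: exI[of _ 1])
          then show ?thesis using 3 by (simp add: DERIV_def)
        qed
      qed
      have "emeasure (density lborel (\<lambda>x. ennreal \<bar>x\<bar>)) {x \<in> space (density lborel (\<lambda>x. ennreal \<bar>x\<bar>)). x\<^sup>2 < a} =
          (\<integral>\<^sup>+x. ennreal \<bar>x\<bar> * indicator {x. x\<^sup>2 < a} x \<partial>lborel)"
        by (subst emeasure_density) auto
      also have "\<dots> = (\<integral>\<^sup>+x. ennreal \<bar>x\<bar> * indicator {- s..s} x \<partial>lborel)"
      proof (rule nn_integral_cong_AE)
        have "AE x in lborel. x \<noteq> s \<and> x \<noteq> - s" by (auto simp: AE_lborel_singleton)
        then show "AE x in lborel. ennreal \<bar>x\<bar> * indicator {x. x\<^sup>2 < a} x = ennreal \<bar>x\<bar> * indicator {- s..s} x"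
        proof eventually_elim
          case (elim x)
          have "x\<^sup>2 < a \<longleftrightarrow> \<bar>x\<bar> < s" using s abs_le_square_iff[of s x] by auto
          then show ?case using elim by (auto simp: indicator_def)
        qed
      qed
      also have "\<dots> = s * \<bar>s\<bar> / 2 - - s * \<bar>- s\<bar> / 2"
        by (rule nn_integral_FTC_Icc) (use s D in \<open>auto intro: has_field_derivative_at_within\<close>)
      also have "s * \<bar>s\<bar> / 2 - - s * \<bar>- s\<bar> / 2 = a" using s by (simp add: power2_eq_square)
      finally show ?thesis using True by simp
    next
      case False
      then have *: "{x \<in> space (density lborel (\<lambda>x. ennreal \<bar>x\<bar>)). x\<^sup>2 < a} = {}"
        by (auto simp: not_less intro: order_trans)
      show ?thesis using False unfolding * by (simp add: max_def)
    qed
  qed auto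
  finally show ?thesis by simp
qed

lemma ball_vol_add_2: "ball_vol (d + 2) \<sigma> = ennreal pi * (\<integral>\<^sup>+r\<in>{0..}. ball_vol d (\<sigma> - r) \<partial>lborel)"
proof -
  have "ball_vol (d + 2) \<sigma> = (\<integral>\<^sup>+x. \<integral>\<^sup>+y. ball_vol d (\<sigma> - (x\<^sup>2 + y\<^sup>2)) \<partial>lborel \<partial>lborel)"
    by (simp add: ball_vol_Suc algebra_simps)
  also have "\<dots> = ennreal pi * (\<integral>\<^sup>+r\<in>{0..}. ball_vol d (\<sigma> - r) \<partial>lborel)"
    by (rule nn_integral_radial_plane) measurable
  finally show ?thesis .
qed

lemma nn_integral_cmult2:
  fixes f :: "real \<Rightarrow> real \<Rightarrow> ennreal"
  assumes [measurable]: "case_prod f \<in> borel_measurable (borel \<Otimes>\<^sub>M borel)"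
  shows "(\<integral>\<^sup>+x. \<integral>\<^sup>+y. c * f x y \<partial>lborel \<partial>lborel) = c * (\<integral>\<^sup>+x. \<integral>\<^sup>+y. f x y \<partial>lborel \<partial>lborel)"
  by (simp add: nn_integral_cmult)

lemma ennreal_pi_cancel: "ennreal (1 / pi) * (ennreal pi * x) = x"
  by (simp add: mult.assoc[symmetric] ennreal_mult[symmetric])

text \<open>Against a function of \<open>x\<^sup>2\<close>, the weight \<open>\<bar>x\<bar>\<close>
  makes the single variable \<open>x\<close> count as a whole plane, up to the factor
  \<open>1 / pi\<close>. Together with \<open>y\<close> this adds three dimensions.\<close>

lemma nn_integral_abs_ball_vol:
  "(\<integral>\<^sup>+x. \<integral>\<^sup>+y. ennreal \<bar>x\<bar> * ball_vol d (\<sigma> - (x\<^sup>2 + y\<^sup>2)) \<partial>lborel \<partial>lborel) = ennreal (1 / pi) * ball_vol (d + 3) \<sigma>"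
proof -
  have d3: "d + 3 = Suc (d + 2)" by simp
  have "(\<integral>\<^sup>+x. \<integral>\<^sup>+y. ennreal \<bar>x\<bar> * ball_vol d (\<sigma> - (x\<^sup>2 + y\<^sup>2)) \<partial>lborel \<partial>lborel) =
    (\<integral>\<^sup>+y. \<integral>\<^sup>+x. ennreal \<bar>x\<bar> * ball_vol d (\<sigma> - (x\<^sup>2 + y\<^sup>2)) \<partial>lborel \<partial>lborel)"
    by (rule lborel_pair.Fubini'[symmetric]) measurable
  also have "\<dots> = (\<integral>\<^sup>+y. ennreal (1 / pi) * ball_vol (d + 2) (\<sigma> - y\<^sup>2) \<partial>lborel)"
  proof (rule nn_integral_cong)
    fix y :: real
    have "(\<integral>\<^sup>+x. ennreal \<bar>x\<bar> * ball_vol d (\<sigma> - (x\<^sup>2 + y\<^sup>2)) \<partial>lborel) =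
        (\<integral>\<^sup>+r\<in>{0..}. ball_vol d (\<sigma> - (r + y\<^sup>2)) \<partial>lborel)"
      by (rule nn_integral_abs_even) measurable
    then show "(\<integral>\<^sup>+x. ennreal \<bar>x\<bar> * ball_vol d (\<sigma> - (x\<^sup>2 + y\<^sup>2)) \<partial>lborel) = ennreal (1 / pi) * ball_vol (d + 2) (\<sigma> - y\<^sup>2)"
      by (simp only: ball_vol_add_2 ennreal_pi_cancel) (simp add: algebra_simps)
  qed
  also have "\<dots> = ennreal (1 / pi) * (\<integral>\<^sup>+y. ball_vol (d + 2) (\<sigma> - y\<^sup>2) \<partial>lborel)"
    by (rule nn_integral_cmult) measurable
  also have "(\<integral>\<^sup>+y. ball_vol (d + 2) (\<sigma> - y\<^sup>2) \<partial>lborel) = ball_vol (d + 3) \<sigma>"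
    by (simp only: d3 ball_vol_Suc[of "d + 2"])
  finally show ?thesis .
qed

text \<open>\<open>2 * sqrt q\<close> is the length of the interval of all \<open>z\<close> with
  \<open>z\<^sup>2 \<le> q\<close>. The weight is therefore half the extent of one more coordinate,
  and Fubini in \<open>z\<close> and \<open>q\<close> recognises a ball with three more
  dimensions.\<close>

lemma nn_integral_norm_ball_vol:
  "(\<integral>\<^sup>+x. \<integral>\<^sup>+y. ennreal (sqrt (x\<^sup>2 + y\<^sup>2)) * ball_vol d (\<sigma> - (x\<^sup>2 + y\<^sup>2)) \<partial>lborel \<partial>lborel) = ennreal (1 / 2) * ball_vol (d + 3) \<sigma>"
proof -
  have d3: "d + 3 = Suc (d + 2)" by simp
  let ?I = "\<integral>\<^sup>+q. ennreal (sqrt q) * ball_vol d (\<sigma> - q) * indicator {0..} q \<partial>lborel"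
  have "ball_vol (d + 3) \<sigma> = (\<integral>\<^sup>+z. ball_vol (d + 2) (\<sigma> - z\<^sup>2) \<partial>lborel)"
    by (simp only: d3 ball_vol_Suc[of "d + 2"])
  also have "\<dots> = (\<integral>\<^sup>+z. ennreal pi * (\<integral>\<^sup>+q. ball_vol d (\<sigma> - q) * indicator {p. (fst p)\<^sup>2 \<le> snd p} (z, q) \<partial>lborel) \<partial>lborel)"
  proof (rule nn_integral_cong)
    fix z :: real
    have "(\<integral>\<^sup>+q. ball_vol d (\<sigma> - q) * indicator {p. (fst p)\<^sup>2 \<le> snd p} (z, q) \<partial>lborel) =
        (\<integral>\<^sup>+r\<in>{0..}. ball_vol d (\<sigma> - z\<^sup>2 - r) \<partial>lborel)"
      by (subst nn_integral_real_affine[where c = 1 and t = "z\<^sup>2"])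
         (auto simp: indicator_def algebra_simps intro!: nn_integral_cong)
    then show "ball_vol (d + 2) (\<sigma> - z\<^sup>2) =
      ennreal pi * (\<integral>\<^sup>+q. ball_vol d (\<sigma> - q) * indicator {p. (fst p)\<^sup>2 \<le> snd p} (z, q) \<partial>lborel)"
      by (simp only: ball_vol_add_2)
  qed
  also have "\<dots> = ennreal pi * (\<integral>\<^sup>+z. \<integral>\<^sup>+q. ball_vol d (\<sigma> - q) * indicator {p. (fst p)\<^sup>2 \<le> snd p} (z, q) \<partial>lborel \<partial>lborel)"
    by (rule nn_integral_cmult) measurable
  also have "(\<integral>\<^sup>+z. \<integral>\<^sup>+q. ball_vol d (\<sigma> - q) * indicator {p. (fst p)\<^sup>2 \<le> snd p} (z, q) \<partial>lborel \<partial>lborel) =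
      (\<integral>\<^sup>+q. \<integral>\<^sup>+z. ball_vol d (\<sigma> - q) * indicator {p. (fst p)\<^sup>2 \<le> snd p} (z, q) \<partial>lborel \<partial>lborel)"
    by (rule lborel_pair.Fubini'[symmetric]) measurable
  also have "\<dots> = (\<integral>\<^sup>+q. 2 * (ennreal (sqrt q) * ball_vol d (\<sigma> - q) * indicator {0..} q) \<partial>lborel)"
  proof (rule nn_integral_cong)
    fix q :: real
    have "(\<integral>\<^sup>+z. indicator {p. (fst p)\<^sup>2 \<le> snd p} (z, q) \<partial>lborel) = 2 * (ennreal (sqrt q) * indicator {0..} q)"
    proof (cases "q \<ge> 0")
      case True
      have "indicator {p. (fst p)\<^sup>2 \<le> snd p} (z, q) = (indicator {- sqrt q..sqrt q} z :: ennreal)" for z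
        using True real_le_rsqrt[of z q] real_le_rsqrt[of "- z" q] sqrt_ge_absD[of z q] by (fastforce simp: indicator_def abs_le_iff)
      then show ?thesis using True by (simp add: ennreal_mult'[symmetric] flip: ennreal_numeral)
    next
      case False
      then have "indicator {p. (fst p)\<^sup>2 \<le> snd p} (z, q) = (0 :: ennreal)" for z
        using zero_le_power2[of z] order_trans[of 0 "z\<^sup>2" q] by (auto simp: indicator_def simp del: zero_le_power2)
      then show ?thesis using False by simp
    qed
    then show "(\<integral>\<^sup>+z. ball_vol d (\<sigma> - q) * indicator {p. (fst p)\<^sup>2 \<le> snd p} (z, q) \<partial>lborel) =
        2 * (ennreal (sqrt q) * ball_vol d (\<sigma> - q) * indicator {0..} q)"
      by (subst nn_integral_cmult) (auto simp: mult_ac)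
  qed
  also have "\<dots> = 2 * ?I" by (rule nn_integral_cmult) measurable
  finally have "ennreal (1 / 2) * ball_vol (d + 3) \<sigma> = (ennreal (1 / 2) * ennreal 2) * (ennreal pi * ?I)"
    by (simp add: mult_ac)
  also have "ennreal (1 / 2) * ennreal 2 = 1" by (subst ennreal_mult[symmetric]) auto
  also have "1 * (ennreal pi * ?I) = (\<integral>\<^sup>+x. \<integral>\<^sup>+y. ennreal (sqrt (x\<^sup>2 + y\<^sup>2)) * ball_vol d (\<sigma> - (x\<^sup>2 + y\<^sup>2)) \<partial>lborel \<partial>lborel)"
    by (subst nn_integral_radial_plane[of "\<lambda>r. ennreal (sqrt r) * ball_vol d (\<sigma> - r)"]) auto
  finally show ?thesis by simp
qed

text \<open>For fixed \<open>(s, t)\<close> the determinant is a linear functional of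
  \<open>(s', t')\<close> with norm \<open>sqrt (s\<^sup>2 + t\<^sup>2)\<close>. So the inner
  integral is this norm times the moment with constant \<open>1 / pi\<close>, and the outer one is
  the moment with constant \<open>1 / 2\<close>.\<close>

lemma nn_integral_cross_ball_vol:
  "(\<integral>\<^sup>+s. \<integral>\<^sup>+t. (\<integral>\<^sup>+s'. \<integral>\<^sup>+t'. ennreal \<bar>s * t' - t * s'\<bar> * ball_vol d (\<sigma> - (s'\<^sup>2 + t'\<^sup>2)) \<partial>lborel \<partial>lborel) *
      ball_vol d (\<sigma> - (s\<^sup>2 + t\<^sup>2)) \<partial>lborel \<partial>lborel) = ennreal (1 / (2 * pi)) * (ball_vol (d + 3) \<sigma>)\<^sup>2"
proof -
  let ?c = "ennreal (1 / pi) * ball_vol (d + 3) \<sigma>"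
  have inner: "(\<integral>\<^sup>+s'. \<integral>\<^sup>+t'. ennreal \<bar>s * t' - t * s'\<bar> * ball_vol d (\<sigma> - (s'\<^sup>2 + t'\<^sup>2)) \<partial>lborel \<partial>lborel) =
      ennreal (sqrt (s\<^sup>2 + t\<^sup>2)) * ?c" for s t
  proof (cases "s = 0 \<and> t = 0")
    case False
    then have nz: "(- t)\<^sup>2 + s\<^sup>2 \<noteq> 0" by (auto simp: add_nonneg_eq_0_iff)
    let ?n = "sqrt (s\<^sup>2 + t\<^sup>2)"
    have "(\<integral>\<^sup>+s'. \<integral>\<^sup>+t'. ennreal \<bar>s * t' - t * s'\<bar> * ball_vol d (\<sigma> - (s'\<^sup>2 + t'\<^sup>2)) \<partial>lborel \<partial>lborel) =
      (\<integral>\<^sup>+s'. \<integral>\<^sup>+t'. ennreal \<bar>- t * s' + s * t'\<bar> * ball_vol d (\<sigma> - (s'\<^sup>2 + t'\<^sup>2)) \<partial>lborel \<partial>lborel)"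
      by (simp add: algebra_simps)
    also have "\<dots> = (\<integral>\<^sup>+s'. \<integral>\<^sup>+t'. ennreal \<bar>sqrt ((- t)\<^sup>2 + s\<^sup>2) * s'\<bar> * ball_vol d (\<sigma> - (s'\<^sup>2 + t'\<^sup>2)) \<partial>lborel \<partial>lborel)"
      by (rule nn_integral_linear_functional_radial[of "\<lambda>A R. ennreal \<bar>A\<bar> * ball_vol d (\<sigma> - R)", OF _ nz]) measurable
    also have "\<dots> = (\<integral>\<^sup>+s'. \<integral>\<^sup>+t'. ennreal ?n * (ennreal \<bar>s'\<bar> * ball_vol d (\<sigma> - (s'\<^sup>2 + t'\<^sup>2))) \<partial>lborel \<partial>lborel)"
      by (simp add: abs_mult ennreal_mult add.commute mult.assoc)
    also have "\<dots> = ennreal ?n * ?c"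
      by (subst nn_integral_cmult2) (measurable, simp only: nn_integral_abs_ball_vol)
    finally show ?thesis .
  qed auto
  have "(\<integral>\<^sup>+s. \<integral>\<^sup>+t. (ennreal (sqrt (s\<^sup>2 + t\<^sup>2)) * ?c) * ball_vol d (\<sigma> - (s\<^sup>2 + t\<^sup>2)) \<partial>lborel \<partial>lborel) =
    (\<integral>\<^sup>+s. \<integral>\<^sup>+t. ?c * (ennreal (sqrt (s\<^sup>2 + t\<^sup>2)) * ball_vol d (\<sigma> - (s\<^sup>2 + t\<^sup>2))) \<partial>lborel \<partial>lborel)"
    by (simp add: mult_ac)
  also have "\<dots> = ?c * (ennreal (1 / 2) * ball_vol (d + 3) \<sigma>)"
    by (subst nn_integral_cmult2) (measurable, simp only: nn_integral_norm_ball_vol)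
  also have "\<dots> = (ennreal (1 / pi) * ennreal (1 / 2)) * (ball_vol (d + 3) \<sigma>)\<^sup>2"
    by (simp add: power2_eq_square mult_ac)
  also have "ennreal (1 / pi) * ennreal (1 / 2) = ennreal (1 / (2 * pi))"
    by (subst ennreal_mult[symmetric]) (auto simp: mult.commute)
  finally show ?thesis unfolding inner .
qed

text \<open>Squaring removes the root in \<open>ball_vol_eq\<close>, so in the squared radius
  \<open>r\<close> the integrand is a multiple of \<open>(\<rho> - c * r) ^ k\<close> up to
  \<open>r = \<rho> / c\<close> and zero beyond.\<close>

lemma nn_integral_square_ball_vol:
  fixes c \<rho> :: real
  assumes c: "c > 0" and \<rho>: "\<rho> > 0"
  shows "(\<integral>\<^sup>+x. \<integral>\<^sup>+y. (ball_vol k (\<rho> - c * (x\<^sup>2 + y\<^sup>2)))\<^sup>2 \<partial>lborel \<partial>lborel) =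
    ennreal (pi * (unit_ball_vol k)\<^sup>2 * \<rho> ^ (k + 1) / (c * (k + 1)))"
proof -
  let ?\<omega> = "unit_ball_vol (real k)"
  have \<omega>: "?\<omega> > 0" by simp
  have "(\<integral>\<^sup>+x. \<integral>\<^sup>+y. (ball_vol k (\<rho> - c * (x\<^sup>2 + y\<^sup>2)))\<^sup>2 \<partial>lborel \<partial>lborel) =
    ennreal pi * (\<integral>\<^sup>+r\<in>{0..}. (ball_vol k (\<rho> - c * r))\<^sup>2 \<partial>lborel)"
    by (rule nn_integral_radial_plane) measurable
  also have "(\<integral>\<^sup>+r\<in>{0..}. (ball_vol k (\<rho> - c * r))\<^sup>2 \<partial>lborel) =
    (\<integral>\<^sup>+r. ennreal (?\<omega>\<^sup>2 * (\<rho> - c * r) ^ k) * indicator {0..\<rho> / c} r \<partial>lborel)"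
  proof (rule nn_integral_cong_AE)
    \<comment> \<open>At this point the argument of \<open>ball_vol\<close> is 0, which neither
      \<open>ball_vol_eq\<close> nor \<open>ball_vol_neg\<close> covers.\<close>
    have "AE r in lborel. r \<noteq> \<rho> / c" by (rule AE_lborel_singleton)
    then show "AE r in lborel. (ball_vol k (\<rho> - c * r))\<^sup>2 * indicator {0..} r =
        ennreal (?\<omega>\<^sup>2 * (\<rho> - c * r) ^ k) * indicator {0..\<rho> / c} r"
    proof eventually_elim
      case (elim r)
      show ?case
      proof (cases "r < \<rho> / c")
        case True
        then have pos: "\<rho> - c * r > 0" using c by (simp add: field_simps)
        have "(sqrt (\<rho> - c * r) ^ k)\<^sup>2 = (\<rho> - c * r) ^ k"
          using pos by (simp add: power_mult[symmetric] mult.commute[of k]) (simp add: power_mult)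
        then have "(ball_vol k (\<rho> - c * r))\<^sup>2 = ennreal (?\<omega>\<^sup>2 * (\<rho> - c * r) ^ k)"
          using pos by (simp add: ball_vol_eq ennreal_power power_mult_distrib)
        then show ?thesis using True by (auto simp: indicator_def)
      next
        case False
        with elim have "\<rho> / c < r" by simp
        then have "\<rho> - c * r < 0" using c by (simp add: field_simps)
        then show ?thesis using False elim by (simp add: ball_vol_neg indicator_def)
      qed
    qed
  qed
  also have "\<dots> = - (?\<omega>\<^sup>2 * (\<rho> - c * (\<rho> / c)) ^ (k + 1) / (c * (k + 1))) - - (?\<omega>\<^sup>2 * (\<rho> - c * 0) ^ (k + 1) / (c * (k + 1)))"
  proof (rule nn_integral_FTC_Icc)
    show "((\<lambda>r. - (?\<omega>\<^sup>2 * (\<rho> - c * r) ^ (k + 1) / (c * (k + 1)))) has_real_derivative ?\<omega>\<^sup>2 * (\<rho> - c * r) ^ k) (at r)" for r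
    proof -
      have "((\<lambda>r. (\<rho> - c * r) ^ Suc k) has_real_derivative real (Suc k) * (\<rho> - c * r) ^ k * - c) (at r)"
        by (rule derivative_eq_intros refl | simp)+
      from DERIV_cmult[OF this, of "- (?\<omega>\<^sup>2 / (c * real (Suc k)))"]
      have "((\<lambda>r. - (?\<omega>\<^sup>2 * (\<rho> - c * r) ^ (k + 1) / (c * (k + 1)))) has_real_derivative
          - (?\<omega>\<^sup>2 / (c * real (Suc k))) * (real (Suc k) * (\<rho> - c * r) ^ k * - c)) (at r)"
        by (simp add: add.commute)
      moreover have "- (?\<omega>\<^sup>2 / (c * real (Suc k))) * (real (Suc k) * (\<rho> - c * r) ^ k * - c) = ?\<omega>\<^sup>2 * (\<rho> - c * r) ^ k"
        using c by (simp del: of_nat_Suc)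
      ultimately show ?thesis by (simp only:)
    qed
    show "0 \<le> ?\<omega>\<^sup>2 * (\<rho> - c * r) ^ k" if "r \<in> {0..\<rho> / c}" for r
      using that c by (auto simp: field_simps)
  qed (use c \<rho> in auto)
  also have "- (?\<omega>\<^sup>2 * (\<rho> - c * (\<rho> / c)) ^ (k + 1) / (c * (k + 1))) - - (?\<omega>\<^sup>2 * (\<rho> - c * 0) ^ (k + 1) / (c * (k + 1))) =
      ?\<omega>\<^sup>2 * \<rho> ^ (k + 1) / (c * (k + 1))"
    using c by simp
  finally show ?thesis
    using c \<rho> by (simp add: ennreal_mult'[symmetric] mult_ac)
qed

section \<open>Splitting the coefficient space\<close>

text \<open>
  The integral of \<open>\<bar>det (d, g' \<psi>)\<bar>\<close> over the curves \<open>g\<close> in the ball with \<open>g \<psi> = w\<close>, in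
  coordinates in which it visibly does not depend on \<open>\<psi>\<close>; see \<open>crossing_density_eq\<close>.
\<close>

definition crossing_density :: "nat \<Rightarrow> real \<Rightarrow> real \<times> real \<Rightarrow> real \<times> real \<Rightarrow> ennreal" where
  "crossing_density n \<rho> w d = ennreal (1 / (2 * n + 3)) *
    (\<integral>\<^sup>+s. \<integral>\<^sup>+t. ennreal \<bar>fst d * (sqrt (\<Sum>k=1..Suc n. (real k)\<^sup>2) * t) - snd d * (sqrt (\<Sum>k=1..Suc n. (real k)\<^sup>2) * s)\<bar> *
      ball_vol (4 * n + 2) (\<rho> - 2 * ((fst w)\<^sup>2 + (snd w)\<^sup>2) / (2 * n + 3) - (s\<^sup>2 + t\<^sup>2)) \<partial>lborel \<partial>lborel)"

lemma measurable_crossing_density [measurable (raw)]: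
  assumes [measurable]: "w1 \<in> borel_measurable M" "w2 \<in> borel_measurable M" "d1 \<in> borel_measurable M" "d2 \<in> borel_measurable M"
  shows "(\<lambda>x. crossing_density n \<rho> (w1 x, w2 x) (d1 x, d2 x)) \<in> borel_measurable M"
  unfolding crossing_density_def fst_conv snd_conv by measurable

lemma crossing_density_eq:
  "(\<integral>\<^sup>+a. \<integral>\<^sup>+b. ennreal \<bar>d1 * trig_deriv (Suc n) b \<phi> - d2 * trig_deriv (Suc n) a \<phi>\<bar> *
      indicator {..\<rho>} (2 * (w1 - trig_val (Suc n) a \<phi>)\<^sup>2 + trig_sq (Suc n) a +
        (2 * (w2 - trig_val (Suc n) b \<phi>)\<^sup>2 + trig_sq (Suc n) b)) \<partial>trig_space (Suc n) \<partial>trig_space (Suc n)) =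
    crossing_density n \<rho> (w1, w2) (d1, d2)"
  using nn_integral_curve_constrained[of "\<lambda>z. ennreal \<bar>d1 * snd z - d2 * fst z\<bar>" n \<phi> \<rho> w1 w2]
  by (simp add: crossing_density_def)

text \<open>The integral over \<open>f\<close> has the same shape as the one over \<open>g\<close>,
  with \<open>crossing_density\<close> as its weight. Each curve contributes \<open>1 / K\<close>
  and a factor \<open>sqrt S\<close>, and the cross moment contributes \<open>1 / (2 * pi)\<close>.
  Integrating over \<open>w\<close> with \<open>c = 2 / K\<close> contributes \<open>pi / 4\<close>,
  because \<open>4 * n + 6 = 2 * K\<close>.\<close>

lemma nn_integral_crossing_density:
  assumes \<rho>: "\<rho> > 0"
  shows "(\<integral>\<^sup>+w1. \<integral>\<^sup>+w2. (\<integral>\<^sup>+a. \<integral>\<^sup>+b. crossing_density n \<rho> (w1, w2) (trig_deriv (Suc n) a \<phi>, trig_deriv (Suc n) b \<phi>) *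
      indicator {..\<rho>} (2 * (w1 - trig_val (Suc n) a \<phi>)\<^sup>2 + trig_sq (Suc n) a +
        (2 * (w2 - trig_val (Suc n) b \<phi>)\<^sup>2 + trig_sq (Suc n) b)) \<partial>trig_space (Suc n) \<partial>trig_space (Suc n)) \<partial>lborel \<partial>lborel) =
    ennreal ((\<Sum>k=1..Suc n. (real k)\<^sup>2) * (unit_ball_vol (4 * n + 5))\<^sup>2 * \<rho> ^ (4 * n + 6) / (8 * (2 * n + 3)\<^sup>2))"
proof -
  define K where "K = real (2 * n + 3)"
  define S where "S = (\<Sum>k=1..Suc n. (real k)\<^sup>2)"
  let ?B = "ball_vol (4 * n + 2)"
  have K: "K > 0" by (simp add: K_def)
  have S: "S \<ge> 0" unfolding S_def by (intro sum_nonneg) auto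
  have w: "(\<integral>\<^sup>+a. \<integral>\<^sup>+b. crossing_density n \<rho> (w1, w2) (trig_deriv (Suc n) a \<phi>, trig_deriv (Suc n) b \<phi>) *
      indicator {..\<rho>} (2 * (w1 - trig_val (Suc n) a \<phi>)\<^sup>2 + trig_sq (Suc n) a +
        (2 * (w2 - trig_val (Suc n) b \<phi>)\<^sup>2 + trig_sq (Suc n) b)) \<partial>trig_space (Suc n) \<partial>trig_space (Suc n)) =
      ennreal (S / K\<^sup>2 / (2 * pi)) * (ball_vol (4 * n + 5) (\<rho> - 2 / K * (w1\<^sup>2 + w2\<^sup>2)))\<^sup>2" for w1 w2
  proof -
    define \<sigma> where "\<sigma> = \<rho> - 2 / K * (w1\<^sup>2 + w2\<^sup>2)"
    have \<sigma>: "\<rho> - 2 * (w1\<^sup>2 + w2\<^sup>2) / (2 * n + 3) = \<sigma>" by (simp add: \<sigma>_def K_def)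
    have G: "crossing_density n \<rho> (w1, w2) (sqrt S * s, sqrt S * t) =
       ennreal (S / K) * (\<integral>\<^sup>+s'. \<integral>\<^sup>+t'. ennreal \<bar>s * t' - t * s'\<bar> * ?B (\<sigma> - (s'\<^sup>2 + t'\<^sup>2)) \<partial>lborel \<partial>lborel)" for s t
    proof -
      have *: "ennreal \<bar>sqrt S * s * (sqrt S * t') - sqrt S * t * (sqrt S * s')\<bar> = ennreal S * ennreal \<bar>s * t' - t * s'\<bar>" for s' t'
      proof -
        have "sqrt S * s * (sqrt S * t') - sqrt S * t * (sqrt S * s') = (sqrt S * sqrt S) * (s * t' - t * s')"
          by (simp only: algebra_simps)
        then show ?thesis using S by (simp add: abs_mult ennreal_mult)
      qed
      have "crossing_density n \<rho> (w1, w2) (sqrt S * s, sqrt S * t) =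
        ennreal (1 / K) * (\<integral>\<^sup>+s'. \<integral>\<^sup>+t'. ennreal S * (ennreal \<bar>s * t' - t * s'\<bar> * ?B (\<sigma> - (s'\<^sup>2 + t'\<^sup>2))) \<partial>lborel \<partial>lborel)"
        unfolding crossing_density_def fst_conv snd_conv \<sigma> S_def[symmetric] * by (simp add: mult.assoc K_def \<sigma>_def)
      also have "\<dots> = ennreal (1 / K) * (ennreal S * (\<integral>\<^sup>+s'. \<integral>\<^sup>+t'. ennreal \<bar>s * t' - t * s'\<bar> * ?B (\<sigma> - (s'\<^sup>2 + t'\<^sup>2)) \<partial>lborel \<partial>lborel))"
        by (subst nn_integral_cmult2) auto
      also have "\<dots> = ennreal (S / K) * (\<integral>\<^sup>+s'. \<integral>\<^sup>+t'. ennreal \<bar>s * t' - t * s'\<bar> * ?B (\<sigma> - (s'\<^sup>2 + t'\<^sup>2)) \<partial>lborel \<partial>lborel)"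
        using S K by (simp add: mult.assoc[symmetric] ennreal_mult[symmetric])
      finally show ?thesis .
    qed
    have "(\<lambda>z. crossing_density n \<rho> (w1, w2) (fst z, snd z)) \<in> borel_measurable (borel \<Otimes>\<^sub>M borel)" by measurable
    from nn_integral_curve_constrained[OF this, of n \<phi> \<rho> w1 w2]
    have "(\<integral>\<^sup>+a. \<integral>\<^sup>+b. crossing_density n \<rho> (w1, w2) (trig_deriv (Suc n) a \<phi>, trig_deriv (Suc n) b \<phi>) *
      indicator {..\<rho>} (2 * (w1 - trig_val (Suc n) a \<phi>)\<^sup>2 + trig_sq (Suc n) a +
        (2 * (w2 - trig_val (Suc n) b \<phi>)\<^sup>2 + trig_sq (Suc n) b)) \<partial>trig_space (Suc n) \<partial>trig_space (Suc n)) =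
      ennreal (1 / K) * (\<integral>\<^sup>+s. \<integral>\<^sup>+t. crossing_density n \<rho> (w1, w2) (sqrt S * s, sqrt S * t) * ?B (\<sigma> - (s\<^sup>2 + t\<^sup>2)) \<partial>lborel \<partial>lborel)"
      unfolding \<sigma> S_def[symmetric] fst_conv snd_conv by (simp add: K_def)
    also have "\<dots> = ennreal (1 / K) * (ennreal (S / K) * (\<integral>\<^sup>+s. \<integral>\<^sup>+t. (\<integral>\<^sup>+s'. \<integral>\<^sup>+t'. ennreal \<bar>s * t' - t * s'\<bar> *
        ?B (\<sigma> - (s'\<^sup>2 + t'\<^sup>2)) \<partial>lborel \<partial>lborel) * ?B (\<sigma> - (s\<^sup>2 + t\<^sup>2)) \<partial>lborel \<partial>lborel))"
      unfolding G mult.assoc by (subst nn_integral_cmult2) auto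
    also have "\<dots> = ennreal (1 / K) * (ennreal (S / K) * (ennreal (1 / (2 * pi)) * (ball_vol (4 * n + 5) \<sigma>)\<^sup>2))"
    proof -
      have "4 * n + 2 + 3 = 4 * n + 5" by simp
      then show ?thesis unfolding nn_integral_cross_ball_vol by (simp only:)
    qed
    also have "\<dots> = (ennreal (1 / K) * ennreal (S / K) * ennreal (1 / (2 * pi))) * (ball_vol (4 * n + 5) \<sigma>)\<^sup>2"
      by (simp only: mult.assoc)
    also have "ennreal (1 / K) * ennreal (S / K) * ennreal (1 / (2 * pi)) = ennreal (S / K\<^sup>2 / (2 * pi))"
      using K S by (simp only: ennreal_mult[symmetric] divide_nonneg_pos zero_le_divide_1_iff less_imp_le mult_nonneg_nonneg pi_ge_zero zero_le_numeral)
        (simp add: power2_eq_square)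
    finally show ?thesis unfolding \<sigma>_def .
  qed
  have "(\<integral>\<^sup>+w1. \<integral>\<^sup>+w2. ennreal (S / K\<^sup>2 / (2 * pi)) * (ball_vol (4 * n + 5) (\<rho> - 2 / K * (w1\<^sup>2 + w2\<^sup>2)))\<^sup>2 \<partial>lborel \<partial>lborel) =
    ennreal (S / K\<^sup>2 / (2 * pi)) * (\<integral>\<^sup>+w1. \<integral>\<^sup>+w2. (ball_vol (4 * n + 5) (\<rho> - 2 / K * (w1\<^sup>2 + w2\<^sup>2)))\<^sup>2 \<partial>lborel \<partial>lborel)"
    by (rule nn_integral_cmult2) measurable
  also have "\<dots> = ennreal (S / K\<^sup>2 / (2 * pi)) * ennreal (pi * (unit_ball_vol (4 * n + 5))\<^sup>2 * \<rho> ^ (4 * n + 5 + 1) / (2 / K * (4 * n + 5 + 1)))"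
    using K \<rho> by (subst nn_integral_square_ball_vol) (auto simp: add_ac)
  also have "\<dots> = ennreal (S / K\<^sup>2 / (2 * pi) * (pi * (unit_ball_vol (4 * n + 5))\<^sup>2 * \<rho> ^ (4 * n + 5 + 1) / (2 / K * (4 * n + 5 + 1))))"
    using S K \<rho> by (intro ennreal_mult[symmetric]) auto
  also have "S / K\<^sup>2 / (2 * pi) * (pi * (unit_ball_vol (4 * n + 5))\<^sup>2 * \<rho> ^ (4 * n + 5 + 1) / (2 / K * (4 * n + 5 + 1))) =
    S * (unit_ball_vol (4 * n + 5))\<^sup>2 * \<rho> ^ (4 * n + 6) / (8 * K\<^sup>2)"
  proof -
    have "real (4 * n + 5 + 1) = 2 * K" by (simp add: K_def)
    then have "2 / K * real (4 * n + 5 + 1) = 4" using K by simp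
    moreover have "4 * n + 5 + 1 = 4 * n + 6" by simp
    ultimately show ?thesis using K by (simp add: field_simps)
  qed
  finally show ?thesis unfolding w by (simp add: S_def K_def add_ac)
qed

section \<open>Separating constant and non-constant coefficients\<close>

definition coeff_space :: "nat \<Rightarrow> (int \<times> (real \<times> real) \<Rightarrow> real) measure" where
  "coeff_space N = (\<Pi>\<^sub>M i\<in>curve_index N. lborel)"

text \<open>Splits a coefficient vector into the non-constant and the constant parts of its two components.\<close>

definition split_space :: "nat \<Rightarrow> ((int \<Rightarrow> real) \<times> (int \<Rightarrow> real) \<times> real \<times> real) measure" where
  "split_space N = trig_space N \<Otimes>\<^sub>M (trig_space N \<Otimes>\<^sub>M (lborel \<Otimes>\<^sub>M lborel))"

definition join_coeffs :: "nat \<Rightarrow> (int \<Rightarrow> real) \<times> (int \<Rightarrow> real) \<times> real \<times> real \<Rightarrow> int \<times> (real \<times> real) \<Rightarrow> real" where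
  "join_coeffs N = (\<lambda>(a, b, x, y). \<lambda>i\<in>curve_index N.
     if snd i = (1, 0) then (if fst i = 0 then x else a (fst i)) else (if fst i = 0 then y else b (fst i)))"

lemma finite_curve_index: "finite (curve_index N)"
  by (simp add: curve_index_def)

lemma curve_index_eq: "curve_index N = {- int N..int N} \<times> {(1, 0), (0, 1)}"
  by (auto simp: curve_index_def Basis_prod_def)

lemma prod_curve_index:
  fixes g :: "int \<times> (real \<times> real) \<Rightarrow> 'a::comm_monoid_mult"
  shows "(\<Prod>i\<in>curve_index N. g i) =
    (\<Prod>k\<in>trig_index N. g (k, (1, 0))) * (\<Prod>k\<in>trig_index N. g (k, (0, 1))) * (g (0, (1, 0)) * g (0, (0, 1)))"
proof -
  have "(\<Prod>i\<in>curve_index N. g i) = (\<Prod>k\<in>{- int N..int N}. \<Prod>u\<in>{(1, 0), (0, 1)}. g (k, u))"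
    unfolding curve_index_eq by (subst prod.cartesian_product) simp
  also have "\<dots> = (\<Prod>k\<in>{- int N..int N}. g (k, (1, 0)) * g (k, (0, 1)))" by simp
  also have "\<dots> = (g (0, (1, 0)) * g (0, (0, 1))) * (\<Prod>k\<in>trig_index N. g (k, (1, 0)) * g (k, (0, 1)))"
    unfolding trig_index_def by (rule prod.remove) auto
  finally show ?thesis by (simp add: prod.distrib mult_ac)
qed

lemma measurable_join_coeffs [measurable]: "join_coeffs N \<in> measurable (split_space N) (coeff_space N)"
  unfolding coeff_space_def
proof (rule measurable_PiM_single')
  fix i assume i: "i \<in> curve_index N"
  consider "i = (0, (1, 0))" | "i = (0, (0, 1))" | k where "k \<in> trig_index N" "i = (k, (1, 0))"
    | k where "k \<in> trig_index N" "i = (k, (0, 1))"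
    using i by (cases i) (auto simp: curve_index_eq trig_index_def)
  then show "(\<lambda>\<omega>. join_coeffs N \<omega> i) \<in> measurable (split_space N) lborel"
  proof cases
    case 1
    then show ?thesis using i by (simp add: join_coeffs_def split_def split_space_def)
  next
    case 2
    then show ?thesis using i by (simp add: join_coeffs_def split_def split_space_def)
  next
    case (3 k)
    then have "k \<noteq> 0" by (simp add: trig_index_def)
    moreover have "(\<lambda>\<omega>. fst \<omega> k) \<in> measurable (split_space N) borel"
      unfolding split_space_def by (rule measurable_compose[OF measurable_fst measurable_trig_coeff[OF 3(1)]])
    ultimately show ?thesis using i 3 by (simp add: join_coeffs_def split_def)
  next
    case (4 k)
    then have "k \<noteq> 0" by (simp add: trig_index_def)
    moreover have "(\<lambda>\<omega>. fst (snd \<omega>) k) \<in> measurable (split_space N) borel"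
      unfolding split_space_def
      by (rule measurable_compose[OF measurable_snd measurable_compose[OF measurable_fst measurable_trig_coeff[OF 4(1)]]])
    ultimately show ?thesis using i 4 by (simp add: join_coeffs_def split_def)
  qed
qed (auto simp: join_coeffs_def)

text \<open>A product measure is determined by its values on boxes, and the preimage of a box under
  \<open>join_coeffs\<close> is the box of the same factors, regrouped.\<close>

lemma distr_join_coeffs: "distr (split_space N) (coeff_space N) (join_coeffs N) = coeff_space N"
proof -
  interpret product_sigma_finite "\<lambda>_. lborel :: real measure" ..
  interpret T: sigma_finite_measure "trig_space N" by (rule sigma_finite_trig_space)
  interpret LL: pair_sigma_finite "lborel :: real measure" "lborel :: real measure" ..
  interpret TLL: pair_sigma_finite "trig_space N" "lborel \<Otimes>\<^sub>M lborel :: (real \<times> real) measure" ..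
  interpret TTLL: pair_sigma_finite "trig_space N" "trig_space N \<Otimes>\<^sub>M (lborel \<Otimes>\<^sub>M lborel :: (real \<times> real) measure)" ..
  show ?thesis
    unfolding coeff_space_def
  proof (rule PiM_eqI)
    fix A :: "int \<times> (real \<times> real) \<Rightarrow> real set"
    assume A: "\<And>i. i \<in> curve_index N \<Longrightarrow> A i \<in> sets lborel"
    have idx: "(0, (1, 0)) \<in> curve_index N" "(0, (0, 1)) \<in> curve_index N"
      "k \<in> trig_index N \<Longrightarrow> (k, (1, 0)) \<in> curve_index N" "k \<in> trig_index N \<Longrightarrow> (k, (0, 1)) \<in> curve_index N" for k
      by (auto simp: curve_index_eq trig_index_def)
    let ?U = "Pi\<^sub>E (trig_index N) (\<lambda>k. A (k, (1, 0)))" and ?V = "Pi\<^sub>E (trig_index N) (\<lambda>k. A (k, (0, 1)))"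
    have fin: "finite (trig_index N)" by (simp add: trig_index_def)
    have UV: "?U \<in> sets (trig_space N)" "?V \<in> sets (trig_space N)"
      unfolding trig_space_def using A idx by (auto intro!: sets_PiM_I_finite fin)
    have emU: "emeasure (trig_space N) ?U = (\<Prod>k\<in>trig_index N. emeasure lborel (A (k, (1, 0))))"
      "emeasure (trig_space N) ?V = (\<Prod>k\<in>trig_index N. emeasure lborel (A (k, (0, 1))))"
      unfolding trig_space_def using A idx by (auto intro!: emeasure_PiM fin)
    have pre: "join_coeffs N -` Pi\<^sub>E (curve_index N) A \<inter> space (split_space N) =
        ?U \<times> ?V \<times> A (0, (1, 0)) \<times> A (0, (0, 1))" (is "?L = ?R")
    proof (intro equalityI subsetI)
      fix z assume z: "z \<in> ?L"
      obtain a b x y where [simp]: "z = (a, b, x, y)" by (metis surj_pair)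
      have m: "join_coeffs N z i \<in> A i" if "i \<in> curve_index N" for i using z that by auto
      have sp: "a \<in> extensional (trig_index N)" "b \<in> extensional (trig_index N)"
        using z by (auto simp: split_space_def trig_space_def space_pair_measure space_PiM PiE_def)
      have "a k \<in> A (k, (1, 0))" "b k \<in> A (k, (0, 1))" if "k \<in> trig_index N" for k
        using m[OF idx(3)[OF that]] m[OF idx(4)[OF that]] that idx(3,4)[OF that]
        by (auto simp: join_coeffs_def trig_index_def)
      moreover have "x \<in> A (0, (1, 0))" "y \<in> A (0, (0, 1))"
        using m[OF idx(1)] m[OF idx(2)] idx(1,2) by (auto simp: join_coeffs_def)
      ultimately show "z \<in> ?R" using sp by (auto simp: PiE_def)
    next
      fix z assume z: "z \<in> ?R"
      obtain a b x y where [simp]: "z = (a, b, x, y)" by (metis surj_pair)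
      have "join_coeffs N z i \<in> A i" if "i \<in> curve_index N" for i
        using z that by (cases i) (auto simp: join_coeffs_def curve_index_eq trig_index_def PiE_def Pi_def split: if_splits)
      moreover have "join_coeffs N z \<in> extensional (curve_index N)" by (simp add: join_coeffs_def)
      moreover have "z \<in> space (split_space N)"
        using z by (auto simp: split_space_def trig_space_def space_pair_measure space_PiM PiE_def)
      ultimately show "z \<in> ?L" by (auto simp: PiE_def)
    qed
    have "emeasure (distr (split_space N) (coeff_space N) (join_coeffs N)) (Pi\<^sub>E (curve_index N) A) =
        emeasure (split_space N) (?U \<times> ?V \<times> A (0, (1, 0)) \<times> A (0, (0, 1)))"
      using A by (subst emeasure_distr) (auto simp: coeff_space_def pre intro!: sets_PiM_I_finite finite_curve_index measurable_join_coeffs[unfolded coeff_space_def])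
    also have "\<dots> = emeasure (trig_space N) ?U * (emeasure (trig_space N) ?V *
        (emeasure lborel (A (0, (1, 0))) * emeasure lborel (A (0, (0, 1)))))"
    proof -
      have 1: "A (0, (1, 0)) \<in> sets lborel" "A (0, (0, 1)) \<in> sets lborel" using A idx by auto
      have 2: "A (0, (1, 0)) \<times> A (0, (0, 1)) \<in> sets (lborel \<Otimes>\<^sub>M lborel)" using 1 by (rule pair_measureI)
      have 3: "?V \<times> A (0, (1, 0)) \<times> A (0, (0, 1)) \<in> sets (trig_space N \<Otimes>\<^sub>M (lborel \<Otimes>\<^sub>M lborel))"
        using UV(2) 2 by (rule pair_measureI)
      have s1: "sigma_finite_measure (lborel \<Otimes>\<^sub>M lborel :: (real \<times> real) measure)" ..
      have s2: "sigma_finite_measure (trig_space N \<Otimes>\<^sub>M (lborel \<Otimes>\<^sub>M lborel :: (real \<times> real) measure))" ..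
      show ?thesis
        unfolding split_space_def sigma_finite_measure.emeasure_pair_measure_Times[OF s2 UV(1) 3]
          sigma_finite_measure.emeasure_pair_measure_Times[OF s1 UV(2) 2] lborel.emeasure_pair_measure_Times[OF 1] by simp
    qed
    also have "\<dots> = (\<Prod>i\<in>curve_index N. emeasure lborel (A i))"
      unfolding emU prod_curve_index by (simp add: mult_ac)
    finally show "emeasure (distr (split_space N) (\<Pi>\<^sub>M i\<in>curve_index N. lborel) (join_coeffs N)) (Pi\<^sub>E (curve_index N) A) =
        (\<Prod>i\<in>curve_index N. emeasure lborel (A i))" by (simp add: coeff_space_def)
  qed (simp_all add: finite_curve_index)
qed

section \<open>Curves and their crossings in split coordinates\<close>

lemma trig_val_has_derivative: "(trig_val N a has_real_derivative trig_deriv N a \<phi>) (at \<phi>)"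
proof -
  have "((\<lambda>\<phi>. \<Sum>j=1..N. a (int j) * cos (real j * \<phi>) + a (- int j) * sin (real j * \<phi>)) has_real_derivative
      (\<Sum>j=1..N. real j * (a (- int j) * cos (real j * \<phi>) - a (int j) * sin (real j * \<phi>)))) (at \<phi>)"
    by (rule DERIV_sum) (auto intro!: derivative_eq_intros simp: algebra_simps)
  then show ?thesis by (simp add: trig_val_def[abs_def] trig_deriv_def)
qed

lemma continuous_on_trig_deriv: "continuous_on S (trig_deriv N a)"
  unfolding trig_deriv_def[abs_def] by (intro continuous_intros)

lemma sum_trig_index:
  "(\<Sum>k\<in>trig_index N. g k :: real) = (\<Sum>j=1..N. g (int j) + g (- int j))"
proof (induction N)
  case (Suc N)
  have "trig_index (Suc N) = insert (int (Suc N)) (insert (- int (Suc N)) (trig_index N))"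
    by (auto simp: trig_index_def)
  moreover have "finite (trig_index N)" "int (Suc N) \<notin> insert (- int (Suc N)) (trig_index N)"
    "- int (Suc N) \<notin> trig_index N" by (auto simp: trig_index_def)
  ultimately show ?case using Suc by (simp del: of_nat_Suc)
qed (simp add: trig_index_def)

lemma sum_curve_index:
  fixes g :: "int \<times> (real \<times> real) \<Rightarrow> real"
  shows "(\<Sum>i\<in>curve_index N. g i) =
    (\<Sum>k\<in>trig_index N. g (k, (1, 0))) + (\<Sum>k\<in>trig_index N. g (k, (0, 1))) + (g (0, (1, 0)) + g (0, (0, 1)))"
proof -
  have "(\<Sum>i\<in>curve_index N. g i) = (\<Sum>k\<in>{- int N..int N}. \<Sum>u\<in>{(1, 0), (0, 1)}. g (k, u))"
    unfolding curve_index_eq by (subst sum.cartesian_product) simp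
  also have "\<dots> = (\<Sum>k\<in>{- int N..int N}. g (k, (1, 0)) + g (k, (0, 1)))" by simp
  also have "\<dots> = (g (0, (1, 0)) + g (0, (0, 1))) + (\<Sum>k\<in>trig_index N. g (k, (1, 0)) + g (k, (0, 1)))"
    unfolding trig_index_def by (rule sum.remove) auto
  finally show ?thesis by (simp add: sum.distrib)
qed

lemma join_coeffs_apply:
  "join_coeffs N (a, b, x, y) (0, (1, 0)) = x"
  "join_coeffs N (a, b, x, y) (0, (0, 1)) = y"
  "k \<in> trig_index N \<Longrightarrow> join_coeffs N (a, b, x, y) (k, (1, 0)) = a k"
  "k \<in> trig_index N \<Longrightarrow> join_coeffs N (a, b, x, y) (k, (0, 1)) = b k"
  by (auto simp: join_coeffs_def curve_index_eq trig_index_def)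

lemma sum_squares_join_coeffs:
  "(\<Sum>i\<in>curve_index N. (join_coeffs N (a, b, x, y) i)\<^sup>2) = trig_sq N a + trig_sq N b + (x\<^sup>2 + y\<^sup>2)"
  unfolding sum_curve_index by (simp add: join_coeffs_apply sum_trig_index trig_sq_def cong: sum.cong)

text \<open>The constant basis function of norm 1 is \<open>1 / sqrt 2\<close>, so a constant
  coefficient moves the curve by only \<open>1 / sqrt 2\<close> of its size. This is the source of
  the factors \<open>sqrt 2\<close> in the later substitutions.\<close>

lemma curve_of_join_coeffs:
  "curve_of N (join_coeffs N (a, b, x, y)) \<phi> = (x / sqrt 2 + trig_val N a \<phi>, y / sqrt 2 + trig_val N b \<phi>)"
proof -
  have "int j \<in> trig_index N" "- int j \<in> trig_index N" if "j \<in> {1..N}" for j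
    using that by (auto simp: trig_index_def)
  note idx = this
  show ?thesis
    unfolding curve_of_eq trig_basis_sum[of "\<lambda>k. join_coeffs N (a, b, x, y) (k, (1, 0))"]
      trig_basis_sum[of "\<lambda>k. join_coeffs N (a, b, x, y) (k, (0, 1))"] trig_val_def join_coeffs_apply(1,2)
    by (intro conjI arg_cong2[where f = Pair] arg_cong2[where f = "(+)"] refl sum.cong)
       (simp_all only: join_coeffs_apply(3,4)[OF idx(1)] join_coeffs_apply(3,4)[OF idx(2)])
qed

text \<open>Written as a zero set of a difference to fit
  \<open>borel_measurable_ecount_zeros\<close>; \<open>crossing_count_eq\<close> relates it to
  \<open>intersection_points\<close>.\<close>

definition crossing_count ::
  "nat \<Rightarrow> (int \<times> (real \<times> real) \<Rightarrow> real) \<Rightarrow> (int \<times> (real \<times> real) \<Rightarrow> real) \<Rightarrow> ennreal" where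
  "crossing_count N c e =
     ecount {\<theta> \<in> {0..<2 * pi} \<times> {0..<2 * pi}. curve_of N c (fst \<theta>) - curve_of N e (snd \<theta>) = 0}"

lemma measurable_curve_of [measurable]:
  "(\<lambda>c. curve_of N c \<phi>) \<in> borel_measurable (coeff_space N)"
  unfolding curve_of_def coeff_space_def
  by (intro borel_measurable_sum borel_measurable_scaleR) auto

lemma measurable_sum_squares_coeffs [measurable]:
  "(\<lambda>c. \<Sum>i\<in>curve_index N. (c i)\<^sup>2) \<in> borel_measurable (coeff_space N)"
  unfolding coeff_space_def by (intro borel_measurable_sum borel_measurable_power) auto

lemma continuous_on_curve_of: "continuous_on S (curve_of N c)"
  unfolding curve_of_eq trig_basis_sum by (intro continuous_intros)

lemma continuous_on_curve_difference:
  "continuous_on UNIV (\<lambda>\<theta>. curve_of N c (fst \<theta>) - curve_of N e (snd \<theta>))"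
  by (intro continuous_intros continuous_on_compose2[OF continuous_on_curve_of[of UNIV]]) auto

lemma measurable_crossing_count [measurable]:
  "(\<lambda>(c, e). crossing_count N c e) \<in> borel_measurable (coeff_space N \<Otimes>\<^sub>M coeff_space N)"
  unfolding crossing_count_def split_def
  by (rule borel_measurable_ecount_zeros[OF atLeastLessThan_square_eq_UN_compact])
     (auto intro: compact_Times continuous_on_curve_difference)

lemma sigma_finite_coeff_space: "sigma_finite_measure (coeff_space N)"
  unfolding coeff_space_def by (rule sigma_finite_PiM_lborel[OF finite_curve_index])

lemma sigma_finite_split_space: "sigma_finite_measure (split_space N)"
  unfolding split_space_def
  by (intro sigma_finite_pair_measure sigma_finite_trig_space lborel.sigma_finite_measure_axioms)

lemma nn_integral_coeff_space:
  assumes [measurable]: "F \<in> borel_measurable (coeff_space N)"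
  shows "(\<integral>\<^sup>+c. F c \<partial>coeff_space N) = (\<integral>\<^sup>+z. F (join_coeffs N z) \<partial>split_space N)"
  by (subst distr_join_coeffs[symmetric], subst nn_integral_distr) auto

lemma nn_integral_split_space:
  assumes [measurable]: "F \<in> borel_measurable (split_space N)"
  shows "(\<integral>\<^sup>+z. F z \<partial>split_space N) =
    (\<integral>\<^sup>+a. \<integral>\<^sup>+b. \<integral>\<^sup>+p. F (a, b, p) \<partial>(lborel \<Otimes>\<^sub>M lborel) \<partial>trig_space N \<partial>trig_space N)"
proof -
  note s1 = sigma_finite_pair_measure[OF lborel.sigma_finite_measure_axioms lborel.sigma_finite_measure_axioms]
  note s2 = sigma_finite_pair_measure[OF sigma_finite_trig_space s1]
  have F: "F \<in> borel_measurable (trig_space N \<Otimes>\<^sub>M (trig_space N \<Otimes>\<^sub>M (lborel \<Otimes>\<^sub>M lborel)))"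
    using assms by (simp add: split_space_def)
  have "(\<integral>\<^sup>+z. F z \<partial>split_space N) = (\<integral>\<^sup>+a. \<integral>\<^sup>+q. F (a, q) \<partial>(trig_space N \<Otimes>\<^sub>M (lborel \<Otimes>\<^sub>M lborel)) \<partial>trig_space N)"
    unfolding split_space_def using sigma_finite_measure.nn_integral_fst[OF s2 F] by simp
  also have "\<dots> = (\<integral>\<^sup>+a. \<integral>\<^sup>+b. \<integral>\<^sup>+p. F (a, b, p) \<partial>(lborel \<Otimes>\<^sub>M lborel) \<partial>trig_space N \<partial>trig_space N)"
  proof (rule nn_integral_cong)
    fix a assume a: "a \<in> space (trig_space N)"
    have "(\<lambda>q. F (a, q)) \<in> borel_measurable (trig_space N \<Otimes>\<^sub>M (lborel \<Otimes>\<^sub>M lborel))"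
      by (rule measurable_compose[OF measurable_Pair1'[OF a] F])
    from sigma_finite_measure.nn_integral_fst[OF s1 this]
    show "(\<integral>\<^sup>+q. F (a, q) \<partial>(trig_space N \<Otimes>\<^sub>M (lborel \<Otimes>\<^sub>M lborel))) =
      (\<integral>\<^sup>+b. \<integral>\<^sup>+p. F (a, b, p) \<partial>(lborel \<Otimes>\<^sub>M lborel) \<partial>trig_space N)" by simp
  qed
  finally show ?thesis .
qed

section \<open>The expected number of crossings\<close>

lemma measurable_crossing_count_right [measurable]:
  "crossing_count N c \<in> borel_measurable (coeff_space N)"
  unfolding crossing_count_def[abs_def]
  by (rule borel_measurable_ecount_zeros[OF atLeastLessThan_square_eq_UN_compact])
     (auto intro: compact_Times continuous_on_curve_difference)

text \<open>For fixed other coefficients, the crossings are the preimages of the constant terms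
  \<open>p\<close> under \<open>(\<phi>, \<psi>) \<mapsto> sqrt 2 * (f \<phi> - g\<^sub>0
  \<psi>)\<close>, so the area formula trades the integral over \<open>p\<close> for one over
  \<open>\<theta>\<close>. The scaling by \<open>sqrt 2\<close> in both components doubles the
  Jacobian, and in the ball condition \<open>p\<close> is replaced by its value at
  \<open>\<theta>\<close>.\<close>

lemma nn_integral_constant_terms_crossing_count:
  fixes a b a' b' :: "int \<Rightarrow> real" and x y \<rho> :: real and N :: nat
  defines "D \<equiv> {0..<2 * pi} \<times> {0..<2 * pi}"
    and "f1 \<equiv> \<lambda>\<phi>. x / sqrt 2 + trig_val N a \<phi>" and "f2 \<equiv> \<lambda>\<phi>. y / sqrt 2 + trig_val N b \<phi>"
  shows "(\<integral>\<^sup>+p. indicator {..\<rho>} (\<Sum>i\<in>curve_index N. (join_coeffs N (a', b', p) i)\<^sup>2) *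
      crossing_count N (join_coeffs N (a, b, x, y)) (join_coeffs N (a', b', p)) \<partial>(lborel \<Otimes>\<^sub>M lborel)) =
    (\<integral>\<^sup>+\<theta>. (2 * indicator D \<theta>) * (ennreal \<bar>trig_deriv N a (fst \<theta>) * trig_deriv N b' (snd \<theta>) - trig_deriv N b (fst \<theta>) * trig_deriv N a' (snd \<theta>)\<bar> *
      indicator {..\<rho>} (2 * (f1 (fst \<theta>) - trig_val N a' (snd \<theta>))\<^sup>2 + trig_sq N a' +
        (2 * (f2 (fst \<theta>) - trig_val N b' (snd \<theta>))\<^sup>2 + trig_sq N b'))) \<partial>lborel)"
proof -
  \<comment> \<open>The constant terms for which the second curve stays in the ball.\<close>
  define C where "C = {p :: real \<times> real. trig_sq N a' + trig_sq N b' + ((fst p)\<^sup>2 + (snd p)\<^sup>2) \<le> \<rho>}"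
  let ?u = "\<lambda>\<phi>. sqrt 2 * f1 \<phi>" and ?v = "\<lambda>\<phi>. sqrt 2 * f2 \<phi>"
    and ?p = "\<lambda>\<psi>. sqrt 2 * trig_val N a' \<psi>" and ?q = "\<lambda>\<psi>. sqrt 2 * trig_val N b' \<psi>"
  have Cb: "C \<in> sets borel"
    unfolding C_def by (intro borel_closed closed_Collect_le continuous_intros)
  have count: "crossing_count N (join_coeffs N (a, b, x, y)) (join_coeffs N (a', b', p)) =
      ecount {\<theta> \<in> D. (?u (fst \<theta>) - ?p (snd \<theta>), ?v (fst \<theta>) - ?q (snd \<theta>)) = p}" for p
  proof -
    have *: "X - (r / sqrt 2 + Y) = 0 \<longleftrightarrow> sqrt 2 * X - sqrt 2 * Y = r" for X Y r :: real
      by (auto simp: field_simps)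
    obtain p1 p2 where p: "p = (p1, p2)" by (metis surj_pair)
    show ?thesis
      unfolding crossing_count_def p curve_of_join_coeffs D_def f1_def f2_def
      by (rule arg_cong[where f = ecount]) (simp only: diff_Pair prod_eq_iff fst_conv snd_conv fst_zero snd_zero *)
  qed
  have ind: "indicator {..\<rho>} (\<Sum>i\<in>curve_index N. (join_coeffs N (a', b', p) i)\<^sup>2) = (indicator C p :: ennreal)" for p
    by (cases p) (simp add: sum_squares_join_coeffs C_def indicator_def)
  have "(\<integral>\<^sup>+p. indicator {..\<rho>} (\<Sum>i\<in>curve_index N. (join_coeffs N (a', b', p) i)\<^sup>2) *
      crossing_count N (join_coeffs N (a, b, x, y)) (join_coeffs N (a', b', p)) \<partial>(lborel \<Otimes>\<^sub>M lborel)) =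
    (\<integral>\<^sup>+p. indicator C p * ecount {\<theta> \<in> D. (?u (fst \<theta>) - ?p (snd \<theta>), ?v (fst \<theta>) - ?q (snd \<theta>)) = p} \<partial>lborel)"
    unfolding ind count lborel_prod ..
  also have "\<dots> = (\<integral>\<^sup>+\<theta>. ennreal \<bar>(sqrt 2 * trig_deriv N a (fst \<theta>)) * (sqrt 2 * trig_deriv N b' (snd \<theta>)) -
        (sqrt 2 * trig_deriv N b (fst \<theta>)) * (sqrt 2 * trig_deriv N a' (snd \<theta>))\<bar> *
      indicator C (?u (fst \<theta>) - ?p (snd \<theta>), ?v (fst \<theta>) - ?q (snd \<theta>)) * indicator D \<theta> \<partial>lborel)"
    unfolding D_def
  proof (rule area_formula_difference)
    show "((\<lambda>\<phi>. sqrt 2 * f1 \<phi>) has_real_derivative sqrt 2 * trig_deriv N a \<phi>) (at \<phi>)" for \<phi>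
      unfolding f1_def by (rule derivative_eq_intros trig_val_has_derivative refl | simp)+
    show "((\<lambda>\<phi>. sqrt 2 * f2 \<phi>) has_real_derivative sqrt 2 * trig_deriv N b \<phi>) (at \<phi>)" for \<phi>
      unfolding f2_def by (rule derivative_eq_intros trig_val_has_derivative refl | simp)+
  qed (use Cb in \<open>auto intro!: continuous_intros continuous_on_trig_deriv DERIV_cmult trig_val_has_derivative\<close>)
  also have "\<dots> = (\<integral>\<^sup>+\<theta>. (2 * indicator D \<theta>) * (ennreal \<bar>trig_deriv N a (fst \<theta>) * trig_deriv N b' (snd \<theta>) - trig_deriv N b (fst \<theta>) * trig_deriv N a' (snd \<theta>)\<bar> *
      indicator {..\<rho>} (2 * (f1 (fst \<theta>) - trig_val N a' (snd \<theta>))\<^sup>2 + trig_sq N a' +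
        (2 * (f2 (fst \<theta>) - trig_val N b' (snd \<theta>))\<^sup>2 + trig_sq N b'))) \<partial>lborel)"
  proof (rule nn_integral_cong)
    fix \<theta> :: "real \<times> real"
    obtain \<phi> \<psi> where \<theta>: "\<theta> = (\<phi>, \<psi>)" by (metis surj_pair)
    have "\<bar>(sqrt 2 * trig_deriv N a \<phi>) * (sqrt 2 * trig_deriv N b' \<psi>) - (sqrt 2 * trig_deriv N b \<phi>) * (sqrt 2 * trig_deriv N a' \<psi>)\<bar> =
      \<bar>(sqrt 2 * sqrt 2) * (trig_deriv N a \<phi> * trig_deriv N b' \<psi> - trig_deriv N b \<phi> * trig_deriv N a' \<psi>)\<bar>"
      by (simp only: algebra_simps)
    also have "\<dots> = 2 * \<bar>trig_deriv N a \<phi> * trig_deriv N b' \<psi> - trig_deriv N b \<phi> * trig_deriv N a' \<psi>\<bar>"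
      by (simp only: abs_mult) simp
    finally have 1: "ennreal \<bar>(sqrt 2 * trig_deriv N a \<phi>) * (sqrt 2 * trig_deriv N b' \<psi>) - (sqrt 2 * trig_deriv N b \<phi>) * (sqrt 2 * trig_deriv N a' \<psi>)\<bar> =
      2 * ennreal \<bar>trig_deriv N a \<phi> * trig_deriv N b' \<psi> - trig_deriv N b \<phi> * trig_deriv N a' \<psi>\<bar>"
      by (simp add: ennreal_mult)
    have sq: "(sqrt 2 * X - sqrt 2 * Y)\<^sup>2 = 2 * (X - Y)\<^sup>2" for X Y :: real
      by (simp add: right_diff_distrib[symmetric] power_mult_distrib)
    have 2: "indicator C (?u \<phi> - ?p \<psi>, ?v \<phi> - ?q \<psi>) = (indicator {..\<rho>} (2 * (f1 \<phi> - trig_val N a' \<psi>)\<^sup>2 + trig_sq N a' +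
        (2 * (f2 \<phi> - trig_val N b' \<psi>)\<^sup>2 + trig_sq N b')) :: ennreal)"
      by (simp add: C_def indicator_def sq add_ac)
    show "ennreal \<bar>(sqrt 2 * trig_deriv N a (fst \<theta>)) * (sqrt 2 * trig_deriv N b' (snd \<theta>)) -
        (sqrt 2 * trig_deriv N b (fst \<theta>)) * (sqrt 2 * trig_deriv N a' (snd \<theta>))\<bar> *
      indicator C (?u (fst \<theta>) - ?p (snd \<theta>), ?v (fst \<theta>) - ?q (snd \<theta>)) * indicator D \<theta> =
      (2 * indicator D \<theta>) * (ennreal \<bar>trig_deriv N a (fst \<theta>) * trig_deriv N b' (snd \<theta>) - trig_deriv N b (fst \<theta>) * trig_deriv N a' (snd \<theta>)\<bar> *
      indicator {..\<rho>} (2 * (f1 (fst \<theta>) - trig_val N a' (snd \<theta>))\<^sup>2 + trig_sq N a' +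
        (2 * (f2 (fst \<theta>) - trig_val N b' (snd \<theta>))\<^sup>2 + trig_sq N b')))"
      unfolding \<theta> fst_conv snd_conv 1 2 by (simp add: mult_ac)
  qed
  finally show ?thesis .
qed

text \<open>Tonelli moves \<open>\<theta>\<close> outermost; for fixed \<open>\<theta>\<close> the
  integral over the coefficients of \<open>g\<close> is \<open>crossing_density\<close>, from which
  \<open>snd \<theta>\<close> has disappeared.\<close>

lemma nn_integral_crossing_count:
  fixes a b :: "int \<Rightarrow> real" and x y \<rho> :: real and n :: nat
  defines "D \<equiv> {0..<2 * pi} \<times> {0..<2 * pi}" and "N \<equiv> Suc n"
  shows "(\<integral>\<^sup>+e. indicator {..\<rho>} (\<Sum>i\<in>curve_index N. (e i)\<^sup>2) * crossing_count N (join_coeffs N (a, b, x, y)) e \<partial>coeff_space N) =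
    (\<integral>\<^sup>+\<theta>. (2 * indicator D \<theta>) * crossing_density n \<rho> (x / sqrt 2 + trig_val N a (fst \<theta>), y / sqrt 2 + trig_val N b (fst \<theta>))
      (trig_deriv N a (fst \<theta>), trig_deriv N b (fst \<theta>)) \<partial>(lborel \<Otimes>\<^sub>M lborel))"
proof -
  let ?f1 = "\<lambda>\<phi>. x / sqrt 2 + trig_val N a \<phi>" and ?f2 = "\<lambda>\<phi>. y / sqrt 2 + trig_val N b \<phi>"
  let ?g = "\<lambda>a' b' \<phi> \<psi>. ennreal \<bar>trig_deriv N a \<phi> * trig_deriv N b' \<psi> - trig_deriv N b \<phi> * trig_deriv N a' \<psi>\<bar> *
      indicator {..\<rho>} (2 * (?f1 \<phi> - trig_val N a' \<psi>)\<^sup>2 + trig_sq N a' + (2 * (?f2 \<phi> - trig_val N b' \<psi>)\<^sup>2 + trig_sq N b'))"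
  have c [measurable]: "trig_val N a \<in> borel_measurable borel" "trig_val N b \<in> borel_measurable borel"
    "trig_deriv N a \<in> borel_measurable borel" "trig_deriv N b \<in> borel_measurable borel"
    by (auto intro!: borel_measurable_continuous_onI DERIV_continuous_on trig_val_has_derivative continuous_on_trig_deriv)
  have [measurable]: "D \<in> sets (lborel \<Otimes>\<^sub>M lborel)" "D \<in> sets (borel \<Otimes>\<^sub>M borel)"
    unfolding D_def by (auto intro!: pair_measureI)
  note s1 = sigma_finite_pair_measure[OF lborel.sigma_finite_measure_axioms lborel.sigma_finite_measure_axioms]
  interpret T: sigma_finite_measure "trig_space N" by (rule sigma_finite_trig_space)
  have "(\<integral>\<^sup>+e. indicator {..\<rho>} (\<Sum>i\<in>curve_index N. (e i)\<^sup>2) * crossing_count N (join_coeffs N (a, b, x, y)) e \<partial>coeff_space N) =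
    (\<integral>\<^sup>+a'. \<integral>\<^sup>+b'. \<integral>\<^sup>+p. indicator {..\<rho>} (\<Sum>i\<in>curve_index N. (join_coeffs N (a', b', p) i)\<^sup>2) *
      crossing_count N (join_coeffs N (a, b, x, y)) (join_coeffs N (a', b', p)) \<partial>(lborel \<Otimes>\<^sub>M lborel) \<partial>trig_space N \<partial>trig_space N)"
  proof -
    have F: "(\<lambda>e. indicator {..\<rho>} (\<Sum>i\<in>curve_index N. (e i)\<^sup>2) * crossing_count N (join_coeffs N (a, b, x, y)) e) \<in> borel_measurable (coeff_space N)"
      by measurable
    show ?thesis
      unfolding nn_integral_coeff_space[OF F]
        nn_integral_split_space[OF measurable_compose[OF measurable_join_coeffs F]] ..
  qed
  also have "\<dots> = (\<integral>\<^sup>+a'. \<integral>\<^sup>+b'. \<integral>\<^sup>+\<theta>. (2 * indicator D \<theta>) * ?g a' b' (fst \<theta>) (snd \<theta>) \<partial>(lborel \<Otimes>\<^sub>M lborel) \<partial>trig_space N \<partial>trig_space N)"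
    unfolding nn_integral_constant_terms_crossing_count D_def lborel_prod[symmetric] ..
  also have "\<dots> = (\<integral>\<^sup>+a'. \<integral>\<^sup>+\<theta>. \<integral>\<^sup>+b'. (2 * indicator D \<theta>) * ?g a' b' (fst \<theta>) (snd \<theta>) \<partial>trig_space N \<partial>(lborel \<Otimes>\<^sub>M lborel) \<partial>trig_space N)"
    by (intro nn_integral_cong nn_integral_swap[OF sigma_finite_trig_space s1]) measurable
  also have "\<dots> = (\<integral>\<^sup>+\<theta>. \<integral>\<^sup>+a'. \<integral>\<^sup>+b'. (2 * indicator D \<theta>) * ?g a' b' (fst \<theta>) (snd \<theta>) \<partial>trig_space N \<partial>trig_space N \<partial>(lborel \<Otimes>\<^sub>M lborel))"
    by (rule nn_integral_swap[OF sigma_finite_trig_space s1]) measurable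
  also have "\<dots> = (\<integral>\<^sup>+\<theta>. (2 * indicator D \<theta>) * (\<integral>\<^sup>+a'. \<integral>\<^sup>+b'. ?g a' b' (fst \<theta>) (snd \<theta>) \<partial>trig_space N \<partial>trig_space N) \<partial>(lborel \<Otimes>\<^sub>M lborel))"
  proof (rule nn_integral_cong)
    fix \<theta> :: "real \<times> real"
    have "(\<integral>\<^sup>+a'. \<integral>\<^sup>+b'. (2 * indicator D \<theta>) * ?g a' b' (fst \<theta>) (snd \<theta>) \<partial>trig_space N \<partial>trig_space N) =
      (\<integral>\<^sup>+a'. (2 * indicator D \<theta>) * (\<integral>\<^sup>+b'. ?g a' b' (fst \<theta>) (snd \<theta>) \<partial>trig_space N) \<partial>trig_space N)"
      by (intro nn_integral_cong nn_integral_cmult) measurable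
    also have "\<dots> = (2 * indicator D \<theta>) * (\<integral>\<^sup>+a'. \<integral>\<^sup>+b'. ?g a' b' (fst \<theta>) (snd \<theta>) \<partial>trig_space N \<partial>trig_space N)"
      by (rule nn_integral_cmult) measurable
    finally show "(\<integral>\<^sup>+a'. \<integral>\<^sup>+b'. (2 * indicator D \<theta>) * ?g a' b' (fst \<theta>) (snd \<theta>) \<partial>trig_space N \<partial>trig_space N) =
      (2 * indicator D \<theta>) * (\<integral>\<^sup>+a'. \<integral>\<^sup>+b'. ?g a' b' (fst \<theta>) (snd \<theta>) \<partial>trig_space N \<partial>trig_space N)" .
  qed
  finally show ?thesis unfolding N_def crossing_density_eq .
qed

lemma nn_integral_lborel_affine2:
  fixes g :: "real \<Rightarrow> real \<Rightarrow> ennreal" and k s t :: real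
  assumes [measurable]: "case_prod g \<in> borel_measurable (borel \<Otimes>\<^sub>M borel)" and k: "k \<noteq> 0"
  shows "(\<integral>\<^sup>+x. \<integral>\<^sup>+y. g x y \<partial>lborel \<partial>lborel) =
    ennreal (k\<^sup>2) * (\<integral>\<^sup>+x. \<integral>\<^sup>+y. g (k * (x - s)) (k * (y - t)) \<partial>lborel \<partial>lborel)"
proof -
  have "(\<integral>\<^sup>+x. \<integral>\<^sup>+y. g x y \<partial>lborel \<partial>lborel) = (\<integral>\<^sup>+x. ennreal \<bar>k\<bar> * (\<integral>\<^sup>+y. g x (- k * t + k * y) \<partial>lborel) \<partial>lborel)"
    using k by (intro nn_integral_cong nn_integral_real_affine) auto
  also have "\<dots> = ennreal \<bar>k\<bar> * (\<integral>\<^sup>+x. ennreal \<bar>k\<bar> * (\<integral>\<^sup>+y. g (- k * s + k * x) (- k * t + k * y) \<partial>lborel) \<partial>lborel)"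
    using k by (intro nn_integral_real_affine) auto
  also have "\<dots> = ennreal \<bar>k\<bar> * (ennreal \<bar>k\<bar> * (\<integral>\<^sup>+x. \<integral>\<^sup>+y. g (- k * s + k * x) (- k * t + k * y) \<partial>lborel \<partial>lborel))"
    by (subst nn_integral_cmult) auto
  also have "\<dots> = (ennreal \<bar>k\<bar> * ennreal \<bar>k\<bar>) * (\<integral>\<^sup>+x. \<integral>\<^sup>+y. g (k * (x - s)) (k * (y - t)) \<partial>lborel \<partial>lborel)"
    by (simp add: mult.assoc algebra_simps)
  also have "ennreal \<bar>k\<bar> * ennreal \<bar>k\<bar> = ennreal (k\<^sup>2)"
    by (simp add: ennreal_mult[symmetric] power2_eq_square)
  finally show ?thesis .
qed

text \<open>Substituting the point \<open>w = f \<phi>\<close> for the constant term of \<open>f\<close>.\<close>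

lemma nn_integral_split_space_crossing_density:
  fixes n :: nat and \<rho> \<phi> :: real
  assumes \<rho>: "\<rho> > 0"
  defines "N \<equiv> Suc n"
  shows "(\<integral>\<^sup>+(a, b, x, y). indicator {..\<rho>} (trig_sq N a + trig_sq N b + (x\<^sup>2 + y\<^sup>2)) *
      crossing_density n \<rho> (x / sqrt 2 + trig_val N a \<phi>, y / sqrt 2 + trig_val N b \<phi>)
        (trig_deriv N a \<phi>, trig_deriv N b \<phi>) \<partial>split_space N) =
    2 * ennreal ((\<Sum>k=1..Suc n. (real k)\<^sup>2) * (unit_ball_vol (4 * n + 5))\<^sup>2 * \<rho> ^ (4 * n + 6) / (8 * (2 * n + 3)\<^sup>2))"
proof -
  interpret T: sigma_finite_measure "trig_space N" by (rule sigma_finite_trig_space)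
  note s = sigma_finite_trig_space lborel.sigma_finite_measure_axioms
  let ?E = "\<lambda>a b w1 w2. crossing_density n \<rho> (w1, w2) (trig_deriv N a \<phi>, trig_deriv N b \<phi>)"
  let ?g = "\<lambda>a b x y. indicator {..\<rho>} (trig_sq N a + trig_sq N b + (x\<^sup>2 + y\<^sup>2)) *
      ?E a b (x / sqrt 2 + trig_val N a \<phi>) (y / sqrt 2 + trig_val N b \<phi>)"
  let ?h = "\<lambda>a b w1 w2. ?E a b w1 w2 * indicator {..\<rho>} (2 * (w1 - trig_val N a \<phi>)\<^sup>2 + trig_sq N a +
        (2 * (w2 - trig_val N b \<phi>)\<^sup>2 + trig_sq N b))"
  have "(\<lambda>(a, b, x, y). ?g a b x y) \<in> borel_measurable (split_space N)"
    unfolding split_space_def by measurable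
  from nn_integral_split_space[OF this]
  have "(\<integral>\<^sup>+(a, b, x, y). ?g a b x y \<partial>split_space N) =
      (\<integral>\<^sup>+a. \<integral>\<^sup>+b. \<integral>\<^sup>+(x, y). ?g a b x y \<partial>(lborel \<Otimes>\<^sub>M lborel) \<partial>trig_space N \<partial>trig_space N)"
    by simp
  also have "\<dots> = (\<integral>\<^sup>+a. \<integral>\<^sup>+b. 2 * (\<integral>\<^sup>+w1. \<integral>\<^sup>+w2. ?h a b w1 w2 \<partial>lborel \<partial>lborel) \<partial>trig_space N \<partial>trig_space N)"
  proof (rule nn_integral_cong, rule nn_integral_cong)
    fix a b
    have eq: "?g a b (sqrt 2 * (w1 - trig_val N a \<phi>)) (sqrt 2 * (w2 - trig_val N b \<phi>)) = ?h a b w1 w2" for w1 w2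
      by (simp add: power_mult_distrib indicator_def add_ac mult.commute)
    have "(\<integral>\<^sup>+(x, y). ?g a b x y \<partial>(lborel \<Otimes>\<^sub>M lborel)) = (\<integral>\<^sup>+x. \<integral>\<^sup>+y. ?g a b x y \<partial>lborel \<partial>lborel)"
      by (subst lborel.nn_integral_fst[symmetric]) auto
    also have "\<dots> = ennreal ((sqrt 2)\<^sup>2) * (\<integral>\<^sup>+w1. \<integral>\<^sup>+w2. ?g a b (sqrt 2 * (w1 - trig_val N a \<phi>)) (sqrt 2 * (w2 - trig_val N b \<phi>)) \<partial>lborel \<partial>lborel)"
      by (rule nn_integral_lborel_affine2) auto
    finally show "(\<integral>\<^sup>+(x, y). ?g a b x y \<partial>(lborel \<Otimes>\<^sub>M lborel)) = 2 * (\<integral>\<^sup>+w1. \<integral>\<^sup>+w2. ?h a b w1 w2 \<partial>lborel \<partial>lborel)"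
      unfolding eq by simp
  qed
  also have "\<dots> = 2 * (\<integral>\<^sup>+a. \<integral>\<^sup>+b. \<integral>\<^sup>+w1. \<integral>\<^sup>+w2. ?h a b w1 w2 \<partial>lborel \<partial>lborel \<partial>trig_space N \<partial>trig_space N)"
  proof -
    have "(\<integral>\<^sup>+a. \<integral>\<^sup>+b. 2 * (\<integral>\<^sup>+w1. \<integral>\<^sup>+w2. ?h a b w1 w2 \<partial>lborel \<partial>lborel) \<partial>trig_space N \<partial>trig_space N) =
      (\<integral>\<^sup>+a. 2 * (\<integral>\<^sup>+b. \<integral>\<^sup>+w1. \<integral>\<^sup>+w2. ?h a b w1 w2 \<partial>lborel \<partial>lborel \<partial>trig_space N) \<partial>trig_space N)"
      by (intro nn_integral_cong nn_integral_cmult) measurable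
    also have "\<dots> = 2 * (\<integral>\<^sup>+a. \<integral>\<^sup>+b. \<integral>\<^sup>+w1. \<integral>\<^sup>+w2. ?h a b w1 w2 \<partial>lborel \<partial>lborel \<partial>trig_space N \<partial>trig_space N)"
      by (rule nn_integral_cmult) measurable
    finally show ?thesis .
  qed
  also have "(\<integral>\<^sup>+a. \<integral>\<^sup>+b. \<integral>\<^sup>+w1. \<integral>\<^sup>+w2. ?h a b w1 w2 \<partial>lborel \<partial>lborel \<partial>trig_space N \<partial>trig_space N) =
      (\<integral>\<^sup>+a. \<integral>\<^sup>+w1. \<integral>\<^sup>+b. \<integral>\<^sup>+w2. ?h a b w1 w2 \<partial>lborel \<partial>trig_space N \<partial>lborel \<partial>trig_space N)"
    by (intro nn_integral_cong nn_integral_swap[OF s]) measurable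
  also have "\<dots> = (\<integral>\<^sup>+w1. \<integral>\<^sup>+a. \<integral>\<^sup>+b. \<integral>\<^sup>+w2. ?h a b w1 w2 \<partial>lborel \<partial>trig_space N \<partial>trig_space N \<partial>lborel)"
    by (rule nn_integral_swap[OF s]) measurable
  also have "\<dots> = (\<integral>\<^sup>+w1. \<integral>\<^sup>+a. \<integral>\<^sup>+w2. \<integral>\<^sup>+b. ?h a b w1 w2 \<partial>trig_space N \<partial>lborel \<partial>trig_space N \<partial>lborel)"
    by (intro nn_integral_cong nn_integral_swap[OF s]) measurable
  also have "\<dots> = (\<integral>\<^sup>+w1. \<integral>\<^sup>+w2. \<integral>\<^sup>+a. \<integral>\<^sup>+b. ?h a b w1 w2 \<partial>trig_space N \<partial>trig_space N \<partial>lborel \<partial>lborel)"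
    by (intro nn_integral_cong nn_integral_swap[OF s]) measurable
  finally show ?thesis
    unfolding N_def nn_integral_crossing_density[OF \<rho>] by simp
qed

text \<open>The integral over \<open>f\<close> does not depend on \<open>\<phi>\<close>, so the
  parameters contribute just the area \<open>4 * pi\<^sup>2\<close> of the square. Together with a
  factor 2 from the constant terms of each curve and the \<open>1 / 8\<close> from
  \<open>nn_integral_crossing_density\<close> this makes \<open>2 * pi\<^sup>2\<close>.\<close>

theorem nn_integral_crossing_count_balls:
  fixes n :: nat and \<rho> :: real
  assumes \<rho>: "\<rho> > 0"
  defines "N \<equiv> Suc n"
  shows "(\<integral>\<^sup>+c. indicator {..\<rho>} (\<Sum>i\<in>curve_index N. (c i)\<^sup>2) *
      (\<integral>\<^sup>+e. indicator {..\<rho>} (\<Sum>i\<in>curve_index N. (e i)\<^sup>2) * crossing_count N c e \<partial>coeff_space N) \<partial>coeff_space N) =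
    ennreal (2 * pi\<^sup>2 * (\<Sum>k=1..N. (real k)\<^sup>2) * (unit_ball_vol (4 * n + 5))\<^sup>2 * \<rho> ^ (4 * n + 6) / (2 * n + 3)\<^sup>2)"
proof -
  define D where "D = {0..<2 * pi} \<times> {0..<2 * pi}"
  define J where "J = (\<Sum>k=1..N. (real k)\<^sup>2) * (unit_ball_vol (4 * n + 5))\<^sup>2 * \<rho> ^ (4 * n + 6) / (8 * (2 * n + 3)\<^sup>2)"
  have J: "J \<ge> 0" unfolding J_def using \<rho> by (intro divide_nonneg_nonneg mult_nonneg_nonneg sum_nonneg) auto
  have D [measurable]: "D \<in> sets (lborel \<Otimes>\<^sub>M lborel)" "D \<in> sets (borel \<Otimes>\<^sub>M borel)"
    unfolding D_def by (auto intro!: pair_measureI)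
  note s1 = sigma_finite_pair_measure[OF lborel.sigma_finite_measure_axioms lborel.sigma_finite_measure_axioms]
  interpret C: sigma_finite_measure "coeff_space N" by (rule sigma_finite_coeff_space)
  let ?G = "\<lambda>c. indicator {..\<rho>} (\<Sum>i\<in>curve_index N. (c i)\<^sup>2) *
      (\<integral>\<^sup>+e. indicator {..\<rho>} (\<Sum>i\<in>curve_index N. (e i)\<^sup>2) * crossing_count N c e \<partial>coeff_space N)"
  let ?h = "\<lambda>\<phi> (a, b, x, y). indicator {..\<rho>} (trig_sq N a + trig_sq N b + (x\<^sup>2 + y\<^sup>2)) *
      crossing_density n \<rho> (x / sqrt 2 + trig_val N a \<phi>, y / sqrt 2 + trig_val N b \<phi>)
        (trig_deriv N a \<phi>, trig_deriv N b \<phi>)"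
  have h1 [measurable]: "?h \<phi> \<in> borel_measurable (split_space N)" for \<phi>
    unfolding split_space_def by measurable
  have h2: "(\<lambda>(z, \<theta>). (2 * indicator D \<theta>) * ?h (fst \<theta>) z) \<in> borel_measurable (split_space N \<Otimes>\<^sub>M (lborel \<Otimes>\<^sub>M lborel))"
    unfolding split_space_def by measurable
  have "(\<integral>\<^sup>+c. ?G c \<partial>coeff_space N) = (\<integral>\<^sup>+z. ?G (join_coeffs N z) \<partial>split_space N)"
    by (rule nn_integral_coeff_space) measurable
  also have "\<dots> = (\<integral>\<^sup>+z. \<integral>\<^sup>+\<theta>. (2 * indicator D \<theta>) * ?h (fst \<theta>) z \<partial>(lborel \<Otimes>\<^sub>M lborel) \<partial>split_space N)"
  proof (rule nn_integral_cong)
    fix z assume z: "z \<in> space (split_space N)"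
    obtain a b x y where [simp]: "z = (a, b, x, y)" by (metis surj_pair)
    let ?i = "indicator {..\<rho>} (trig_sq N a + trig_sq N b + (x\<^sup>2 + y\<^sup>2)) :: ennreal"
    let ?E = "\<lambda>\<phi>. crossing_density n \<rho> (x / sqrt 2 + trig_val N a \<phi>, y / sqrt 2 + trig_val N b \<phi>)
        (trig_deriv N a \<phi>, trig_deriv N b \<phi>)"
    have [measurable]: "trig_val N a \<in> borel_measurable borel" "trig_val N b \<in> borel_measurable borel"
      "trig_deriv N a \<in> borel_measurable borel" "trig_deriv N b \<in> borel_measurable borel"
      by (auto intro!: borel_measurable_continuous_onI DERIV_continuous_on trig_val_has_derivative continuous_on_trig_deriv)
    have "?G (join_coeffs N z) = ?i * (\<integral>\<^sup>+\<theta>. (2 * indicator D \<theta>) * ?E (fst \<theta>) \<partial>(lborel \<Otimes>\<^sub>M lborel))"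
      by (simp only: \<open>z = (a, b, x, y)\<close> sum_squares_join_coeffs nn_integral_crossing_count N_def D_def)
    also have "\<dots> = (\<integral>\<^sup>+\<theta>. ?i * ((2 * indicator D \<theta>) * ?E (fst \<theta>)) \<partial>(lborel \<Otimes>\<^sub>M lborel))"
      by (rule nn_integral_cmult[symmetric]) measurable
    finally show "?G (join_coeffs N z) = (\<integral>\<^sup>+\<theta>. (2 * indicator D \<theta>) * ?h (fst \<theta>) z \<partial>(lborel \<Otimes>\<^sub>M lborel))"
      by (simp only: \<open>z = (a, b, x, y)\<close> prod.case mult_ac)
  qed
  also have "\<dots> = (\<integral>\<^sup>+\<theta>. \<integral>\<^sup>+z. (2 * indicator D \<theta>) * ?h (fst \<theta>) z \<partial>split_space N \<partial>(lborel \<Otimes>\<^sub>M lborel))"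
    by (rule nn_integral_swap[OF sigma_finite_split_space s1 h2])
  also have "\<dots> = (\<integral>\<^sup>+\<theta>. (2 * indicator D \<theta>) * (2 * ennreal J) \<partial>(lborel \<Otimes>\<^sub>M lborel))"
  proof (rule nn_integral_cong)
    fix \<theta> :: "real \<times> real"
    have "(\<integral>\<^sup>+z. (2 * indicator D \<theta>) * ?h (fst \<theta>) z \<partial>split_space N) = (2 * indicator D \<theta>) * (\<integral>\<^sup>+z. ?h (fst \<theta>) z \<partial>split_space N)"
      by (rule nn_integral_cmult) measurable
    then show "(\<integral>\<^sup>+z. (2 * indicator D \<theta>) * ?h (fst \<theta>) z \<partial>split_space N) = (2 * indicator D \<theta>) * (2 * ennreal J)"
      unfolding J_def N_def nn_integral_split_space_crossing_density[OF \<rho>] .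
  qed
  also have "\<dots> = (\<integral>\<^sup>+\<theta>. (4 * ennreal J) * indicator D \<theta> \<partial>(lborel \<Otimes>\<^sub>M lborel))"
    by (intro nn_integral_cong) (simp add: indicator_def mult.assoc[symmetric])
  also have "\<dots> = (4 * ennreal J) * emeasure (lborel \<Otimes>\<^sub>M lborel) D"
    by (rule nn_integral_cmult_indicator) measurable
  also have "emeasure (lborel \<Otimes>\<^sub>M lborel) D = ennreal (2 * pi) * ennreal (2 * pi)"
    unfolding D_def by (subst lborel.emeasure_pair_measure_Times) auto
  also have "(4 * ennreal J) * (ennreal (2 * pi) * ennreal (2 * pi)) = ennreal (4 * J * (2 * pi * (2 * pi)))"
    using J by (simp only: ennreal_mult ennreal_numeral mult_nonneg_nonneg zero_le_numeral pi_ge_zero)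
  also have "4 * J * (2 * pi * (2 * pi)) = 2 * pi\<^sup>2 * (\<Sum>k=1..N. (real k)\<^sup>2) * (unit_ball_vol (4 * n + 5))\<^sup>2 * \<rho> ^ (4 * n + 6) / (2 * n + 3)\<^sup>2"
    unfolding J_def by (simp add: power2_eq_square)
  finally show ?thesis .
qed

section \<open>Transfer to the volume of curves\<close>

text \<open>Bilinear extension of orthonormality. Interchanging the finite sums with the integral
  requires integrability of each product, hence the orthonormality in \<open>has_integral\<close>
  form.\<close>

lemma curve_inner_curve_of:
  "curve_inner (curve_of N c) (curve_of N e) = (\<Sum>i\<in>curve_index N. c i * e i)"
proof -
  let ?I = "curve_index N"
  have basis: "((\<lambda>\<phi>. curve_basis i \<phi> \<bullet> curve_basis j \<phi>) has_integral (if i = j then pi else 0)) {0..2 * pi}"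
    if ij: "i \<in> ?I" "j \<in> ?I" for i j
  proof -
    obtain k u l v where [simp]: "i = (k, u)" "j = (l, v)" by (metis surj_pair)
    have uv: "u \<in> Basis" "v \<in> Basis" using ij by (auto simp: curve_index_def)
    have "((\<lambda>\<phi>. (u \<bullet> v) * (trig_basis k \<phi> * trig_basis l \<phi>)) has_integral (u \<bullet> v) * (if k = l then pi else 0)) {0..2 * pi}"
      by (intro has_integral_mult_right has_integral_trig_basis)
    then show ?thesis using uv by (simp add: curve_basis_def mult_ac inner_Basis split: if_splits)
  qed
  have "((\<lambda>\<phi>. \<Sum>i\<in>?I. \<Sum>j\<in>?I. (c i * e j) * (curve_basis i \<phi> \<bullet> curve_basis j \<phi>)) has_integral
      (\<Sum>i\<in>?I. \<Sum>j\<in>?I. (c i * e j) * (if i = j then pi else 0))) {0..2 * pi}"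
    by (intro has_integral_sum has_integral_mult_right basis finite_curve_index)
  moreover have "(\<Sum>i\<in>?I. \<Sum>j\<in>?I. (c i * e j) * (curve_basis i \<phi> \<bullet> curve_basis j \<phi>)) = curve_of N c \<phi> \<bullet> curve_of N e \<phi>" for \<phi>
    unfolding curve_of_def by (subst inner_sum_left, intro sum.cong refl, subst inner_sum_right, simp add: mult_ac)
  moreover have "(\<Sum>i\<in>?I. \<Sum>j\<in>?I. (c i * e j) * (if i = j then pi else 0)) = (\<Sum>i\<in>?I. c i * e i) * pi"
    by (simp add: finite_curve_index sum_distrib_right if_distrib[of "\<lambda>x. _ * x"] cong: if_cong)
  ultimately have "((\<lambda>\<phi>. curve_of N c \<phi> \<bullet> curve_of N e \<phi>) has_integral (\<Sum>i\<in>?I. c i * e i) * pi) {0..2 * pi}"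
    by simp
  then show ?thesis by (simp add: curve_inner_def integral_unique)
qed

text \<open>By orthonormality this is a left inverse of \<open>curve_of\<close> on
  \<open>space (coeff_space N)\<close>; the restriction to \<open>curve_index N\<close> matches the
  extensional functions that make up that space.\<close>

definition curve_coeffs :: "nat \<Rightarrow> (real \<Rightarrow> real \<times> real) \<Rightarrow> int \<times> (real \<times> real) \<Rightarrow> real" where
  "curve_coeffs N f = (\<lambda>i\<in>curve_index N. curve_inner f (curve_basis i))"

lemma curve_coeffs_curve_of:
  assumes "c \<in> space (coeff_space N)"
  shows "curve_coeffs N (curve_of N c) = c"
proof
  fix j
  show "curve_coeffs N (curve_of N c) j = c j"
  proof (cases "j \<in> curve_index N")
    case True
    have "curve_basis j = curve_of N (\<lambda>i. if i = j then 1 else 0)"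
      using True by (auto simp: fun_eq_iff curve_of_def finite_curve_index sum.delta if_distrib[of "\<lambda>x. x *\<^sub>R _"] cong: if_cong)
    then have "curve_inner (curve_of N c) (curve_basis j) = c j"
      using True by (simp add: curve_inner_curve_of finite_curve_index sum.delta if_distrib[of "\<lambda>x. _ * x"] cong: if_cong)
    then show ?thesis using True by (simp add: curve_coeffs_def)
  next
    case False
    moreover have "c \<in> curve_index N \<rightarrow>\<^sub>E UNIV" using assms by (simp add: coeff_space_def space_PiM)
    ultimately show ?thesis by (simp add: curve_coeffs_def PiE_arb[of c])
  qed
qed

lemma curve_volume_eq: "curve_volume N = embed_measure (coeff_space N) (curve_of N)"
  by (simp add: curve_volume_def coeff_space_def)

lemma inj_on_curve_of: "inj_on (curve_of N) (space (coeff_space N))"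
  by (rule inj_on_inverseI[of _ "curve_coeffs N"]) (rule curve_coeffs_curve_of)

lemma measurable_curve_coeffs [measurable]: "curve_coeffs N \<in> measurable (curve_volume N) (coeff_space N)"
  unfolding curve_volume_eq
  by (rule measurable_embed_measure1) (simp add: curve_coeffs_curve_of cong: measurable_cong)

lemma measurable_curve_of_volume [measurable]: "curve_of N \<in> measurable (coeff_space N) (curve_volume N)"
  unfolding curve_volume_eq by (rule measurable_embed_measure2'[OF inj_on_curve_of])

lemma curve_volume_eq_distr: "curve_volume N = distr (coeff_space N) (curve_volume N) (curve_of N)"
  unfolding curve_volume_eq by (rule embed_measure_eq_distr'[OF inj_on_curve_of])

text \<open>\<open>curve_coeffs\<close> pushes the volume forward to the sigma-finite
  \<open>coeff_space\<close>, and sigma-finiteness of a push-forward passes back to the original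
  measure. This permits the product of two image measures to be treated as the image of a
  product.\<close>

lemma sigma_finite_curve_volume: "sigma_finite_measure (curve_volume N)"
proof -
  have "coeff_space N = distr (curve_volume N) (coeff_space N) (curve_coeffs N)"
  proof (rule measure_eqI)
    fix A assume A: "A \<in> sets (coeff_space N)"
    have "emeasure (distr (curve_volume N) (coeff_space N) (curve_coeffs N)) A =
        emeasure (coeff_space N) (curve_of N -` (curve_coeffs N -` A \<inter> space (curve_volume N)) \<inter> space (coeff_space N))"
      using A by (subst emeasure_distr, measurable, subst curve_volume_eq_distr, subst emeasure_distr)
        (auto intro!: measurable_sets[OF measurable_curve_coeffs])
    also have "curve_of N -` (curve_coeffs N -` A \<inter> space (curve_volume N)) \<inter> space (coeff_space N) = A"
      using sets.sets_into_space[OF A] measurable_space[OF measurable_curve_of_volume]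
      by (auto simp: curve_coeffs_curve_of)
    finally show "emeasure (coeff_space N) A = emeasure (distr (curve_volume N) (coeff_space N) (curve_coeffs N)) A" ..
  qed simp
  then have "sigma_finite_measure (distr (curve_volume N) (coeff_space N) (curve_coeffs N))"
    using sigma_finite_coeff_space[of N] by simp
  then show ?thesis
    by (rule sigma_finite_measure_distr) measurable
qed

lemma curve_pair_volume_eq_distr:
  "curve_pair_volume N = distr (coeff_space N \<Otimes>\<^sub>M coeff_space N) (curve_pair_volume N) (\<lambda>(c, e). (curve_of N c, curve_of N e))"
proof -
  have "sigma_finite_measure (distr (coeff_space N) (curve_volume N) (curve_of N))"
    using sigma_finite_curve_volume[of N] by (simp flip: curve_volume_eq_distr)
  from pair_measure_distr[OF measurable_curve_of_volume measurable_curve_of_volume this]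
  show ?thesis unfolding curve_pair_volume_def by (simp flip: curve_volume_eq_distr)
qed

text \<open>Measurability has to be checked on the coefficient side only: \<open>A\<close> is the
  preimage of \<open>A'\<close> under \<open>curve_coeffs\<close> in both components, since
  \<open>curve_coeffs\<close> inverts \<open>curve_of\<close> on all of
  \<open>curves N\<close>.\<close>

lemma emeasure_curve_pair_volume:
  fixes A N
  defines "A' \<equiv> {z \<in> space (coeff_space N \<Otimes>\<^sub>M coeff_space N). (curve_of N (fst z), curve_of N (snd z)) \<in> A}"
  assumes A: "A \<subseteq> curves N \<times> curves N" and A': "A' \<in> sets (coeff_space N \<Otimes>\<^sub>M coeff_space N)"
  shows "emeasure (curve_pair_volume N) A = emeasure (coeff_space N \<Otimes>\<^sub>M coeff_space N) A'"
proof -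
  let ?\<kappa> = "\<lambda>z. (curve_coeffs N (fst z), curve_coeffs N (snd z))"
  have sp: "space (curve_volume N) = curve_of N ` space (coeff_space N)"
    by (simp add: curve_volume_eq space_embed_measure)
  have "?\<kappa> -` A' \<inter> space (curve_pair_volume N) \<in> sets (curve_pair_volume N)"
    using A' unfolding curve_pair_volume_def by (intro measurable_sets) measurable
  also have "?\<kappa> -` A' \<inter> space (curve_pair_volume N) = A"
  proof -
    have inv: "curve_coeffs N f \<in> space (coeff_space N) \<and> curve_of N (curve_coeffs N f) = f" if "f \<in> curves N" for f
      using that by (auto simp: sp curve_coeffs_curve_of simp flip: space_curve_volume)
    show ?thesis
    proof (intro equalityI subsetI)
      fix z assume z: "z \<in> ?\<kappa> -` A' \<inter> space (curve_pair_volume N)"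
      then have "fst z \<in> curves N" "snd z \<in> curves N"
        by (auto simp: curve_pair_volume_def space_pair_measure space_curve_volume)
      then show "z \<in> A" using z inv by (simp add: A'_def)
    next
      fix z assume z: "z \<in> A"
      then have "fst z \<in> curves N" "snd z \<in> curves N" using A by auto
      then show "z \<in> ?\<kappa> -` A' \<inter> space (curve_pair_volume N)"
        using z inv by (auto simp: A'_def curve_pair_volume_def space_pair_measure space_curve_volume mem_Times_iff)
    qed
  qed
  finally have As: "A \<in> sets (curve_pair_volume N)" .
  have "emeasure (curve_pair_volume N) A =
      emeasure (distr (coeff_space N \<Otimes>\<^sub>M coeff_space N) (curve_pair_volume N) (\<lambda>(c, e). (curve_of N c, curve_of N e))) A"
    by (simp flip: curve_pair_volume_eq_distr)
  also have "\<dots> = emeasure (coeff_space N \<Otimes>\<^sub>M coeff_space N)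
      ((\<lambda>(c, e). (curve_of N c, curve_of N e)) -` A \<inter> space (coeff_space N \<Otimes>\<^sub>M coeff_space N))"
    using As by (intro emeasure_distr) (auto simp: curve_pair_volume_def)
  also have "(\<lambda>(c, e). (curve_of N c, curve_of N e)) -` A \<inter> space (coeff_space N \<Otimes>\<^sub>M coeff_space N) = A'"
    by (auto simp: A'_def)
  finally show ?thesis .
qed

lemma curve_of_in_curve_ball_iff:
  assumes "R > 0" "c \<in> space (coeff_space N)"
  shows "curve_of N c \<in> curve_ball N R \<longleftrightarrow> (\<Sum>i\<in>curve_index N. (c i)\<^sup>2) \<le> R\<^sup>2"
proof -
  have "curve_of N c \<in> curves N"
    using measurable_space[OF measurable_curve_of_volume assms(2)] by (simp add: space_curve_volume)
  moreover have "sqrt s \<le> R \<longleftrightarrow> s \<le> R\<^sup>2" for s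
    using assms(1) real_sqrt_le_iff[of s "R\<^sup>2"] by simp
  ultimately show ?thesis
    by (simp add: curve_ball_def curve_inner_curve_of power2_eq_square)
qed

lemma crossing_count_eq: "crossing_count N c e = ecount (intersection_points (curve_of N c) (curve_of N e))"
  unfolding crossing_count_def intersection_points_def by (rule arg_cong[where f = ecount]) auto

text \<open>A single equation in \<open>ennreal\<close> expresses both conditions in the definition
  of \<open>intersection_fraction\<close>.\<close>

lemma ecount_eq_of_nat_iff: "ecount Z = of_nat i \<longleftrightarrow> finite Z \<and> card Z = i"
  by (auto simp: emeasure_count_space)

section \<open>Normalisation and summation over the fractions\<close>

lemma emeasure_coeff_ball:
  assumes "R > 0"
  shows "emeasure (coeff_space N) {c \<in> space (coeff_space N). (\<Sum>i\<in>curve_index N. (c i)\<^sup>2) \<le> R\<^sup>2} =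
    ennreal (unit_ball_vol (4 * N + 2) * R ^ (4 * N + 2))"
proof -
  have card: "card (curve_index N) = 4 * N + 2"
    by (simp add: curve_index_eq card_cartesian_product)
  have "{c \<in> space (coeff_space N). (\<Sum>i\<in>curve_index N. (c i)\<^sup>2) \<le> R\<^sup>2} =
      {f. sqrt (\<Sum>i\<in>curve_index N. (f i)\<^sup>2) \<le> R} \<inter> space (coeff_space N)"
    using assms real_sqrt_le_iff[of _ "R\<^sup>2"] by auto
  then show ?thesis
    using emeasure_cball_aux[OF finite_curve_index[of N] assms] by (simp add: coeff_space_def card)
qed

text \<open>\<open>T\<close> is the integral of the count over pairs in the ball and
  \<open>V\<close> the volume of one ball. Splitting the integral of \<open>T\<close> according to
  the value of the count gives the series, and dividing by \<open>V\<^sup>2\<close> turns the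
  measures of the level sets \<open>X i\<close> into the fractions.\<close>

theorem weighted_intersection_fractions_sums:
  fixes n :: nat and R :: real
  assumes R: "R > 0"
  defines "N \<equiv> Suc n"
  defines "T \<equiv> 2 * pi\<^sup>2 * (\<Sum>k=1..N. (real k)\<^sup>2) * (unit_ball_vol (4 * n + 5))\<^sup>2 * (R\<^sup>2) ^ (4 * n + 6) / (2 * n + 3)\<^sup>2"
    and "V \<equiv> unit_ball_vol (4 * N + 2) * R ^ (4 * N + 2)"
  shows "(\<lambda>i. real i * intersection_fraction N R i) sums (T / V\<^sup>2)"
proof -
  let ?M = "coeff_space N" and ?P = "coeff_space N \<Otimes>\<^sub>M coeff_space N"
  interpret C: sigma_finite_measure ?M by (rule sigma_finite_coeff_space)
  define B where "B = {c \<in> space ?M. (\<Sum>i\<in>curve_index N. (c i)\<^sup>2) \<le> R\<^sup>2}"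
  define X where "X i = {z \<in> space ?P. fst z \<in> B \<and> snd z \<in> B \<and> crossing_count N (fst z) (snd z) = of_nat i}" for i
  have [measurable]: "B \<in> sets ?M" unfolding B_def by measurable
  have [measurable]: "(\<lambda>z. crossing_count N (fst z) (snd z)) \<in> borel_measurable ?P"
    using measurable_crossing_count by (simp add: split_def)
  have X [measurable]: "X i \<in> sets ?P" for i unfolding X_def by measurable
  have V: "V > 0" using R by (simp add: V_def)
  have T: "T \<ge> 0" unfolding T_def by (intro divide_nonneg_nonneg mult_nonneg_nonneg sum_nonneg) auto
  have BB: "emeasure ?P (B \<times> B) = ennreal (V\<^sup>2)"
    using V unfolding C.emeasure_pair_measure_Times[OF \<open>B \<in> sets ?M\<close> \<open>B \<in> sets ?M\<close>]
    unfolding B_def emeasure_coeff_ball[OF R] V_def[symmetric]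
    by (simp add: ennreal_mult[symmetric] power2_eq_square)
  have ball: "curve_ball N R \<subseteq> curves N" by (auto simp: curve_ball_def)
  have vol: "measure (curve_pair_volume N) (curve_ball N R \<times> curve_ball N R) = V\<^sup>2"
  proof -
    have "{z \<in> space ?P. (curve_of N (fst z), curve_of N (snd z)) \<in> curve_ball N R \<times> curve_ball N R} = B \<times> B"
      using curve_of_in_curve_ball_iff[OF R, of _ N] by (auto simp: B_def space_pair_measure)
    then have "emeasure (curve_pair_volume N) (curve_ball N R \<times> curve_ball N R) = ennreal (V\<^sup>2)"
      using ball by (subst emeasure_curve_pair_volume) (auto simp: BB)
    then show ?thesis by (simp add: measure_def)
  qed
  have frac: "intersection_fraction N R i = measure ?P (X i) / V\<^sup>2" for i
  proof -
    let ?A = "{(f, g) \<in> curve_ball N R \<times> curve_ball N R.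
          finite (intersection_points f g) \<and> card (intersection_points f g) = i}"
    have eq: "{z \<in> space ?P. (curve_of N (fst z), curve_of N (snd z)) \<in> ?A} = X i"
      using curve_of_in_curve_ball_iff[OF R, of _ N]
      by (auto simp: X_def B_def space_pair_measure crossing_count_eq ecount_eq_of_nat_iff)
    have "emeasure (curve_pair_volume N) ?A = emeasure ?P (X i)"
    proof (subst emeasure_curve_pair_volume, unfold eq)
      show "?A \<subseteq> curves N \<times> curves N" using ball by auto
    qed (use X in auto)
    then show ?thesis unfolding intersection_fraction_def vol by (simp add: measure_def)
  qed
  have emX: "emeasure ?P (X i) = ennreal (measure ?P (X i))" for i
  proof -
    have "X i \<subseteq> B \<times> B" by (auto simp: X_def)
    then have "emeasure ?P (X i) \<le> ennreal (V\<^sup>2)"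
      unfolding BB[symmetric] by (intro emeasure_mono) auto
    then show ?thesis by (intro emeasure_eq_ennreal_measure) (auto simp: top_unique)
  qed
  let ?F = "\<lambda>z. indicator (B \<times> B) z * crossing_count N (fst z) (snd z)"
  have int: "(\<integral>\<^sup>+z. ?F z \<partial>?P) = ennreal T"
  proof -
    have "(\<integral>\<^sup>+z. ?F z \<partial>?P) = (\<integral>\<^sup>+c. \<integral>\<^sup>+e. ?F (c, e) \<partial>?M \<partial>?M)"
      by (subst C.nn_integral_fst[symmetric]) auto
    also have "\<dots> = (\<integral>\<^sup>+c. indicator {..R\<^sup>2} (\<Sum>i\<in>curve_index N. (c i)\<^sup>2) *
      (\<integral>\<^sup>+e. indicator {..R\<^sup>2} (\<Sum>i\<in>curve_index N. (e i)\<^sup>2) * crossing_count N c e \<partial>?M) \<partial>?M)"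
    proof (rule nn_integral_cong)
      fix c assume c: "c \<in> space ?M"
      have "(\<integral>\<^sup>+e. ?F (c, e) \<partial>?M) = (\<integral>\<^sup>+e. indicator {..R\<^sup>2} (\<Sum>i\<in>curve_index N. (c i)\<^sup>2) *
          (indicator {..R\<^sup>2} (\<Sum>i\<in>curve_index N. (e i)\<^sup>2) * crossing_count N c e) \<partial>?M)"
        using c by (intro nn_integral_cong) (auto simp: B_def indicator_def)
      also have "\<dots> = indicator {..R\<^sup>2} (\<Sum>i\<in>curve_index N. (c i)\<^sup>2) *
          (\<integral>\<^sup>+e. indicator {..R\<^sup>2} (\<Sum>i\<in>curve_index N. (e i)\<^sup>2) * crossing_count N c e \<partial>?M)"
        by (rule nn_integral_cmult) measurable
      finally show "(\<integral>\<^sup>+e. ?F (c, e) \<partial>?M) = indicator {..R\<^sup>2} (\<Sum>i\<in>curve_index N. (c i)\<^sup>2) *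
          (\<integral>\<^sup>+e. indicator {..R\<^sup>2} (\<Sum>i\<in>curve_index N. (e i)\<^sup>2) * crossing_count N c e \<partial>?M)" .
    qed
    also have "\<dots> = ennreal T"
      unfolding N_def T_def using R by (intro nn_integral_crossing_count_balls) simp
    finally show ?thesis .
  qed
  have "AE z in ?P. ?F z \<noteq> \<infinity>"
    by (rule nn_integral_PInf_AE) (auto simp: int)
  \<comment> \<open>Where the count is a finite number \<open>k\<close>, only the term with index
    \<open>k\<close> survives in the series; outside \<open>B \<times> B\<close> both sides
    vanish.\<close>
  then have "AE z in ?P. ?F z = (\<Sum>i. of_nat i * indicator (X i) z)"
  proof eventually_elim
    case (elim z)
    show ?case
    proof (cases "z \<in> B \<times> B")
      case True
      with elim obtain k where k: "crossing_count N (fst z) (snd z) = of_nat k"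
        by (auto simp: crossing_count_eq emeasure_count_space indicator_def split: if_splits)
      have "z \<in> space ?P" using True by (auto simp: B_def space_pair_measure)
      then have "(\<lambda>i. of_nat i * indicator (X i) z :: ennreal) = (\<lambda>i. if i = k then of_nat k else 0)"
        using True k by (auto simp: X_def indicator_def fun_eq_iff)
      then show ?thesis using True k sums_unique[OF sums_single[of k "\<lambda>_. of_nat k :: ennreal"]] by simp
    next
      case False
      then have "z \<notin> X i" for i by (auto simp: X_def mem_Times_iff)
      with False show ?thesis by simp
    qed
  qed
  then have "ennreal T = (\<integral>\<^sup>+z. (\<Sum>i. of_nat i * indicator (X i) z) \<partial>?P)"
    unfolding int[symmetric] by (rule nn_integral_cong_AE)
  also have "\<dots> = (\<Sum>i. of_nat i * emeasure ?P (X i))"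
    by (subst nn_integral_suminf) (auto simp: nn_integral_cmult_indicator)
  also have "\<dots> = (\<Sum>i. ennreal (real i * measure ?P (X i)))"
    by (simp add: emX ennreal_mult ennreal_of_nat_eq_real_of_nat)
  \<comment> \<open>In \<open>ennreal\<close> every series converges; as its sum \<open>T\<close> is
    a nonnegative real, convergence carries over to the real series.\<close>
  finally have "(\<lambda>i. ennreal (real i * measure ?P (X i))) sums ennreal T"
    by (metis summableI summable_sums)
  then have "(\<lambda>i. real i * measure ?P (X i)) sums T"
    using T by (subst (asm) sums_ennreal) auto
  from sums_divide[OF this, of "V\<^sup>2"] show ?thesis
    by (simp add: frac)
qed

text \<open>With \<open>N = Suc n\<close> and \<open>m = 2 * N\<close>, the two dimensions are
  \<open>2 * m + 1\<close> and \<open>2 * Suc m\<close>. The closed forms for odd and even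
  dimensions carry \<open>pi ^ m\<close> and \<open>pi ^ Suc m\<close>, so the squared quotient
  leaves \<open>1 / pi\<^sup>2\<close>, which cancels the factor \<open>pi\<^sup>2\<close> in front;
  the powers of \<open>R\<close> agree. What survives is a quotient of factorials.\<close>

lemma unit_ball_vol_ratio:
  fixes n :: nat and S R :: real
  assumes R: "R > 0"
  shows "2 * pi\<^sup>2 * S * (unit_ball_vol (4 * n + 5))\<^sup>2 * (R\<^sup>2) ^ (4 * n + 6) / (2 * n + 3)\<^sup>2 /
      (unit_ball_vol (4 * Suc n + 2) * R ^ (4 * Suc n + 2))\<^sup>2 =
    2 ^ (8 * Suc n + 3) * fact (2 * Suc n) ^ 4 / fact (4 * Suc n + 1) ^ 2 * S"
proof -
  define m where "m = 2 * n + 2"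
  have idx: "4 * n + 5 = 2 * m + 1" "4 * n + 6 = 2 * Suc m" "4 * Suc n + 2 = 2 * Suc m" "2 * n + 3 = Suc m"
    "8 * Suc n + 3 = 4 * m + 3" "2 * Suc n = m" "4 * Suc n + 1 = 2 * m + 1"
    by (simp_all add: m_def)
  have odd: "unit_ball_vol (2 * m + 1) = (2 ^ (2 * Suc m) * fact (Suc m)) / fact (2 * Suc m) * pi ^ m"
    by (rule unit_ball_vol_odd)
  have even: "unit_ball_vol (2 * Suc m) = pi ^ Suc m / fact (Suc m)"
    by (rule unit_ball_vol_even)
  have fact2: "fact (2 * Suc m) = 2 * real (Suc m) * fact (2 * m + 1)"
    by (simp add: algebra_simps)
  have fact1: "fact (Suc m) = real (Suc m) * fact m" by simp
  have R2: "(R\<^sup>2) ^ (2 * Suc m) = (R ^ (2 * Suc m))\<^sup>2" by (simp only: power_mult[symmetric] mult.commute)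
  \<comment> \<open>Naming the powers and factorials reduces the claim to an identity of rational
    functions with nonzero denominators.\<close>
  define r where "r = R ^ (2 * Suc m)"
  define P where "P = pi ^ m"
  define F where "F = (fact m :: real)"
  define G where "G = (fact (2 * m + 1) :: real)"
  define s where "s = real (Suc m)"
  define Q where "Q = (2::real) ^ (2 * m)"
  have nz: "r \<noteq> 0" "P \<noteq> 0" "F \<noteq> 0" "G \<noteq> 0" "s \<noteq> 0" using R by (auto simp: r_def P_def F_def G_def s_def)
  have pw: "(2::real) ^ (2 * Suc m) = 4 * Q" "(2::real) ^ (4 * m + 3) = 8 * Q\<^sup>2" "pi ^ Suc m = pi * P"
    by (simp_all add: Q_def P_def power_add power_mult[symmetric] mult.commute)
  have "2 * pi\<^sup>2 * S * ((4 * Q * (s * F)) / (2 * s * G) * P)\<^sup>2 * r\<^sup>2 / s\<^sup>2 / ((pi * P) / (s * F) * r)\<^sup>2 =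
      8 * Q\<^sup>2 * F ^ 4 / G\<^sup>2 * S"
    using nz by (simp add: field_simps power2_eq_square power4_eq_xxxx)
  then show ?thesis
    unfolding idx odd even fact2 R2 pw fact1 unfolding r_def P_def F_def G_def s_def by simp
qed

theorem theorem1:
  fixes N :: nat and R :: real
  assumes "N \<ge> 1" and "R > 0"
  shows "(\<lambda>i. real i * intersection_fraction N R i) sums
           (2 ^ (8 * N + 3) * fact (2 * N) ^ 4 / fact (4 * N + 1) ^ 2 * (\<Sum>k=1..N. real k ^ 2))"
proof -
  obtain n where "N = Suc n" using \<open>N \<ge> 1\<close> by (cases N) auto
  then show ?thesis using weighted_intersection_fractions_sums[OF \<open>R > 0\<close>, of n] unit_ball_vol_ratio[OF \<open>R > 0\<close>] by simp
qed

end
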